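(* Let $m_1,m_2,m_3>0$ and let $q=(q_1,q_2,q_3):[0,T]\to\Sigma\setminus\{0\}$ be a (continuous) piecewise smooth planar three-body motion, with angular momentum $J(t)$, moment of inertia $I(t)$, and projected curve $\gamma(t)$ on the shape sphere $S$. (i) Assume $q_1(0)\neq 0$ and $q_1(T)\neq 0$. Then the angle of rotation $\Delta\theta$ from $q_1(0)$ to $q_1(T)$ (the difference of their polar angles) satisfies $$\Delta\theta=\int_0^T\frac{J(t)}{I(t)}\,dt+2\int_{D_\gamma}\Omega_0 \pmod{2\pi},$$ where $D_\gamma$ is a disk on the shape sphere bounded by the three curves: $\gamma$, the geodesic from $\gamma(0)$ to $C_1$, and the geodesic from $\gamma(T)$ to $C_1$. (ii) Assume $q_3(0)-q_2(0)\neq 0$ and $q_3(T)-q_2(T)\ne 0$. Then the angle of rotation $\Delta\theta'$ from $q_3(0)-q_2(0)$ to $q_3(T)-q_2(T)$ satisfies $$\Delta\theta'=\int_0^T\frac{J(t)}{I(t)}\,dt+2\int_{D'_\gamma}\Omega_0 \pmod{2\pi},$$ where $D'_\gamma$ is a disk on the shape sphere bounded by the three curves: $\gamma$, the geodesic from $\gamma(0)$ to $O_1$, and the geodesic from $\gamma(T)$ to $O_1$.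
   Context: Configuration space: $\Sigma=\{q=(q_1,q_2,q_3)\in\mathbb{C}^3 : \sum_{i=1}^3 m_iq_i=0\}$. Moment of inertia $I=\sum_i m_i|q_i|^2$; angular momentum $J=\sum_i m_i\,\mathrm{Im}(\overline{q_i}\,\dot q_i)$. Normalized Jacobi coordinates: $Z_1=\mu_1(q_3-q_2)$, $Z_2=\mu_2\big(q_1-\frac{m_2q_2+m_3q_3}{m_2+m_3}\big)$, with $\mu_1,\mu_2>0$, $\frac1{\mu_1^2}=\frac1{m_2}+\frac1{m_3}$, $\frac1{\mu_2^2}=\frac1{m_1}+\frac1{m_2+m_3}$. (Note that $Z_2$ is a positive multiple of $q_1$ on $\Sigma$.) Shape space projection: $\pi:\Sigma\to\mathbb{R}^3$, $\pi(q)=(\omega_1,\omega_2,\omega_3)$ where $\omega_1=\frac12(|Z_1|^2-|Z_2|^2)$ and $\omega_2+\sqrt{-1}\,\omega_3=\overline{Z_1}Z_2$. One has $|\pi(q)|=\frac12 I$. The shape sphere is $S=\{\omega\in\mathbb{R}^3: |\omega|=\frac12\}$ (the locus $I=1$), and the projected curve of $q$ on $S$ is $\gamma(t)=\pi(q(t))/I(t)$. Marked points: $C_1=(-\frac12,0,0)$ (shape of the collision $q_2=q_3$) and $O_1=(\frac12,0,0)$ (shape with $q_1=0$). Geodesics are minimizing great-circle arcs on $S$ (constant if the endpoints coincide). $\Omega_0$ is the standard area form of the round sphere $S$ of radius $\frac12$ (total area $\pi$), with sign chosen so that the area of a disk is positive when its boundary curve rotates clockwise as seen from outside $S$. The boundary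 of $D_\gamma$ is the closed curve $C_1\to\gamma(0)$ (geodesic), then $\gamma$ from $\gamma(0)$ to $\gamma(T)$, then $\gamma(T)\to C_1$ (geodesic); $\int_{D_\gamma}\Omega_0$ is the signed area of any (piecewise smooth, not necessarily embedded) disk in $S$ with this boundary, which is well defined modulo $\pi$. The same convention holds for $D'_\gamma$ with $O_1$ in place of $C_1$. Angles differing by $2k\pi$, $k\in\mathbb{Z}$, are regarded as the same. *)

theory Defs
  imports "HOL-Analysis.Analysis" "HOL-Library.Real_Mod"
begin

unbundle cross3_syntax

section \<open>Planar three-body configurations\<close>

text \<open>A configuration is \<open>q :: complex ^ 3\<close>, the masses are \<open>m :: real ^ 3\<close>.\<close>

definition config_space :: "real ^ 3 \<Rightarrow> (complex ^ 3) set" where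
  "config_space m = {q. (\<Sum>i\<in>UNIV. m $ i *\<^sub>R q $ i) = 0}"

definition inertia :: "real ^ 3 \<Rightarrow> complex ^ 3 \<Rightarrow> real" where
  "inertia m q = (\<Sum>i\<in>UNIV. m $ i * (cmod (q $ i))\<^sup>2)"

definition angular_momentum :: "real ^ 3 \<Rightarrow> (real \<Rightarrow> complex ^ 3) \<Rightarrow> real \<Rightarrow> real" where
  "angular_momentum m q t =
     (\<Sum>i\<in>UNIV. m $ i * Im (cnj (q t $ i) * vector_derivative q (at t) $ i))"

text \<open>Continuous on \<open>{a..b}\<close>, and continuously differentiable (one-sided at the end points) on
  each closed interval between consecutive points of a finite subdivision.
  This is stronger than \<open>f piecewise_C1_differentiable_on {a..b}\<close>, which does not require the
  derivative to have one-sided limits at the break points.\<close>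

definition piecewise_smooth_curve :: "real \<Rightarrow> real \<Rightarrow> (real \<Rightarrow> 'a::real_normed_vector) \<Rightarrow> bool" where
  "piecewise_smooth_curve a b f \<longleftrightarrow>
     continuous_on {a..b} f \<and>
     (\<exists>B. finite B \<and> {a, b} \<subseteq> B \<and> B \<subseteq> {a..b} \<and>
        (\<forall>u\<in>B. \<forall>v\<in>B. u < v \<and> {u<..<v} \<inter> B = {} \<longrightarrow>
           (\<exists>f'. continuous_on {u..v} f' \<and>
              (\<forall>t\<in>{u..v}. (f has_vector_derivative f' t) (at t within {u..v})))))"

section \<open>Jacobi coordinates and the shape sphere\<close>

definition mu1 :: "real ^ 3 \<Rightarrow> real" where
  "mu1 m = 1 / sqrt (1 / m $ 2 + 1 / m $ 3)"

definition mu2 :: "real ^ 3 \<Rightarrow> real" where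
  "mu2 m = 1 / sqrt (1 / m $ 1 + 1 / (m $ 2 + m $ 3))"

definition jacobi1 :: "real ^ 3 \<Rightarrow> complex ^ 3 \<Rightarrow> complex" where
  "jacobi1 m q = mu1 m *\<^sub>R (q $ 3 - q $ 2)"

definition jacobi2 :: "real ^ 3 \<Rightarrow> complex ^ 3 \<Rightarrow> complex" where
  "jacobi2 m q =
     mu2 m *\<^sub>R (q $ 1 - (m $ 2 *\<^sub>R q $ 2 + m $ 3 *\<^sub>R q $ 3) /\<^sub>R (m $ 2 + m $ 3))"

definition shape_proj :: "real ^ 3 \<Rightarrow> complex ^ 3 \<Rightarrow> real ^ 3" where
  "shape_proj m q =
     (let Z1 = jacobi1 m q; Z2 = jacobi2 m q
      in vector [((cmod Z1)\<^sup>2 - (cmod Z2)\<^sup>2) / 2, Re (cnj Z1 * Z2), Im (cnj Z1 * Z2)])"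

definition shape_curve :: "real ^ 3 \<Rightarrow> (real \<Rightarrow> complex ^ 3) \<Rightarrow> real \<Rightarrow> real ^ 3" where
  "shape_curve m q t = shape_proj m (q t) /\<^sub>R inertia m (q t)"

definition shape_sphere :: "(real ^ 3) set" where
  "shape_sphere = sphere 0 (1/2)"

definition C1_pt :: "real ^ 3" where
  "C1_pt = vector [-1/2, 0, 0]"

definition O1_pt :: "real ^ 3" where
  "O1_pt = vector [1/2, 0, 0]"

text \<open>Minimizing great-circle arcs from \<open>a\<close> to \<open>b\<close>, parametrized on \<open>{0..1}\<close> with constant
  speed: \<open>2 *\<^sub>R a\<close> and \<open>2 *\<^sub>R e\<close> are orthonormal, \<open>\<phi>\<close> is the angle swept out, and the
  arc is minimizing since \<open>\<phi> \<le> pi\<close>.\<close>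

definition geodesic_arc :: "real ^ 3 \<Rightarrow> real ^ 3 \<Rightarrow> (real \<Rightarrow> real ^ 3) \<Rightarrow> bool" where
  "geodesic_arc a b g \<longleftrightarrow>
     a \<in> shape_sphere \<and> g 1 = b \<and>
     (\<exists>e \<phi>. e \<in> shape_sphere \<and> a \<bullet> e = 0 \<and> 0 \<le> \<phi> \<and> \<phi> \<le> pi \<and>
        (\<forall>u\<in>{0..1}. g u = cos (\<phi> * u) *\<^sub>R a + sin (\<phi> * u) *\<^sub>R e))"

section \<open>Disks on the shape sphere and their signed area\<close>

text \<open>The outer unit normal at \<open>\<omega>\<close> is \<open>2 *\<^sub>R \<omega>\<close>; the minus sign makes the area of a disk
  positive when its boundary runs clockwise as seen from outside.\<close>

definition area_form :: "real ^ 3 \<Rightarrow> real ^ 3 \<Rightarrow> real ^ 3 \<Rightarrow> real" where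
  "area_form \<omega> u v = - ((2 *\<^sub>R \<omega>) \<bullet> (u \<times> v))"

text \<open>The closed unit square serves as the parameter domain of disks;
  \<open>square_boundary\<close> runs once counterclockwise around it.\<close>

definition unit_square :: "(real \<times> real) set" where
  "unit_square = cbox (0, 0) (1, 1)"

definition square_boundary :: "real \<Rightarrow> real \<times> real" where
  "square_boundary =
     linepath (0, 0) (1, 0) +++ linepath (1, 0) (1, 1) +++
     linepath (1, 1) (0, 1) +++ linepath (0, 1) (0, 0)"

text \<open>\<open>K\<close> is a finite union of compact pieces (with frontiers of measure zero, as for the cells
  of a triangulation), and on each piece \<open>F\<close> is the restriction of a continuously
  differentiable map defined on a neighbourhood of the piece.\<close>

definition piecewise_smooth_on ::
  "('a::euclidean_space \<Rightarrow> 'b::euclidean_space) \<Rightarrow> 'a set \<Rightarrow> bool" where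
  "piecewise_smooth_on F K \<longleftrightarrow>
     continuous_on K F \<and>
     (\<exists>\<P>. finite \<P> \<and> \<Union>\<P> = K \<and>
        (\<forall>P\<in>\<P>. compact P \<and> negligible (frontier P) \<and>
           (\<exists>U g g'. open U \<and> P \<subseteq> U \<and>
              (\<forall>x\<in>U. (g has_derivative blinfun_apply (g' x)) (at x)) \<and>
              continuous_on U g' \<and> (\<forall>x\<in>P. F x = g x))))"

text \<open>\<open>F\<close> is a piecewise smooth, not necessarily embedded, disk on the sphere whose boundary,
  up to an orientation-preserving reparametrization \<open>\<phi>\<close>, is the closed curve \<open>c\<close>.
  Intervals on which \<open>\<phi>\<close> is constant are allowed; for example, a null-homotopy of \<open>c\<close>
  with fixed base point is such a disk.\<close>

definition disk_bounded_by :: "(real \<times> real \<Rightarrow> real ^ 3) \<Rightarrow> (real \<Rightarrow> real ^ 3) \<Rightarrow> bool" where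
  "disk_bounded_by F c \<longleftrightarrow>
     F ` unit_square \<subseteq> shape_sphere \<and> piecewise_smooth_on F unit_square \<and>
     (\<exists>\<phi>. continuous_on {0..1} \<phi> \<and> mono_on {0..1} \<phi> \<and> \<phi> 0 = 0 \<and> \<phi> 1 = (1::real) \<and>
        (\<forall>u\<in>{0..1}. F (square_boundary u) = c (\<phi> u)))"

text \<open>The integral over the square of the pullback of the area form along \<open>F\<close>, which is
  differentiable almost everywhere.\<close>

definition signed_area :: "(real \<times> real \<Rightarrow> real ^ 3) \<Rightarrow> real" where
  "signed_area F = integral unit_square
     (\<lambda>z. area_form (F z) (frechet_derivative F (at z) (1, 0)) (frechet_derivative F (at z) (0, 1)))"

text \<open>The closed curve that runs along \<open>g0\<close>, then along \<open>\<gamma>\<close> from \<open>\<gamma> 0\<close> to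
  \<open>\<gamma> T\<close>, and back along \<open>g1\<close>.\<close>

definition closed_up_curve ::
  "(real \<Rightarrow> real ^ 3) \<Rightarrow> (real \<Rightarrow> real ^ 3) \<Rightarrow> real \<Rightarrow> (real \<Rightarrow> real ^ 3) \<Rightarrow> real \<Rightarrow> real ^ 3" where
  "closed_up_curve g0 \<gamma> T g1 = g0 +++ (\<lambda>u. \<gamma> (T * u)) +++ g1"

text \<open>\<open>D\<close> is a disk bounded by \<open>\<gamma>\<close> on \<open>{0..T}\<close> and the geodesics joining its end points
  to \<open>P\<close>, with the boundary orientation \<open>P \<rightarrow> \<gamma> 0 \<rightarrow> \<gamma> T \<rightarrow> P\<close>.\<close>

definition spanning_disk ::
  "real ^ 3 \<Rightarrow> (real \<Rightarrow> real ^ 3) \<Rightarrow> real \<Rightarrow> (real \<times> real \<Rightarrow> real ^ 3) \<Rightarrow> bool" where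
  "spanning_disk P \<gamma> T D \<longleftrightarrow>
     (\<exists>g0 g1. geodesic_arc P (\<gamma> 0) g0 \<and> geodesic_arc (\<gamma> T) P g1 \<and>
        disk_bounded_by D (closed_up_curve g0 \<gamma> T g1))"

end

theory Submission
  imports Defs
begin

text \<open>
  The shape sphere is the projective line: the Jacobi coordinates \<open>z = (Z\<^sub>1, Z\<^sub>2)\<close> send a nonzero
  configuration to a nonzero vector of \<open>\<complex>\<^sup>2\<close>, and the shape projection is the Hopf map of that
  vector. With the Hermitian product \<open>\<langle>a, b\<rangle>\<close>, conjugate linear in \<open>a\<close>, one has \<open>I = \<langle>z, z\<rangle>\<close> and
  \<open>J = Im \<langle>z, z'\<rangle>\<close> (lemma \<open>herm_jacobi\<close>). Call a lift \<open>\<zeta>\<close> of a curve on the sphere horizontal if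
  \<open>Im \<langle>\<zeta>, \<zeta>'\<rangle> = 0\<close>. Turning \<open>z\<close> by the angle \<open>- \<integral> J / I\<close> makes it a horizontal lift of the shape
  curve (lemma \<open>motion_horizontal_lift\<close>).

  Let \<open>p\<close> be the unit coordinate vector above the base point of the disk, so that \<open>\<langle>p, z\<rangle>\<close> is a
  positive multiple of \<open>q\<^sub>1\<close> (base point \<open>C\<^sub>1\<close>) or of \<open>q\<^sub>3 - q\<^sub>2\<close> (base point \<open>O\<^sub>1\<close>). A geodesic from
  the base point has the horizontal lift \<open>cos x p + sin x p'\<close> with \<open>p'\<close> orthogonal to \<open>p\<close>, along
  which \<open>\<langle>p, \<zeta>\<rangle>\<close> keeps a constant phase. So the two geodesics do not change the phase of \<open>\<langle>p, \<zeta>\<rangle>\<close>, and the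
  closed boundary curve has a horizontal lift from a multiple of \<open>p\<close> to another multiple of \<open>p\<close>,
  the ratio of which has phase \<open>\<Delta>\<theta> - \<integral> J / I\<close>. It remains to see that this holonomy is
  \<open>exp (2 i A)\<close> with \<open>A\<close> the signed area of the disk (theorem \<open>disk_holonomy\<close>).

  A disk may be just Lipschitz across its pieces, and its boundary may be reparametrized in a way
  that is not absolutely continuous, so the holonomy is computed by a discrete form of Stokes'
  theorem. Choose unit lifts at the vertices of an \<open>n \<times> n\<close> grid in the square and give every edge the phase
  of the product of its two end vectors. The product of these phases around all cells equals the
  product along the boundary of the square, since inner edges cancel (\<open>grid_product_telescope\<close>).
  Around a small triangle the product has phase \<open>2 det (\<omega>\<^sub>1, \<omega>\<^sub>2, \<omega>\<^sub>3)\<close> up to fourth order in the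
  diameter (\<open>triangle_phase_estimate\<close>); the sum of the determinants is an integral of step
  functions that converge to minus the area form almost everywhere (\<open>cell_area_sum_tendsto\<close>). Along the
  boundary, the phases of a horizontal lift are trivial up to second order in the step, so their
  product tends to 1 and only the change of lift between the two ends survives
  (\<open>gauge_phase_product\<close>).
\<close>

(* The symbol \<times> is kept for products of sets; cross products are written cross3. *)
unbundle no cross3_syntax

section \<open>The Hermitian product and the Hopf map\<close>

definition herm :: "complex \<times> complex \<Rightarrow> complex \<times> complex \<Rightarrow> complex" where
  "herm a b = cnj (fst a) * fst b + cnj (snd a) * snd b"

text \<open>Twice \<open>hopf a\<close> is, for a unit vector \<open>a\<close>, the Bloch vector of the projection onto the line
  of \<open>a\<close>, with the axes permuted cyclically.\<close>

definition hopf :: "complex \<times> complex \<Rightarrow> real ^ 3" where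
  "hopf a = vector [((cmod (fst a))\<^sup>2 - (cmod (snd a))\<^sup>2) / 2,
                    Re (cnj (fst a) * snd a), Im (cnj (fst a) * snd a)]"

lemma norm_pair_sq: "(norm a)\<^sup>2 = (cmod (fst a))\<^sup>2 + (cmod (snd a))\<^sup>2"
  for a :: "complex \<times> complex"
  by (cases a) (simp add: norm_Pair)

lemma herm_self: "herm a a = (norm a)\<^sup>2"
  by (simp only: norm_pair_sq)
     (simp add: herm_def complex_eq_iff cmod_power2, simp add: power2_eq_square)

lemma herm_commute: "herm b a = cnj (herm a b)"
  by (simp add: herm_def mult.commute)

lemma Re_herm: "Re (herm a b) = inner a b"
  by (simp add: herm_def inner_prod_def inner_complex_def)

lemma herm_simps:
  "herm (a + b) c = herm a c + herm b c" "herm a (b + c) = herm a b + herm a c"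
  "herm (a - b) c = herm a c - herm b c" "herm a (b - c) = herm a b - herm a c"
  by (simp_all add: herm_def algebra_simps)

lemma norm_herm_le: "cmod (herm a b) \<le> 2 * norm a * norm b"
proof -
  have "cmod (cnj (fst a) * fst b) \<le> norm a * norm b" "cmod (cnj (snd a) * snd b) \<le> norm a * norm b"
    by (cases a; cases b; simp add: norm_mult mult_mono norm_fst_le norm_snd_le)+
  then show ?thesis
    unfolding herm_def using norm_triangle_ineq[of "cnj (fst a) * fst b" "cnj (snd a) * snd b"] by linarith
qed

text \<open>The rank one matrix \<open>a a\<^sup>*\<close> has entries that are linear in \<open>hopf a\<close> and \<open>(norm a)\<^sup>2\<close>. Cyclic products
  of Hermitian products are traces of products of such matrices, so the identities below reduce to
  polynomial identities of low degree.\<close>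

lemma gram_entries:
  "cnj (fst x) * fst x = Complex ((norm x)\<^sup>2 / 2 + hopf x $ 1) 0"
  "cnj (snd x) * snd x = Complex ((norm x)\<^sup>2 / 2 - hopf x $ 1) 0"
  "cnj (fst x) * snd x = Complex (hopf x $ 2) (hopf x $ 3)"
  "cnj (snd x) * fst x = Complex (hopf x $ 2) (- hopf x $ 3)"
  unfolding norm_pair_sq
  by (simp_all add: complex_eq_iff hopf_def cmod_power2) (simp_all add: power2_eq_square field_simps)

lemma norm_herm_sq:
  "(cmod (herm a b))\<^sup>2 = (norm a)\<^sup>2 * (norm b)\<^sup>2 / 2 + 2 * (hopf a \<bullet> hopf b)"
proof -
  have "(cmod (herm a b))\<^sup>2 = Re (herm a b * herm b a)"
    by (simp add: herm_commute[of a b] cmod_power2) (simp add: power2_eq_square)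
  also have "herm a b * herm b a =
      (cnj (fst a) * fst a) * (cnj (fst b) * fst b) + (cnj (snd a) * fst a) * (cnj (fst b) * snd b)
    + (cnj (fst a) * snd a) * (cnj (snd b) * fst b) + (cnj (snd a) * snd a) * (cnj (snd b) * snd b)"
    unfolding herm_def by (simp add: distrib_left distrib_right mult_ac add_ac)
  finally show ?thesis
    unfolding gram_entries by (simp add: inner_vec_def sum_3 field_simps)
qed

text \<open>The cyclic product is invariant under changes of phase of the three vectors. Its argument is the
  holonomy around the geodesic triangle; the triple product in the imaginary part is where area
  comes from.\<close>

lemma herm_triangle:
  "Im (herm a b * herm b c * herm c a) = 2 * (hopf a \<bullet> cross3 (hopf b) (hopf c))" (is ?Im)
  "Re (herm a b * herm b c * herm c a) =
     (norm a * norm b * norm c)\<^sup>2 / 4 + (norm c)\<^sup>2 * (hopf a \<bullet> hopf b)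
       + (norm a)\<^sup>2 * (hopf b \<bullet> hopf c) + (norm b)\<^sup>2 * (hopf a \<bullet> hopf c)" (is ?Re)
proof -
  have T: "herm a b * herm b c * herm c a =
      (cnj (fst a) * fst a) * (cnj (fst b) * fst b) * (cnj (fst c) * fst c)
    + (cnj (fst a) * snd a) * (cnj (fst b) * fst b) * (cnj (snd c) * fst c)
    + (cnj (fst a) * fst a) * (cnj (snd b) * fst b) * (cnj (fst c) * snd c)
    + (cnj (fst a) * snd a) * (cnj (snd b) * fst b) * (cnj (snd c) * snd c)
    + (cnj (snd a) * fst a) * (cnj (fst b) * snd b) * (cnj (fst c) * fst c)
    + (cnj (snd a) * snd a) * (cnj (fst b) * snd b) * (cnj (snd c) * fst c)
    + (cnj (snd a) * fst a) * (cnj (snd b) * snd b) * (cnj (fst c) * snd c)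
    + (cnj (snd a) * snd a) * (cnj (snd b) * snd b) * (cnj (snd c) * snd c)"
    unfolding herm_def by (simp only: distrib_left distrib_right mult_ac add_ac)
  show ?Im
    unfolding T gram_entries by (simp add: inner_vec_def sum_3 cross3_def) (simp add: field_simps)
  show ?Re
    unfolding T gram_entries power_mult_distrib by (simp add: inner_vec_def sum_3) (simp add: field_simps)
qed

text \<open>Any nonzero vector of the complex line over \<open>\<omega>\<close> counts as a lift, so the moving Jacobi vector need not
  be normalized.\<close>

definition lifts :: "complex \<times> complex \<Rightarrow> real ^ 3 \<Rightarrow> bool" where
  "lifts a \<omega> \<longleftrightarrow> a \<noteq> 0 \<and> hopf a = (norm a)\<^sup>2 *\<^sub>R \<omega>"

text \<open>The product type carries only the scaling by reals.\<close>

definition scaleC2 :: "complex \<Rightarrow> complex \<times> complex \<Rightarrow> complex \<times> complex" where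
  "scaleC2 c a = (c * fst a, c * snd a)"

lemma fst_scaleC2 [simp]: "fst (scaleC2 c a) = c * fst a"
  and snd_scaleC2 [simp]: "snd (scaleC2 c a) = c * snd a"
  by (simp_all add: scaleC2_def)

lemma herm_scaleC2 [simp]:
  "herm (scaleC2 c a) b = cnj c * herm a b" "herm a (scaleC2 c b) = c * herm a b"
  by (simp_all add: herm_def algebra_simps)

lemma norm_scaleC2 [simp]: "norm (scaleC2 c a) = cmod c * norm a"
proof -
  have "(norm (scaleC2 c a))\<^sup>2 = (cmod c * norm a)\<^sup>2"
    unfolding norm_pair_sq power_mult_distrib by (simp add: norm_mult power_mult_distrib algebra_simps)
  then show ?thesis by simp
qed

lemma scaleC2_eq_0_iff [simp]: "scaleC2 c a = 0 \<longleftrightarrow> c = 0 \<or> a = 0"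
  by (metis mult_eq_0_iff norm_eq_zero norm_scaleC2)

lemma scaleC2_diff: "scaleC2 c a - scaleC2 c b = scaleC2 c (a - b)"
  by (simp add: scaleC2_def prod_eq_iff algebra_simps)

lemma hopf_scaleC2: "hopf (scaleC2 c a) = (cmod c)\<^sup>2 *\<^sub>R hopf a"
  by (simp add: hopf_def vec_eq_iff forall_3 norm_mult power_mult_distrib cmod_power2)
     (simp add: field_simps power2_eq_square)

lemma lifts_scaleC2: "lifts a \<omega> \<Longrightarrow> c \<noteq> 0 \<Longrightarrow> lifts (scaleC2 c a) \<omega>"
  by (simp add: lifts_def hopf_scaleC2 power_mult_distrib)

lemma mem_shape_sphere: "\<omega> \<in> shape_sphere \<longleftrightarrow> \<omega> \<bullet> \<omega> = 1/4"
proof -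
  have "(1/4 :: real) = (1/2)\<^sup>2" by (simp add: power2_eq_square)
  then show ?thesis
    by (simp only: shape_sphere_def mem_sphere_0 dot_square_norm power2_eq_iff_nonneg norm_ge_zero)
qed

text \<open>The fibres of the Hopf map are complex lines: over the same point of the sphere, \<open>norm_herm_sq\<close>
  gives equality in the Cauchy--Schwarz inequality.\<close>

lemma lifts_collinear:
  assumes "lifts a \<omega>" "lifts b \<omega>" "\<omega> \<in> shape_sphere"
  obtains l where "l \<noteq> 0" "b = scaleC2 l a"
proof -
  have w: "\<omega> \<bullet> \<omega> = 1/4"
    using assms(3) by (simp add: mem_shape_sphere)
  have a: "(norm a)\<^sup>2 > 0" "a \<noteq> 0" and b: "b \<noteq> 0"
    using assms by (simp_all add: lifts_def)
  have h: "(cmod (herm a b))\<^sup>2 = (norm a)\<^sup>2 * (norm b)\<^sup>2"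
    unfolding norm_herm_sq using assms(1,2) by (simp add: lifts_def w)
  have "(cmod (fst a * snd b - snd a * fst b))\<^sup>2 = (norm a)\<^sup>2 * (norm b)\<^sup>2 - (cmod (herm a b))\<^sup>2"
    unfolding norm_pair_sq herm_def by (simp add: cmod_power2) (simp add: field_simps power2_eq_square)
  with h have *: "fst a * snd b = snd a * fst b" by simp
  define l where "l = herm a b / (norm a)\<^sup>2"
  have "herm a a * fst b = herm a b * fst a" "herm a a * snd b = herm a b * snd a"
    using * by (simp_all add: herm_def algebra_simps)
  then have "b = scaleC2 l a"
    using a unfolding herm_self l_def by (auto simp: prod_eq_iff field_simps)
  moreover have "l \<noteq> 0" using h a b by (auto simp: l_def)
  ultimately show ?thesis using that by blast
qed

lemma ex_unit_lift:
  assumes "\<omega> \<in> shape_sphere"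
  obtains a where "norm a = 1" "lifts a \<omega>"
proof -
  have "\<omega> \<bullet> \<omega> = 1/4"
    using assms by (simp add: mem_shape_sphere)
  then have w: "(\<omega> $ 1)\<^sup>2 + (\<omega> $ 2)\<^sup>2 + (\<omega> $ 3)\<^sup>2 = 1/4"
    by (simp add: inner_vec_def sum_3 power2_eq_square)
  show ?thesis
  proof (cases "\<omega> $ 1 = - 1/2")
    case True
    then have "(\<omega> $ 1)\<^sup>2 = 1/4" by (simp add: power_divide)
    with w have "(\<omega> $ 2)\<^sup>2 + (\<omega> $ 3)\<^sup>2 = 0" by linarith
    then have "\<omega> $ 2 = 0" "\<omega> $ 3 = 0" by (simp_all only: sum_power2_eq_zero_iff)
    with True show ?thesis
      by (intro that[of "(0, 1)"]) (simp_all add: lifts_def hopf_def norm_Pair vec_eq_iff forall_3 zero_prod_def)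
  next
    case False
    have quarter: "(1/2)\<^sup>2 = (1/4 :: real)" by (simp add: power2_eq_square)
    have "\<bar>\<omega> $ 1\<bar> \<le> 1/2" 
    proof (rule power2_le_imp_le[where x = "\<bar>\<omega> $ 1\<bar>"])
      show "\<bar>\<omega> $ 1\<bar>\<^sup>2 \<le> (1/2)\<^sup>2"
        unfolding power2_abs quarter
        using w zero_le_power2[of "\<omega> $ 2"] zero_le_power2[of "\<omega> $ 3"] by linarith
    qed simp
    with False have p: "1/2 + \<omega> $ 1 > 0" by simp
    \<comment> \<open>The lift with positive first coordinate; it exists away from the pole treated above.\<close>
    define r where "r = sqrt (1/2 + \<omega> $ 1)"
    have r: "r > 0" "r\<^sup>2 = 1/2 + \<omega> $ 1" using p by (simp_all add: r_def)
    define a where "a = (complex_of_real r, Complex (\<omega> $ 2) (\<omega> $ 3) / r)"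
    have "(cmod (snd a))\<^sup>2 = ((\<omega> $ 2)\<^sup>2 + (\<omega> $ 3)\<^sup>2) / r\<^sup>2"
      by (simp add: a_def norm_divide power_divide cmod_power2)
    also have "\<dots> = 1/2 - \<omega> $ 1"
      using p w unfolding r(2) by (simp add: field_simps power2_eq_square)
    finally have s: "(cmod (snd a))\<^sup>2 = 1/2 - \<omega> $ 1" .
    have f: "(cmod (fst a))\<^sup>2 = 1/2 + \<omega> $ 1" using r by (simp add: a_def)
    have n: "(norm a)\<^sup>2 = 1" unfolding norm_pair_sq s f by simp
    then have "norm a = 1" 
      by (metis norm_ge_zero one_power2 power2_eq_iff_nonneg zero_le_one)
    moreover have "hopf a = \<omega>"
      unfolding hopf_def s f using r by (simp add: vec_eq_iff forall_3 a_def)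
    moreover have "a \<noteq> 0" using calculation by auto
    ultimately show ?thesis by (intro that[of a]) (auto simp: lifts_def)
  qed
qed

section \<open>Horizontal lifts and their phases\<close>

text \<open>A form of \<open>Im \<langle>\<zeta>, \<zeta>'\<rangle> = 0\<close> that speaks of increments and not of derivatives. It holds across
  corners, and it is exactly what bounds the phases along a fine partition: each step \<open>t - s\<close>
  contributes a phase of order \<open>(t - s)\<^sup>2\<close>.\<close>

definition horizontal_lift ::
  "(real \<Rightarrow> real ^ 3) \<Rightarrow> real \<Rightarrow> real \<Rightarrow> (real \<Rightarrow> complex \<times> complex) \<Rightarrow> bool" where
  "horizontal_lift c a b \<zeta> \<longleftrightarrow>
     (\<forall>t\<in>{a..b}. lifts (\<zeta> t) (c t)) \<and>
     (\<exists>C. \<forall>s\<in>{a..b}. \<forall>t\<in>{a..b}. s \<le> t \<longrightarrow>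
        norm (\<zeta> t - \<zeta> s) \<le> C * (t - s) \<and> \<bar>Im (herm (\<zeta> s) (\<zeta> t))\<bar> \<le> C * (t - s)\<^sup>2)"

lemma horizontal_liftE:
  assumes "horizontal_lift c a b \<zeta>"
  obtains C where "C > 0"
    "\<And>s t. s \<in> {a..b} \<Longrightarrow> t \<in> {a..b} \<Longrightarrow> s \<le> t \<Longrightarrow> norm (\<zeta> t - \<zeta> s) \<le> C * (t - s)"
    "\<And>s t. s \<in> {a..b} \<Longrightarrow> t \<in> {a..b} \<Longrightarrow> s \<le> t \<Longrightarrow> \<bar>Im (herm (\<zeta> s) (\<zeta> t))\<bar> \<le> C * (t - s)\<^sup>2"
proof -
  obtain C where C: "\<forall>s\<in>{a..b}. \<forall>t\<in>{a..b}. s \<le> t \<longrightarrow>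
        norm (\<zeta> t - \<zeta> s) \<le> C * (t - s) \<and> \<bar>Im (herm (\<zeta> s) (\<zeta> t))\<bar> \<le> C * (t - s)\<^sup>2"
    using assms unfolding horizontal_lift_def by blast
  have le: "C * (t - s) \<le> (\<bar>C\<bar> + 1) * (t - s)" "C * (t - s)\<^sup>2 \<le> (\<bar>C\<bar> + 1) * (t - s)\<^sup>2" if "s \<le> t" for s t
    using that by (auto intro!: mult_right_mono)
  show thesis
  proof (rule that[of "\<bar>C\<bar> + 1"])
    fix s t assume st: "s \<in> {a..b}" "t \<in> {a..b}" "s \<le> t"
    with C have "norm (\<zeta> t - \<zeta> s) \<le> C * (t - s)" "\<bar>Im (herm (\<zeta> s) (\<zeta> t))\<bar> \<le> C * (t - s)\<^sup>2" by blast+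
    with le[OF st(3)] show "norm (\<zeta> t - \<zeta> s) \<le> (\<bar>C\<bar> + 1) * (t - s)"
      "\<bar>Im (herm (\<zeta> s) (\<zeta> t))\<bar> \<le> (\<bar>C\<bar> + 1) * (t - s)\<^sup>2" by (blast intro: order_trans)+
  qed simp
qed

lemma horizontal_lift_lifts: "horizontal_lift c a b \<zeta> \<Longrightarrow> t \<in> {a..b} \<Longrightarrow> lifts (\<zeta> t) (c t)"
  by (simp add: horizontal_lift_def)

lemma horizontal_lift_scaleC2:
  assumes "horizontal_lift c a b \<zeta>" "l \<noteq> 0"
  shows "horizontal_lift c a b (\<lambda>t. scaleC2 l (\<zeta> t))"
proof -
  obtain C where C: "C > 0"
    "\<And>s t. s \<in> {a..b} \<Longrightarrow> t \<in> {a..b} \<Longrightarrow> s \<le> t \<Longrightarrow> norm (\<zeta> t - \<zeta> s) \<le> C * (t - s)"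
    "\<And>s t. s \<in> {a..b} \<Longrightarrow> t \<in> {a..b} \<Longrightarrow> s \<le> t \<Longrightarrow> \<bar>Im (herm (\<zeta> s) (\<zeta> t))\<bar> \<le> C * (t - s)\<^sup>2"
    using horizontal_liftE[OF assms(1)] by metis
  define K where "K = max (cmod l) ((cmod l)\<^sup>2)"
  have "norm (scaleC2 l (\<zeta> t) - scaleC2 l (\<zeta> s)) \<le> K * C * (t - s) \<and>
        \<bar>Im (herm (scaleC2 l (\<zeta> s)) (scaleC2 l (\<zeta> t)))\<bar> \<le> K * C * (t - s)\<^sup>2"
    if st: "s \<in> {a..b}" "t \<in> {a..b}" "s \<le> t" for s t
  proof
    have "norm (scaleC2 l (\<zeta> t) - scaleC2 l (\<zeta> s)) = cmod l * norm (\<zeta> t - \<zeta> s)"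
      by (simp add: scaleC2_diff)
    also have "\<dots> \<le> K * (C * (t - s))"
      using C(2)[OF st] by (intro mult_mono) (auto simp: K_def max_def)
    finally show "norm (scaleC2 l (\<zeta> t) - scaleC2 l (\<zeta> s)) \<le> K * C * (t - s)" by simp
    have "herm (scaleC2 l (\<zeta> s)) (scaleC2 l (\<zeta> t)) = cnj l * l * herm (\<zeta> s) (\<zeta> t)" by simp
    also have "cnj l * l * herm (\<zeta> s) (\<zeta> t) = (cmod l)\<^sup>2 * herm (\<zeta> s) (\<zeta> t)"
      by (simp only: complex_norm_square mult_ac)
    finally have "\<bar>Im (herm (scaleC2 l (\<zeta> s)) (scaleC2 l (\<zeta> t)))\<bar> = (cmod l)\<^sup>2 * \<bar>Im (herm (\<zeta> s) (\<zeta> t))\<bar>"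
      
      by (simp add: abs_mult del: herm_scaleC2 of_real_power)
    also have "\<dots> \<le> K * (C * (t - s)\<^sup>2)"
      using C(3)[OF st] by (intro mult_mono) (auto simp: K_def max_def)
    finally show "\<bar>Im (herm (scaleC2 l (\<zeta> s)) (scaleC2 l (\<zeta> t)))\<bar> \<le> K * C * (t - s)\<^sup>2" by simp
  qed
  then show ?thesis
    using assms unfolding horizontal_lift_def by (blast intro: lifts_scaleC2)
qed

lemma horizontal_lift_affine:
  assumes z: "horizontal_lift c a b \<zeta>" and k: "k \<ge> 0" and ab: "k * a' + d = a" "k * b' + d = b"
    and c': "\<And>t. t \<in> {a'..b'} \<Longrightarrow> c' t = c (k * t + d)"
  shows "horizontal_lift c' a' b' (\<lambda>t. \<zeta> (k * t + d))"
proof -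
  have mem: "k * t + d \<in> {a..b}" if "t \<in> {a'..b'}" for t
    using that k unfolding ab[symmetric] by (auto intro: mult_left_mono)
  obtain C where C: "C > 0"
    "\<And>s t. s \<in> {a..b} \<Longrightarrow> t \<in> {a..b} \<Longrightarrow> s \<le> t \<Longrightarrow> norm (\<zeta> t - \<zeta> s) \<le> C * (t - s)"
    "\<And>s t. s \<in> {a..b} \<Longrightarrow> t \<in> {a..b} \<Longrightarrow> s \<le> t \<Longrightarrow> \<bar>Im (herm (\<zeta> s) (\<zeta> t))\<bar> \<le> C * (t - s)\<^sup>2"
    using horizontal_liftE[OF z] by metis
  define K where "K = max k (k\<^sup>2)"
  have "norm (\<zeta> (k * t + d) - \<zeta> (k * s + d)) \<le> K * C * (t - s) \<and>
        \<bar>Im (herm (\<zeta> (k * s + d)) (\<zeta> (k * t + d)))\<bar> \<le> K * C * (t - s)\<^sup>2"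
    if st: "s \<in> {a'..b'}" "t \<in> {a'..b'}" "s \<le> t" for s t
  proof -
    have le: "k * s + d \<le> k * t + d" using st k by (simp add: mult_left_mono)
    have "C * (k * t + d - (k * s + d)) = k * (C * (t - s))"
         "C * (k * t + d - (k * s + d))\<^sup>2 = k\<^sup>2 * (C * (t - s)\<^sup>2)"
      by (simp_all add: algebra_simps power2_eq_square)
    moreover have "k * (C * (t - s)) \<le> K * (C * (t - s))" "k\<^sup>2 * (C * (t - s)\<^sup>2) \<le> K * (C * (t - s)\<^sup>2)"
      using st C(1) by (auto intro!: mult_right_mono simp: K_def)
    ultimately show ?thesis
      using C(2)[OF mem[OF st(1)] mem[OF st(2)] le] C(3)[OF mem[OF st(1)] mem[OF st(2)] le]
      unfolding mult.assoc[of K C] by linarith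
  qed
  then show ?thesis
    using z mem c' unfolding horizontal_lift_def by (intro conjI exI[of _ "K * C"]) auto
qed

text \<open>A step across the corner \<open>m\<close> is the sum of the steps on either side, up to the product of the two
  increments of \<open>\<zeta>\<close>, which is of second order because \<open>\<zeta>\<close> is Lipschitz.\<close>

lemma horizontal_lift_concat:
  assumes 1: "horizontal_lift c a m \<zeta>" and 2: "horizontal_lift c m b \<zeta>" 
  shows "horizontal_lift c a b \<zeta>"
proof -
  obtain C where C: "C > 0"
    "\<And>s t. s \<in> {a..m} \<Longrightarrow> t \<in> {a..m} \<Longrightarrow> s \<le> t \<Longrightarrow> norm (\<zeta> t - \<zeta> s) \<le> C * (t - s)"
    "\<And>s t. s \<in> {a..m} \<Longrightarrow> t \<in> {a..m} \<Longrightarrow> s \<le> t \<Longrightarrow> \<bar>Im (herm (\<zeta> s) (\<zeta> t))\<bar> \<le> C * (t - s)\<^sup>2"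
    using horizontal_liftE[OF 1] by metis
  obtain D where D: "D > 0"
    "\<And>s t. s \<in> {m..b} \<Longrightarrow> t \<in> {m..b} \<Longrightarrow> s \<le> t \<Longrightarrow> norm (\<zeta> t - \<zeta> s) \<le> D * (t - s)"
    "\<And>s t. s \<in> {m..b} \<Longrightarrow> t \<in> {m..b} \<Longrightarrow> s \<le> t \<Longrightarrow> \<bar>Im (herm (\<zeta> s) (\<zeta> t))\<bar> \<le> D * (t - s)\<^sup>2"
    using horizontal_liftE[OF 2] by metis
  define K where "K = C + D + 2 * C * D"
  have K: "C \<le> K" "D \<le> K" "C + D \<le> K" using C(1) D(1) by (auto simp: K_def)
  have *: "norm (\<zeta> t - \<zeta> s) \<le> K * (t - s) \<and> \<bar>Im (herm (\<zeta> s) (\<zeta> t))\<bar> \<le> K * (t - s)\<^sup>2"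
    if st: "s \<in> {a..b}" "t \<in> {a..b}" "s \<le> t" for s t
  proof -
    consider "t \<le> m" | "m \<le> s" | "s \<le> m" "m \<le> t" by linarith
    then show ?thesis
    proof cases
      case 1
      then show ?thesis
        using st C(2)[of s t] C(3)[of s t] K(1) mult_right_mono[of C K "t - s"] mult_right_mono[of C K "(t - s)\<^sup>2"]
        by auto
    next
      case 2
      then show ?thesis
        using st D(2)[of s t] D(3)[of s t] K(2) mult_right_mono[of D K "t - s"] mult_right_mono[of D K "(t - s)\<^sup>2"]
        by auto
    next
      case 3
      define x where "x = m - s"
      define y where "y = t - m"
      have xy: "x \<ge> 0" "y \<ge> 0" "t - s = x + y" using 3 by (auto simp: x_def y_def)
      have n: "norm (\<zeta> m - \<zeta> s) \<le> C * x" "norm (\<zeta> t - \<zeta> m) \<le> D * y"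
        and i: "\<bar>Im (herm (\<zeta> s) (\<zeta> m))\<bar> \<le> C * x\<^sup>2" "\<bar>Im (herm (\<zeta> m) (\<zeta> t))\<bar> \<le> D * y\<^sup>2"
        using C(2,3)[of s m] D(2,3)[of m t] 3 st by (auto simp: x_def y_def)
      have "norm (\<zeta> t - \<zeta> s) \<le> C * x + D * y"
        using norm_triangle_ineq[of "\<zeta> t - \<zeta> m" "\<zeta> m - \<zeta> s"] n by simp
      also have "\<dots> \<le> K * x + K * y"
        using K xy by (intro add_mono mult_right_mono) auto
      finally have A: "norm (\<zeta> t - \<zeta> s) \<le> K * (t - s)" by (simp add: xy algebra_simps)
      \<comment> \<open>The term in \<open>\<zeta> m\<close> alone is real, so only the mixed increment is new.\<close>
      have "herm (\<zeta> s) (\<zeta> t) = herm (\<zeta> s) (\<zeta> m) + herm (\<zeta> m) (\<zeta> t) - herm (\<zeta> m) (\<zeta> m) - herm (\<zeta> m - \<zeta> s) (\<zeta> t - \<zeta> m)"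
        by (simp add: herm_simps)
      moreover have "Im (herm (\<zeta> m) (\<zeta> m)) = 0" by (simp add: herm_self)
      moreover have "\<bar>Im (herm (\<zeta> m - \<zeta> s) (\<zeta> t - \<zeta> m))\<bar> \<le> 2 * (C * x) * (D * y)"
      proof -
        have "\<bar>Im (herm (\<zeta> m - \<zeta> s) (\<zeta> t - \<zeta> m))\<bar> \<le> 2 * norm (\<zeta> m - \<zeta> s) * norm (\<zeta> t - \<zeta> m)"
          using abs_Im_le_cmod norm_herm_le order_trans by blast
        also have "\<dots> \<le> 2 * (C * x) * (D * y)"
          using n C(1) xy by (intro mult_mono) auto
        finally show ?thesis .
      qed
      ultimately have "\<bar>Im (herm (\<zeta> s) (\<zeta> t))\<bar> \<le> C * x\<^sup>2 + D * y\<^sup>2 + 2 * C * D * (x * y)"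
        using i by (simp add: mult_ac)
      also have "\<dots> \<le> K * x\<^sup>2 + K * y\<^sup>2 + K * (x * y)"
        using K xy C(1) D(1) by (intro add_mono mult_right_mono) (auto simp: K_def)
      also have "\<dots> \<le> K * (t - s)\<^sup>2"
        using K xy C(1) by (simp add: power2_eq_square algebra_simps)
      finally show ?thesis using A by blast
    qed
  qed
  have "lifts (\<zeta> t) (c t)" if "t \<in> {a..b}" for t
    using 1 2 that unfolding horizontal_lift_def by (cases "t \<le> m") auto
  then show ?thesis using * unfolding horizontal_lift_def by blast
qed

lemma horizontal_lift_cong:
  assumes "horizontal_lift c a b \<zeta>" "\<And>t. t \<in> {a..b} \<Longrightarrow> c' t = c t" "\<And>t. t \<in> {a..b} \<Longrightarrow> \<zeta>' t = \<zeta> t"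
  shows "horizontal_lift c' a b \<zeta>'"
  using assms unfolding horizontal_lift_def by simp

lemma horizontal_lift_norm_bound:
  assumes "horizontal_lift c a b \<zeta>"
  obtains \<mu> where "\<mu> > 0" "\<And>t. t \<in> {a..b} \<Longrightarrow> \<mu> \<le> norm (\<zeta> t)"
proof (cases "a \<le> b")
  case True
  obtain C where C: "C > 0"
    "\<And>s t. s \<in> {a..b} \<Longrightarrow> t \<in> {a..b} \<Longrightarrow> s \<le> t \<Longrightarrow> norm (\<zeta> t - \<zeta> s) \<le> C * (t - s)"
    using horizontal_liftE[OF assms] by metis
  have "C-lipschitz_on {a..b} \<zeta>"
  proof (rule lipschitz_onI)
    fix x y assume "x \<in> {a..b}" "y \<in> {a..b}"
    then show "dist (\<zeta> x) (\<zeta> y) \<le> C * dist x y"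
      using C(2)[of x y] C(2)[of y x] by (cases "x \<le> y") (auto simp: dist_norm norm_minus_commute)
  qed (use C in simp)
  then have "continuous_on {a..b} (\<lambda>t. norm (\<zeta> t))"
    by (intro continuous_intros lipschitz_on_continuous_on)
  then obtain t0 where "t0 \<in> {a..b}" "\<And>t. t \<in> {a..b} \<Longrightarrow> norm (\<zeta> t0) \<le> norm (\<zeta> t)"
    using continuous_attains_inf[of "{a..b}" "\<lambda>t. norm (\<zeta> t)"] True by auto
  moreover have "norm (\<zeta> t0) > 0"
    using horizontal_lift_lifts[OF assms \<open>t0 \<in> {a..b}\<close>] by (simp add: lifts_def)
  ultimately show ?thesis using that by blast
qed (use that[of 1] in auto)

lemma cmod_sgn_minus_1_le:
  assumes "Re \<rho> > 0" shows "cmod (sgn \<rho> - 1) \<le> 2 * \<bar>Im \<rho>\<bar> / Re \<rho>"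
proof -
  have r: "Re \<rho> \<le> cmod \<rho>" by (rule complex_Re_le_cmod)
  with assms have p: "cmod \<rho> > 0" by linarith
  have "cmod (\<rho> - cmod \<rho>) \<le> \<bar>Re \<rho> - cmod \<rho>\<bar> + \<bar>Im \<rho>\<bar>"
    using cmod_le[of "\<rho> - cmod \<rho>"] by simp
  also have "\<dots> \<le> 2 * \<bar>Im \<rho>\<bar>"
    using r cmod_le[of \<rho>] assms by simp
  finally have "cmod (\<rho> - cmod \<rho>) / cmod \<rho> \<le> 2 * \<bar>Im \<rho>\<bar> / Re \<rho>"
    using r assms p by (intro frac_le) auto
  moreover have "sgn \<rho> - 1 = (\<rho> - cmod \<rho>) / cmod \<rho>"
    using p by (simp add: sgn_eq diff_divide_distrib)
  ultimately show ?thesis by (simp add: norm_divide)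
qed

lemma horizontal_lift_phase_bound:
  assumes "horizontal_lift c a b \<zeta>"
  obtains C \<eta> where "C > 0" "\<eta> > 0"
    "\<And>s t. s \<in> {a..b} \<Longrightarrow> t \<in> {a..b} \<Longrightarrow> s \<le> t \<Longrightarrow> t - s \<le> \<eta> \<Longrightarrow>
       cmod (sgn (herm (\<zeta> s) (\<zeta> t)) - 1) \<le> C * (t - s)\<^sup>2"
proof -
  obtain C where C: "C > 0"
    "\<And>s t. s \<in> {a..b} \<Longrightarrow> t \<in> {a..b} \<Longrightarrow> s \<le> t \<Longrightarrow> norm (\<zeta> t - \<zeta> s) \<le> C * (t - s)"
    "\<And>s t. s \<in> {a..b} \<Longrightarrow> t \<in> {a..b} \<Longrightarrow> s \<le> t \<Longrightarrow> \<bar>Im (herm (\<zeta> s) (\<zeta> t))\<bar> \<le> C * (t - s)\<^sup>2"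
    using horizontal_liftE[OF assms] by metis
  obtain \<mu> where \<mu>: "\<mu> > 0" "\<And>t. t \<in> {a..b} \<Longrightarrow> \<mu> \<le> norm (\<zeta> t)"
    using horizontal_lift_norm_bound[OF assms] by metis
  define \<eta> where "\<eta> = \<mu> / (2 * C)"
  have "cmod (sgn (herm (\<zeta> s) (\<zeta> t)) - 1) \<le> (4 * C / \<mu>\<^sup>2) * (t - s)\<^sup>2"
    if st: "s \<in> {a..b}" "t \<in> {a..b}" "s \<le> t" "t - s \<le> \<eta>" for s t
  proof -
    have "norm (\<zeta> t - \<zeta> s) \<le> C * (t - s)" by (rule C(2)[OF st(1-3)])
    also have "\<dots> \<le> C * \<eta>" using st C(1) by simp
    also have "\<dots> = \<mu> / 2" using C(1) by (simp add: \<eta>_def)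
    finally have d: "norm (\<zeta> t - \<zeta> s) \<le> \<mu> / 2" .
    have n: "\<mu> \<le> norm (\<zeta> s)" using \<mu>(2)[OF st(1)] .
    have "Re (herm (\<zeta> s) (\<zeta> t)) = (norm (\<zeta> s))\<^sup>2 + \<zeta> s \<bullet> (\<zeta> t - \<zeta> s)"
      by (simp add: Re_herm inner_diff_right dot_square_norm)
    also have "\<dots> \<ge> (norm (\<zeta> s))\<^sup>2 - norm (\<zeta> s) * norm (\<zeta> t - \<zeta> s)"
      using Cauchy_Schwarz_ineq2[of "\<zeta> s" "\<zeta> t - \<zeta> s"] by simp
    also have "(norm (\<zeta> s))\<^sup>2 - norm (\<zeta> s) * norm (\<zeta> t - \<zeta> s) = norm (\<zeta> s) * (norm (\<zeta> s) - norm (\<zeta> t - \<zeta> s))"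
      by (simp add: power2_eq_square algebra_simps)
    also have "\<dots> \<ge> \<mu> * (\<mu> / 2)"
      using n d \<mu>(1) by (intro mult_mono) auto
    finally have R: "Re (herm (\<zeta> s) (\<zeta> t)) \<ge> \<mu>\<^sup>2 / 2" by (simp add: power2_eq_square)
    have Rp: "Re (herm (\<zeta> s) (\<zeta> t)) > 0"
      by (rule less_le_trans[OF _ R]) (use \<mu>(1) in simp)
    have "cmod (sgn (herm (\<zeta> s) (\<zeta> t)) - 1) \<le> 2 * \<bar>Im (herm (\<zeta> s) (\<zeta> t))\<bar> / Re (herm (\<zeta> s) (\<zeta> t))"
      by (rule cmod_sgn_minus_1_le[OF Rp])
    also have "\<dots> \<le> 2 * (C * (t - s)\<^sup>2) / (\<mu>\<^sup>2 / 2)"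
      using C(3)[OF st(1-3)] R \<mu>(1) C(1) by (intro frac_le) auto
    also have "\<dots> = (4 * C / \<mu>\<^sup>2) * (t - s)\<^sup>2" using \<mu>(1) by (simp add: field_simps)
    finally show ?thesis .
  qed
  moreover have "4 * C / \<mu>\<^sup>2 > 0" "\<eta> > 0" using C(1) \<mu>(1) by (simp_all add: \<eta>_def)
  ultimately show ?thesis using that by blast
qed

text \<open>The phases add up to at most the sum of the squared steps, hence to at most the longest step times
  the length of the interval. The steps of the monotone function \<open>\<phi>\<close> sum to a fixed length, and the longest one
  tends to 0 because \<open>\<phi>\<close> is uniformly continuous.\<close>

lemma horizontal_lift_phase_product:
  assumes lift: "horizontal_lift c a b \<zeta>"
    and \<phi>: "continuous_on {\<alpha>..\<beta>} \<phi>" "mono_on {\<alpha>..\<beta>} \<phi>" "\<phi> ` {\<alpha>..\<beta>} \<subseteq> {a..b}" and "\<alpha> < \<beta>"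
  shows "(\<lambda>n. \<Prod>i<n. sgn (herm (\<zeta> (\<phi> (\<alpha> + (\<beta> - \<alpha>) * real i / real n)))
                            (\<zeta> (\<phi> (\<alpha> + (\<beta> - \<alpha>) * real (Suc i) / real n))))) \<longlonglongrightarrow> 1"
proof (rule LIMSEQ_I)
  fix e :: real assume e: "e > 0"
  obtain C \<eta> where C: "C > 0" "\<eta> > 0"
    "\<And>s t. s \<in> {a..b} \<Longrightarrow> t \<in> {a..b} \<Longrightarrow> s \<le> t \<Longrightarrow> t - s \<le> \<eta> \<Longrightarrow>
       cmod (sgn (herm (\<zeta> s) (\<zeta> t)) - 1) \<le> C * (t - s)\<^sup>2"
    using horizontal_lift_phase_bound[OF lift] by metis
  have "\<phi> \<alpha> \<in> {a..b}" "\<phi> \<beta> \<in> {a..b}"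
    by (rule subsetD[OF \<phi>(3)], use \<open>\<alpha> < \<beta>\<close> in simp)+
  then have ab: "a \<le> b" "\<phi> \<beta> - \<phi> \<alpha> \<le> b - a" by auto
  define e' where "e' = min \<eta> (e / (2 * C * (b - a + 1)))"
  have e': "e' > 0" using C e ab by (simp add: e'_def)
  have "uniformly_continuous_on {\<alpha>..\<beta>} \<phi>"
    by (intro compact_uniformly_continuous \<phi>) simp
  then obtain d where d: "d > 0" "\<And>x y. x \<in> {\<alpha>..\<beta>} \<Longrightarrow> y \<in> {\<alpha>..\<beta>} \<Longrightarrow> dist x y < d \<Longrightarrow> dist (\<phi> x) (\<phi> y) < e'"
    unfolding uniformly_continuous_on_def using e' by metis
  obtain N where N: "(\<beta> - \<alpha>) / d < real N" using reals_Archimedean2 by blast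
  show "\<exists>N. \<forall>n\<ge>N. norm ((\<Prod>i<n. sgn (herm (\<zeta> (\<phi> (\<alpha> + (\<beta> - \<alpha>) * real i / real n)))
                            (\<zeta> (\<phi> (\<alpha> + (\<beta> - \<alpha>) * real (Suc i) / real n))))) - 1) < e"
  proof (intro exI[of _ "Suc N"] allI impI)
    fix n assume n: "n \<ge> Suc N"
    define u where "u = (\<lambda>i. \<alpha> + (\<beta> - \<alpha>) * real i / real n)"
    have u_mem: "u i \<in> {\<alpha>..\<beta>}" if "i \<le> n" for i
    proof -
      have "(\<beta> - \<alpha>) * (real i / real n) \<le> (\<beta> - \<alpha>) * 1"
        using that \<open>\<alpha> < \<beta>\<close> n by (intro mult_left_mono) (auto simp: field_simps)
      then show ?thesis using \<open>\<alpha> < \<beta>\<close> by (simp add: u_def)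
    qed
    have u_step: "u (Suc i) - u i = (\<beta> - \<alpha>) / real n" for i
      using n by (simp add: u_def field_simps)
    have "(\<beta> - \<alpha>) / real n < d"
    proof -
      have "real N < real n" using n by simp
      with N have "(\<beta> - \<alpha>) / d < real n" by linarith
      then show ?thesis using d(1) n by (simp add: field_simps)
    qed
    moreover have step_pos: "(\<beta> - \<alpha>) / real n > 0" using \<open>\<alpha> < \<beta>\<close> n by simp
    ultimately have dist_u: "dist (u (Suc i)) (u i) < d" for i
      by (simp add: dist_real_def u_step)
    have tau: "\<phi> (u i) \<le> \<phi> (u (Suc i))" "\<phi> (u (Suc i)) - \<phi> (u i) < e'" if "i < n" for i
      using d(2)[OF u_mem[of "Suc i"] u_mem[of i] dist_u] that step_pos u_step[of i]
        mono_onD[OF \<phi>(2) u_mem[of i] u_mem[of "Suc i"]] by (auto simp: dist_real_def)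
    have \<phi>_mem: "\<phi> (u i) \<in> {a..b}" if "i \<le> n" for i
      using u_mem[OF that] \<phi>(3) by blast
    have step: "cmod (sgn (herm (\<zeta> (\<phi> (u i))) (\<zeta> (\<phi> (u (Suc i))))) - 1) \<le> C * e' * (\<phi> (u (Suc i)) - \<phi> (u i))"
      if "i < n" for i
    proof -
      have "cmod (sgn (herm (\<zeta> (\<phi> (u i))) (\<zeta> (\<phi> (u (Suc i))))) - 1) \<le> C * (\<phi> (u (Suc i)) - \<phi> (u i))\<^sup>2"
        using tau[OF that] \<phi>_mem[of i] \<phi>_mem[of "Suc i"] that by (intro C(3)) (auto simp: e'_def)
      also have "\<dots> \<le> C * (e' * (\<phi> (u (Suc i)) - \<phi> (u i)))"
        using tau[OF that] C(1) unfolding power2_eq_square by (intro mult_left_mono mult_right_mono) auto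
      finally show ?thesis by simp
    qed
    have "norm ((\<Prod>i<n. sgn (herm (\<zeta> (\<phi> (u i))) (\<zeta> (\<phi> (u (Suc i)))))) - (\<Prod>i<n. 1))
       \<le> (\<Sum>i<n. norm (sgn (herm (\<zeta> (\<phi> (u i))) (\<zeta> (\<phi> (u (Suc i))))) - 1))"
      by (rule norm_prod_diff) (auto simp: norm_sgn)
    also have "\<dots> \<le> (\<Sum>i<n. C * e' * (\<phi> (u (Suc i)) - \<phi> (u i)))"
      using step by (intro sum_mono) auto
    also have "\<dots> = C * e' * (\<phi> (u n) - \<phi> (u 0))"
      using sum_lessThan_telescope[of "\<lambda>i. \<phi> (u i)" n] by (simp flip: sum_distrib_left)
    also have "\<phi> (u n) - \<phi> (u 0) \<le> b - a" using ab(2) n by (simp add: u_def)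
    also have "C * e' * (b - a) \<le> C * (e / (2 * C * (b - a + 1))) * (b - a)"
      using C(1) ab by (intro mult_left_mono mult_right_mono) (auto simp: e'_def)
    also have "\<dots> = (e / 2) * ((b - a) / (b - a + 1))"
      using C(1) by simp
    also have "\<dots> \<le> (e / 2) * 1"
      using e ab by (intro mult_left_mono) (auto simp: divide_le_eq_1)
    also have "\<dots> < e" using e by simp
    finally show "norm ((\<Prod>i<n. sgn (herm (\<zeta> (\<phi> (\<alpha> + (\<beta> - \<alpha>) * real i / real n)))
                            (\<zeta> (\<phi> (\<alpha> + (\<beta> - \<alpha>) * real (Suc i) / real n))))) - 1) < e"
      using C(1) e' by (simp add: u_def mult_left_mono)
  qed
qed

text \<open>Here \<open>S\<close> is an arbitrary choice of lifts, possibly discontinuous. Compared with the horizontal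
  lift, each step gains the factor \<open>sgn (l u) / sgn (l v)\<close>, and these telescope.\<close>

lemma gauge_phase_product:
  assumes lift: "horizontal_lift c a b \<zeta>"
    and \<phi>: "continuous_on {\<alpha>..\<beta>} \<phi>" "mono_on {\<alpha>..\<beta>} \<phi>" "\<phi> ` {\<alpha>..\<beta>} \<subseteq> {a..b}" and "\<alpha> < \<beta>"
    and S: "\<And>u. u \<in> {\<alpha>..\<beta>} \<Longrightarrow> \<zeta> (\<phi> u) = scaleC2 (l u) (S u)" "\<And>u. u \<in> {\<alpha>..\<beta>} \<Longrightarrow> l u \<noteq> 0"
  shows "(\<lambda>n. \<Prod>i<n. sgn (herm (S (\<alpha> + (\<beta> - \<alpha>) * real i / real n))
                               (S (\<alpha> + (\<beta> - \<alpha>) * real (Suc i) / real n)))) \<longlonglongrightarrow> sgn (l \<alpha>) / sgn (l \<beta>)"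
proof -
  define u where "u = (\<lambda>n i. \<alpha> + (\<beta> - \<alpha>) * real i / real n)"
  have u_mem: "u n i \<in> {\<alpha>..\<beta>}" if "i \<le> n" for n i
  proof -
    have "(\<beta> - \<alpha>) * (real i / real n) \<le> (\<beta> - \<alpha>) * 1"
      using that \<open>\<alpha> < \<beta>\<close> by (intro mult_left_mono) (auto simp: divide_le_eq_1)
    then show ?thesis using \<open>\<alpha> < \<beta>\<close> by (simp add: u_def)
  qed
  have "(\<Prod>i<n. sgn (herm (S (u n i)) (S (u n (Suc i))))) =
      (\<Prod>i<n. sgn (herm (\<zeta> (\<phi> (u n i))) (\<zeta> (\<phi> (u n (Suc i)))))) * (sgn (l \<alpha>) / sgn (l \<beta>))"
    if n: "n > 0" for n
  proof -
    have "sgn (herm (S (u n i)) (S (u n (Suc i)))) =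
        sgn (herm (\<zeta> (\<phi> (u n i))) (\<zeta> (\<phi> (u n (Suc i))))) * (sgn (l (u n i)) / sgn (l (u n (Suc i))))"
      if i: "i < n" for i
    proof -
      have l: "l (u n i) \<noteq> 0" "l (u n (Suc i)) \<noteq> 0" using S(2) u_mem i by auto
      have unit: "sgn (cnj x) * sgn x = 1" if "x \<noteq> 0" for x :: complex
        using that by (simp add: sgn_eq complex_norm_square[symmetric] power2_eq_square mult.commute flip: of_real_mult)
      show ?thesis
        using l unit[OF l(1)] S(1)[OF u_mem[of i n]] S(1)[OF u_mem[of "Suc i" n]] i
        by (simp add: sgn_mult sgn_zero_iff mult_ac)
    qed
    then have "(\<Prod>i<n. sgn (herm (S (u n i)) (S (u n (Suc i))))) =
      (\<Prod>i<n. sgn (herm (\<zeta> (\<phi> (u n i))) (\<zeta> (\<phi> (u n (Suc i)))))) *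
      (\<Prod>i<n. sgn (l (u n i)) / sgn (l (u n (Suc i))))"
      unfolding prod.distrib[symmetric] by (intro prod.cong) auto
    moreover have "(\<Prod>i<n. sgn (l (u n i)) / sgn (l (u n (Suc i)))) = sgn (l (u n 0)) / sgn (l (u n n))"
      using S(2) u_mem by (intro prod_lessThan_telescope') (auto simp: sgn_zero_iff)
    moreover have "u n 0 = \<alpha>" "u n n = \<beta>" using n by (simp_all add: u_def)
    ultimately show ?thesis by simp
  qed
  then have "\<forall>\<^sub>F n in sequentially. (\<Prod>i<n. sgn (herm (\<zeta> (\<phi> (u n i))) (\<zeta> (\<phi> (u n (Suc i)))))) * (sgn (l \<alpha>) / sgn (l \<beta>))
      = (\<Prod>i<n. sgn (herm (S (u n i)) (S (u n (Suc i)))))"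
    by (intro eventually_mono[OF eventually_gt_at_top[of 0]]) simp
  moreover have "(\<lambda>n. (\<Prod>i<n. sgn (herm (\<zeta> (\<phi> (u n i))) (\<zeta> (\<phi> (u n (Suc i)))))) * (sgn (l \<alpha>) / sgn (l \<beta>)))
      \<longlonglongrightarrow> 1 * (sgn (l \<alpha>) / sgn (l \<beta>))"
    unfolding u_def by (intro tendsto_mult_right horizontal_lift_phase_product[OF lift \<phi> \<open>\<alpha> < \<beta>\<close>])
  ultimately show ?thesis
    unfolding u_def by (simp add: tendsto_cong)
qed

section \<open>Phases of small triangles and cells\<close>

definition triple :: "real ^ 3 \<Rightarrow> real ^ 3 \<Rightarrow> real ^ 3 \<Rightarrow> real" where
  "triple u v w = u \<bullet> cross3 v w"

lemma triple_edges: "triple u v w = triple u (v - u) (w - u)"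
  by (simp add: triple_def Cross3.left_diff_distrib Cross3.right_diff_distrib inner_diff_right dot_cross_self)

lemma norm_cross3_le: "norm (cross3 v w) \<le> norm v * norm w"
proof (rule power2_le_imp_le)
  show "(norm (cross3 v w))\<^sup>2 \<le> (norm v * norm w)\<^sup>2"
    using norm_cross_dot[of v w] zero_le_power2[of "v \<bullet> w"] by linarith
qed simp

lemma abs_triple_le: "\<bar>triple u v w\<bar> \<le> norm u * (norm (v - u) * norm (w - u))"
  unfolding triple_edges[of u v w] unfolding triple_def
  by (rule order_trans[OF Cauchy_Schwarz_ineq2]) (intro mult_left_mono norm_cross3_le norm_ge_zero)

lemma cmod_cis_minus_linear_le: "cmod (cis y - (1 + \<i> * y)) \<le> y\<^sup>2"
  using Taylor_exp[of "\<i> * of_real y" 1] by (simp add: cis_conv_exp norm_mult power2_eq_square)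

text \<open>The real part of the cyclic product is \<open>1\<close> up to second order, and the imaginary part is the
  number \<open>y = 2 triple A B C\<close>, itself of second order. So dividing by the absolute value
  changes \<open>y\<close> only in fourth order, and \<open>1 + i y\<close> differs from \<open>exp (i y)\<close> by at most \<open>y\<^sup>2\<close>.
  The fourth order matters: the error is summed over \<open>n\<^sup>2\<close> cells of diameter \<open>1 / n\<close>.\<close>

lemma triangle_phase_estimate:
  assumes lifts: "lifts a A" "lifts b B" "lifts c C"
    and sphere: "A \<in> shape_sphere" "B \<in> shape_sphere" "C \<in> shape_sphere"
    and small: "norm (B - A) \<le> \<delta>" "norm (C - B) \<le> \<delta>" "norm (C - A) \<le> \<delta>" "\<delta> \<le> 1/2"
    and unit: "norm a = 1" "norm b = 1" "norm c = 1" 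
  shows "cmod (sgn (herm a b * herm b c * herm c a) - cis (2 * triple A B C)) \<le> 10 * \<delta> ^ 4"
proof -
  define T where "T = herm a b * herm b c * herm c a"
  define y where "y = 2 * triple A B C"
  have \<delta>: "\<delta> \<ge> 0" using small(1) norm_ge_zero order_trans by blast
  have d2: "\<delta>\<^sup>2 \<le> 1/4"
    using power_mono[OF small(4) \<delta>, of 2] by (simp add: power_divide)
  have hopf: "hopf a = A" "hopf b = B" "hopf c = C"
    using lifts unit by (simp_all add: lifts_def)
  have inner: "X \<bullet> Y = 1/4 - (norm (Y - X))\<^sup>2 / 2" if "X \<in> shape_sphere" "Y \<in> shape_sphere" for X Y :: "real ^ 3"
    using that by (simp add: mem_shape_sphere power2_norm_eq_inner inner_diff_left inner_diff_right inner_commute field_simps)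
  have sq: "(norm (B - A))\<^sup>2 \<le> \<delta>\<^sup>2" "(norm (C - B))\<^sup>2 \<le> \<delta>\<^sup>2" "(norm (C - A))\<^sup>2 \<le> \<delta>\<^sup>2"
    using small by (auto intro!: power_mono)
  have ImT: "Im T = y"
    unfolding T_def y_def herm_triangle hopf triple_def ..
  have "Re T = 1/4 + A \<bullet> B + B \<bullet> C + A \<bullet> C"
    unfolding T_def herm_triangle hopf unit by simp
  also have "\<dots> = 1 - (norm (B - A))\<^sup>2 / 2 - (norm (C - B))\<^sup>2 / 2 - (norm (C - A))\<^sup>2 / 2"
    using inner sphere by simp
  finally have ReT: "Re T \<ge> 1 - 3/2 * \<delta>\<^sup>2" using sq by simp
  have "cmod (herm u v) \<le> 1" if "norm u = 1" "norm v = 1" "hopf u \<in> shape_sphere" "hopf v \<in> shape_sphere" for u v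
  proof -
    have "(cmod (herm u v))\<^sup>2 = 1/2 + 2 * (1/4 - (norm (hopf v - hopf u))\<^sup>2 / 2)"
      unfolding norm_herm_sq using that inner[of "hopf u" "hopf v"] by simp
    then have "(cmod (herm u v))\<^sup>2 \<le> 1\<^sup>2" by simp
    then show ?thesis by (rule power2_le_imp_le) simp
  qed
  then have "cmod (herm a b) \<le> 1" "cmod (herm b c) \<le> 1" "cmod (herm c a) \<le> 1"
    using unit sphere by (simp_all add: hopf)
  then have T1: "cmod T \<le> 1" unfolding T_def norm_mult by (intro mult_le_one) auto
  have T0: "cmod T \<ge> 1 - 3/2 * \<delta>\<^sup>2" using ReT complex_Re_le_cmod[of T] by linarith
  then have T2: "cmod T \<ge> 1/2" using d2 by linarith
  have nA: "norm A = 1/2" using sphere by (simp add: shape_sphere_def)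
  have y: "\<bar>y\<bar> \<le> \<delta>\<^sup>2"
  proof -
    have "\<bar>triple A B C\<bar> \<le> 1/2 * (norm (B - A) * norm (C - A))"
      using abs_triple_le[of A B C] by (simp add: nA)
    also have "\<dots> \<le> 1/2 * (\<delta> * \<delta>)"
      using small \<delta> by (intro mult_left_mono mult_mono) auto
    finally show ?thesis by (simp add: y_def power2_eq_square abs_mult)
  qed
  have d4: "\<delta>\<^sup>2 * \<delta>\<^sup>2 = \<delta> ^ 4" by (simp add: power_add[symmetric])
  define u where "u = sgn T"
  have ReT_pos: "Re T > 0" using ReT d2 by linarith
  have u: "Im u = y / cmod T" "Re u > 0" "(Re u)\<^sup>2 + (Im u)\<^sup>2 = 1"
  proof -
    have "T \<noteq> 0" using T2 by auto
    then have "cmod u = 1" by (simp add: u_def norm_sgn)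
    then show "(Re u)\<^sup>2 + (Im u)\<^sup>2 = 1" using cmod_power2[of u] by simp
    have "cmod T > 0" using T2 by linarith
    then show "Re u > 0" using ReT_pos by (simp add: u_def)
  qed (simp add: u_def ImT)
  have yT: "\<bar>y / cmod T\<bar> \<le> 2 * \<delta>\<^sup>2"
  proof -
    have "\<bar>y\<bar> / cmod T \<le> \<delta>\<^sup>2 / (1/2)" using y T2 by (intro frac_le) auto
    then show ?thesis by (simp add: abs_divide)
  qed
  have "\<bar>Re u - 1\<bar> \<le> 4 * \<delta> ^ 4"
  proof -
    have "(Im u)\<^sup>2 \<le> (2 * \<delta>\<^sup>2)\<^sup>2"
      using yT unfolding abs_le_square_iff[symmetric] u(1) by simp
    then have i: "(Im u)\<^sup>2 \<le> 4 * \<delta> ^ 4" unfolding power_mult_distrib power2_eq_square[of "\<delta>\<^sup>2"] d4 by simp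
    have "(Re u)\<^sup>2 \<le> 1\<^sup>2" using u(3) zero_le_power2[of "Im u"] unfolding one_power2 by linarith
    then have r: "Re u \<le> 1" by (rule power2_le_imp_le) simp
    then have "(Re u)\<^sup>2 \<le> Re u" using u(2) by (simp add: power2_eq_square)
    then show ?thesis using i u(3) r by linarith
  qed
  moreover have "\<bar>Im u - y\<bar> \<le> 3 * \<delta> ^ 4"
  proof -
    have "Im u - y = y / cmod T * (1 - cmod T)"
      using T2 unfolding u(1) by (cases "cmod T = 0") (auto simp: field_simps)
    then have "\<bar>Im u - y\<bar> = \<bar>y / cmod T\<bar> * (1 - cmod T)"
      using T1 by (simp add: abs_mult)
    also have "\<dots> \<le> (2 * \<delta>\<^sup>2) * (3/2 * \<delta>\<^sup>2)"
      using yT T0 T1 by (intro mult_mono) auto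
    also have "\<dots> = 3 * (\<delta>\<^sup>2 * \<delta>\<^sup>2)" by simp
    finally show ?thesis unfolding d4 .
  qed
  ultimately have "cmod (u - (1 + \<i> * y)) \<le> 7 * \<delta> ^ 4"
    using cmod_le[of "u - (1 + \<i> * y)"] by simp
  moreover have "cmod (cis y - (1 + \<i> * y)) \<le> \<delta> ^ 4"
  proof -
    have "y\<^sup>2 \<le> (\<delta>\<^sup>2)\<^sup>2" using y unfolding abs_le_square_iff[symmetric] by simp
    then have "y\<^sup>2 \<le> \<delta> ^ 4" unfolding power2_eq_square[of "\<delta>\<^sup>2"] d4 .
    then show ?thesis using cmod_cis_minus_linear_le[of y] by linarith
  qed
  ultimately have "cmod (u - cis y) \<le> 7 * \<delta> ^ 4 + \<delta> ^ 4"
    using norm_triangle_ineq4[of "u - (1 + \<i> * y)" "cis y - (1 + \<i> * y)"] by simp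
  moreover have "\<delta> ^ 4 \<ge> 0" by simp
  ultimately show ?thesis unfolding u_def y_def T_def by linarith
qed

lemma sgn_herm_commute: "sgn (herm b a) = inverse (sgn (herm a b))"
proof (cases "herm a b = 0")
  case False
  then have "sgn (herm a b) * sgn (herm b a) = 1"
    unfolding herm_commute[of b a]
    by (simp add: sgn_eq complex_norm_square[symmetric] power2_eq_square flip: of_real_mult)
  then show ?thesis by (metis inverse_unique)
qed (simp add: herm_commute[of b a])

text \<open>The diagonal from \<open>A\<close> to \<open>C\<close> splits the cell into two triangles; it is run through once in each
  direction, so its phases cancel.\<close>

lemma plaquette_phase_estimate:
  assumes lifts: "lifts a A" "lifts b B" "lifts c C" "lifts d D"
    and sphere: "{A, B, C, D} \<subseteq> shape_sphere"
    and small: "\<And>X Y. X \<in> {A, B, C, D} \<Longrightarrow> Y \<in> {A, B, C, D} \<Longrightarrow> norm (Y - X) \<le> \<delta>" "\<delta> \<le> 1/2"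
    and unit: "norm a = 1" "norm b = 1" "norm c = 1" "norm d = 1" and nz: "herm a c \<noteq> 0"
  shows "cmod (sgn (herm a b) * sgn (herm b c) * sgn (herm c d) * sgn (herm d a)
           - cis (2 * (triple A B C + triple A C D))) \<le> 20 * \<delta> ^ 4"
proof -
  define x where "x = sgn (herm a b * herm b c * herm c a)"
  define y where "y = sgn (herm a c * herm c d * herm d a)"
  have "sgn (herm c a) * sgn (herm a c) = 1"
    using nz by (simp add: sgn_herm_commute[of c a] sgn_zero_iff)
  then have xy: "x * y = sgn (herm a b) * sgn (herm b c) * sgn (herm c d) * sgn (herm d a)"
    by (simp add: x_def y_def sgn_mult mult_ac)
  have x: "cmod (x - cis (2 * triple A B C)) \<le> 10 * \<delta> ^ 4"
    unfolding x_def by (rule triangle_phase_estimate) (use assms in auto)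
  have y: "cmod (y - cis (2 * triple A C D)) \<le> 10 * \<delta> ^ 4"
    unfolding y_def by (rule triangle_phase_estimate) (use assms in auto)
  have "x * y - cis (2 * triple A B C) * cis (2 * triple A C D)
      = (x - cis (2 * triple A B C)) * y + cis (2 * triple A B C) * (y - cis (2 * triple A C D))"
    by (simp add: algebra_simps)
  also have "cmod \<dots> \<le> cmod (x - cis (2 * triple A B C)) * cmod y + cmod (y - cis (2 * triple A C D))"
    by (rule order_trans[OF norm_triangle_ineq]) (simp add: norm_mult)
  also have "\<dots> \<le> 10 * \<delta> ^ 4 * 1 + 10 * \<delta> ^ 4"
    using x y by (intro add_mono mult_mono) (auto simp: y_def norm_sgn)
  finally show ?thesis unfolding xy cis_mult by (simp add: distrib_left)
qed

text \<open>Each inner edge belongs to two cells, which run through it in opposite directions.\<close>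

lemma grid_product_telescope:
  fixes H V :: "nat \<Rightarrow> nat \<Rightarrow> 'a :: field"
  assumes H: "\<And>i j. i < n \<Longrightarrow> j \<le> n \<Longrightarrow> H i j \<noteq> 0" and V: "\<And>i j. i \<le> n \<Longrightarrow> j < n \<Longrightarrow> V i j \<noteq> 0"
  shows "(\<Prod>i<n. \<Prod>j<n. H i j * V (Suc i) j / (H i (Suc j) * V i j))
       = (\<Prod>i<n. H i 0) * (\<Prod>j<n. V n j) / ((\<Prod>i<n. H i n) * (\<Prod>j<n. V 0 j))"
proof -
  have "(\<Prod>i<n. \<Prod>j<n. H i j * V (Suc i) j / (H i (Suc j) * V i j))
      = (\<Prod>i<n. \<Prod>j<n. H i j / H i (Suc j)) * (\<Prod>i<n. \<Prod>j<n. V (Suc i) j / V i j)"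
    by (simp only: prod.distrib[symmetric] times_divide_times_eq)
  also have "(\<Prod>i<n. \<Prod>j<n. V (Suc i) j / V i j) = (\<Prod>j<n. \<Prod>i<n. V (Suc i) j / V i j)"
    by (rule prod.swap)
  also have "(\<Prod>i<n. \<Prod>j<n. H i j / H i (Suc j)) = (\<Prod>i<n. H i 0 / H i n)"
    using H by (intro prod.cong refl prod_lessThan_telescope') auto
  also have "(\<Prod>j<n. \<Prod>i<n. V (Suc i) j / V i j) = (\<Prod>j<n. V n j / V 0 j)"
  proof (intro prod.cong refl)
    fix j assume "j \<in> {..<n}"
    then show "(\<Prod>i<n. V (Suc i) j / V i j) = V n j / V 0 j"
      using V prod_lessThan_telescope[of n "\<lambda>i. V i j"] by auto
  qed
  finally show ?thesis by (simp add: prod_dividef)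
qed

section \<open>Regularity of piecewise smooth disks\<close>

text \<open>The mean value inequality works on convex sets only, and \<open>P\<close> can be any compact set. So it is
  applied on balls inside \<open>U\<close>, and compactness turns the local Lipschitz bounds into a global one.\<close>

lemma C1_imp_lipschitz_on_compact:
  fixes g :: "'a::euclidean_space \<Rightarrow> 'b::euclidean_space"
  assumes "compact P" "open U" "P \<subseteq> U"
    and g': "\<And>x. x \<in> U \<Longrightarrow> (g has_derivative blinfun_apply (g' x)) (at x)"
    and cont: "continuous_on U g'"
  obtains L where "L-lipschitz_on P g"
proof -
  have "local_lipschitz {0::real} P (\<lambda>_. g)"
  proof (rule local_lipschitzI)
    fix t :: real and x assume "x \<in> P"
    then obtain r where r: "r > 0" "cball x r \<subseteq> U"
      using assms(2,3) open_contains_cball by blast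
    have "compact (g' ` cball x r)"
      by (intro compact_continuous_image continuous_on_subset[OF cont] r compact_cball)
    then have "bounded (g' ` cball x r)" by (rule compact_imp_bounded)
    then obtain B where B: "\<And>y. y \<in> cball x r \<Longrightarrow> norm (g' y) \<le> B"
      unfolding bounded_iff by blast
    have "\<bar>B\<bar>-lipschitz_on (cball x r) g"
    proof (rule lipschitz_onI)
      fix y z assume yz: "y \<in> cball x r" "z \<in> cball x r"
      have "norm (g y - g z) \<le> \<bar>B\<bar> * norm (y - z)"
      proof (rule differentiable_bound[OF convex_cball _ _ yz])
        fix w assume w: "w \<in> cball x r"
        show "(g has_derivative blinfun_apply (g' w)) (at w within cball x r)"
          using g' w r(2) by (blast intro: has_derivative_at_withinI)
        show "onorm (blinfun_apply (g' w)) \<le> \<bar>B\<bar>"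
          using B[OF w] by (simp add: norm_blinfun.rep_eq)
      qed
      then show "dist (g y) (g z) \<le> \<bar>B\<bar> * dist y z" by (simp add: dist_norm)
    qed simp
    then have "\<bar>B\<bar>-lipschitz_on (cball x r \<inter> P) g"
      by (rule lipschitz_on_subset) simp
    then show "\<exists>u>0. \<exists>L. \<forall>t\<in>cball t u \<inter> {0}. L-lipschitz_on (cball x u \<inter> P) g"
      using r(1) by blast
  qed
  then obtain L where "\<And>t. t \<in> {0::real} \<Longrightarrow> L-lipschitz_on P g"
    using local_lipschitz_compact_implies_lipschitz[of "{0::real}" P "\<lambda>_. g"] assms(1) by (metis compact_insert compact_empty continuous_on_const)
  then show thesis using that by blast
qed

text \<open>The pieces can be arbitrary compact sets, but a segment is covered by the finitely many closed
  traces of the pieces, and there Lipschitz bounds of a function with a common constant can be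
  glued.\<close>

lemma piecewise_smooth_on_lipschitz:
  assumes F: "piecewise_smooth_on F K" and "convex K"
  obtains L where "L-lipschitz_on K F"
proof -
  from F obtain \<P> where \<P>: "finite \<P>" "\<Union>\<P> = K"
    and P: "\<And>P. P \<in> \<P> \<Longrightarrow> compact P \<and> (\<exists>U g g'. open U \<and> P \<subseteq> U \<and>
              (\<forall>x\<in>U. (g has_derivative blinfun_apply (g' x)) (at x)) \<and>
              continuous_on U g' \<and> (\<forall>x\<in>P. F x = g x))"
    unfolding piecewise_smooth_on_def by blast
  have "\<exists>L. L-lipschitz_on P F" if "P \<in> \<P>" for P
  proof -
    from P[OF that] obtain U g g' where g: "compact P" "open U" "P \<subseteq> U"
      "\<And>x. x \<in> U \<Longrightarrow> (g has_derivative blinfun_apply (g' x)) (at x)" "continuous_on U g'"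
      "\<And>x. x \<in> P \<Longrightarrow> F x = g x" by blast
    obtain L where "L-lipschitz_on P g" by (rule C1_imp_lipschitz_on_compact[OF g(1-5)])
    then have "L-lipschitz_on P F" using g(6) by (simp cong: lipschitz_on_cong)
    then show ?thesis by blast
  qed
  then obtain L where L: "\<And>P. P \<in> \<P> \<Longrightarrow> (L P)-lipschitz_on P F" by metis
  define M where "M = (\<Sum>P\<in>\<P>. \<bar>L P\<bar>)"
  have M: "M-lipschitz_on P F" if "P \<in> \<P>" for P
    by (rule lipschitz_on_le[OF L[OF that]])
       (use member_le_sum[of P \<P> "\<lambda>P. \<bar>L P\<bar>"] that \<P>(1) in \<open>auto simp: M_def\<close>)
  have M0: "M \<ge> 0" by (simp add: M_def sum_nonneg)
  have "M-lipschitz_on K F"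
  proof (rule lipschitz_onI)
    fix x y assume xy: "x \<in> K" "y \<in> K"
    define p where "p = (\<lambda>s::real. x + s *\<^sub>R (y - x))"
    have p_cont: "continuous_on {0..1} p" unfolding p_def by (intro continuous_intros)
    have p_mem: "p s \<in> K" if "s \<in> {0..1}" for s
      using convexD_alt[OF \<open>convex K\<close> xy, of s] that by (simp add: p_def algebra_simps)
    have "(M * norm (y - x))-lipschitz_on {0..1} (F \<circ> p)"
    proof (rule lipschitz_on_closed_Union[where I = \<P> and U = "\<lambda>P. {0..1} \<inter> p -` P"])
      fix P assume "P \<in> \<P>"
      show "closed ({0..1} \<inter> p -` P)"
        by (intro continuous_closed_preimage p_cont closed_atLeastAtMost compact_imp_closed)
           (use P \<open>P \<in> \<P>\<close> in blast)
      show "(M * norm (y - x))-lipschitz_on ({0..1} \<inter> p -` P) (F \<circ> p)"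
      proof (rule lipschitz_onI)
        fix s t assume "s \<in> {0..1} \<inter> p -` P" "t \<in> {0..1} \<inter> p -` P"
        then have "dist (F (p s)) (F (p t)) \<le> M * dist (p s) (p t)"
          using lipschitz_onD[OF M[OF \<open>P \<in> \<P>\<close>]] by simp
        also have "dist (p s) (p t) = dist s t * norm (y - x)"
          by (simp add: p_def dist_norm flip: scaleR_diff_left)
        finally show "dist ((F \<circ> p) s) ((F \<circ> p) t) \<le> M * norm (y - x) * dist s t"
          by (simp add: mult_ac)
      qed (simp add: M0)
    qed (use \<P> p_mem M0 in auto)
    from lipschitz_onD[OF this, of 0 1] show "dist (F x) (F y) \<le> M * dist x y"
      by (simp add: p_def dist_norm norm_minus_commute)
  qed (rule M0)
  then show thesis by (rule that)
qed

text \<open>Outside the frontiers of the pieces, a point lies in the interior of a piece, where \<open>F\<close>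
  agrees with a continuously differentiable map.\<close>

lemma piecewise_smooth_on_differentiable_ae:
  assumes "piecewise_smooth_on F K"
  obtains N where "negligible N" "\<And>z. z \<in> K - N \<Longrightarrow> F differentiable (at z)"
proof -
  from assms obtain \<P> where \<P>: "finite \<P>" "\<Union>\<P> = K"
    and P: "\<And>P. P \<in> \<P> \<Longrightarrow> compact P \<and> negligible (frontier P) \<and> (\<exists>U g g'. open U \<and> P \<subseteq> U \<and>
              (\<forall>x\<in>U. (g has_derivative blinfun_apply (g' x)) (at x)) \<and>
              continuous_on U g' \<and> (\<forall>x\<in>P. F x = g x))"
    unfolding piecewise_smooth_on_def by blast
  show thesis
  proof (rule that[of "\<Union>(frontier ` \<P>)"])
    show "negligible (\<Union>(frontier ` \<P>))"
      using \<P>(1) P by (intro negligible_Union) auto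
    fix z assume z: "z \<in> K - \<Union>(frontier ` \<P>)"
    then obtain Q where Q: "Q \<in> \<P>" "z \<in> Q" using \<P>(2) by blast
    then have int: "z \<in> interior Q"
      using z closure_subset[of Q] by (auto simp: frontier_def)
    from P[OF Q(1)] obtain U g g' where g: "Q \<subseteq> U"
      "\<And>x. x \<in> U \<Longrightarrow> (g has_derivative blinfun_apply (g' x)) (at x)" "\<And>x. x \<in> Q \<Longrightarrow> F x = g x" by blast
    have "(g has_derivative blinfun_apply (g' z)) (at z)" using g(1,2) Q(2) by blast
    then have "(F has_derivative blinfun_apply (g' z)) (at z)"
      by (rule has_derivative_transform_within_open[OF _ open_interior int])
         (use g(3) interior_subset[of Q] in force)
    then show "F differentiable (at z)" by (rule differentiableI)
  qed
qed

text \<open>The difference is taken between two points near \<open>z\<close>, neither of which has to be \<open>z\<close>: a derivative at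
  the single point \<open>z\<close> controls it as long as both points are at distance \<open>O(1/n)\<close>.\<close>

lemma difference_quotient_tendsto:
  fixes F :: "'a::real_normed_vector \<Rightarrow> 'b::real_normed_vector"
  assumes F: "(F has_derivative F') (at z)"
    and p: "\<And>n. n > 0 \<Longrightarrow> norm (p n - z) \<le> K / real n" and q: "\<And>n. n > 0 \<Longrightarrow> norm (q n - z) \<le> K / real n"
    and pq: "\<And>n. n > 0 \<Longrightarrow> real n *\<^sub>R (p n - q n) = v"
  shows "(\<lambda>n. real n *\<^sub>R (F (p n) - F (q n))) \<longlonglongrightarrow> F' v"
proof (rule LIMSEQ_I)
  fix e :: real assume e: "e > 0"
  interpret bounded_linear F' using F by (rule has_derivative_bounded_linear)
  have K: "K \<ge> 0" using order_trans[OF norm_ge_zero p[of 1]] by simp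
  define e' where "e' = e / (2 * K + 1)"
  have e': "e' > 0" using e K by (simp add: e'_def)
  obtain d where d: "d > 0" "\<And>y. norm (y - z) < d \<Longrightarrow> norm (F y - F z - F' (y - z)) \<le> e' * norm (y - z)"
    using F e' unfolding has_derivative_at_alt by blast
  obtain N where N: "K / d < real N" using reals_Archimedean2 by blast
  show "\<exists>N. \<forall>n\<ge>N. norm (real n *\<^sub>R (F (p n) - F (q n)) - F' v) < e"
  proof (intro exI[of _ "Suc N"] allI impI)
    fix n assume n: "n \<ge> Suc N"
    then have n0: "n > 0" by simp
    have "K / d < real n" using N n by linarith
    then have "K / real n < d" using d(1) n0 by (simp add: field_simps)
    then have small: "norm (F y - F z - F' (y - z)) \<le> e' * (K / real n)" if "norm (y - z) \<le> K / real n" for y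
      using d(2)[of y] that e' by (meson le_less_trans mult_left_mono order_trans less_imp_le)
    have "real n *\<^sub>R (F (p n) - F (q n)) - F' v
        = real n *\<^sub>R ((F (p n) - F z - F' (p n - z)) - (F (q n) - F z - F' (q n - z)))"
      unfolding pq[OF n0, symmetric] by (simp add: scaleR diff algebra_simps)
    also have "norm \<dots> \<le> real n * (e' * (K / real n) + e' * (K / real n))"
      unfolding norm_scaleR abs_of_nat
      by (intro mult_left_mono order_trans[OF norm_triangle_ineq4] add_mono small p q n0) simp
    also have "\<dots> = e' * (2 * K)" using n0 by (simp add: field_simps)
    also have "\<dots> < e' * (2 * K + 1)" using e' by simp
    also have "\<dots> = e" using K by (simp add: e'_def)
    finally show "norm (real n *\<^sub>R (F (p n) - F (q n)) - F' v) < e" .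
  qed
qed

lemma tendsto_triple:
  assumes "(f \<longlongrightarrow> a) A" "(g \<longlongrightarrow> b) A" "(h \<longlongrightarrow> c) A"
  shows "((\<lambda>x. triple (f x) (g x) (h x)) \<longlongrightarrow> triple a b c) A"
  unfolding triple_def
  by (intro tendsto_inner assms bounded_bilinear.tendsto[OF bilinear_cross[unfolded bilinear_conv_bounded_bilinear]])

section \<open>Signed area as a limit of sums of triple products\<close>

definition grid :: "nat \<Rightarrow> nat \<Rightarrow> nat \<Rightarrow> real \<times> real" where
  "grid n i j = (real i / real n, real j / real n)"

text \<open>The sum of the triple products of the two triangles below and above the diagonal of the cell; to
  leading order it is minus the signed area of the image of the cell.\<close>

definition cell_area :: "(real \<times> real \<Rightarrow> real ^ 3) \<Rightarrow> nat \<Rightarrow> nat \<Rightarrow> nat \<Rightarrow> real" where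
  "cell_area F n i j =
     triple (F (grid n i j)) (F (grid n (Suc i) j)) (F (grid n (Suc i) (Suc j)))
   + triple (F (grid n i j)) (F (grid n (Suc i) (Suc j))) (F (grid n i (Suc j)))"

text \<open>Open cells, so that no point lies in two of them.\<close>

definition cell :: "nat \<Rightarrow> nat \<Rightarrow> nat \<Rightarrow> (real \<times> real) set" where
  "cell n i j = box (grid n i j) (grid n (Suc i) (Suc j))"

lemma mem_cell:
  "z \<in> cell n i j \<longleftrightarrow> real i / n < fst z \<and> fst z < real (Suc i) / n \<and> real j / n < snd z \<and> snd z < real (Suc j) / n"
  by (cases z) (auto simp: cell_def grid_def mem_box Basis_prod_def)

lemma mem_unit_square: "z \<in> unit_square \<longleftrightarrow> 0 \<le> fst z \<and> fst z \<le> 1 \<and> 0 \<le> snd z \<and> snd z \<le> 1"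
  by (cases z) (auto simp: unit_square_def)

lemma grid_mem_unit_square: "i \<le> n \<Longrightarrow> j \<le> n \<Longrightarrow> grid n i j \<in> unit_square"
  by (auto simp: mem_unit_square grid_def divide_le_eq_1)

lemma cell_subset_unit_square:
  assumes "i < n" "j < n" shows "cell n i j \<subseteq> unit_square"
proof
  fix z assume z: "z \<in> cell n i j"
  have "real (Suc i) / n \<le> 1" "real (Suc j) / n \<le> 1" "real i / n \<ge> 0" "real j / n \<ge> 0" using assms by (auto simp: divide_le_eq_1)
  then show "z \<in> unit_square" using z unfolding mem_cell mem_unit_square by linarith
qed

lemma has_integral_cell:
  assumes "n > 0" "i < n" "j < n"
  shows "((\<lambda>z. if z \<in> cell n i j then c else 0) has_integral c / (real n)\<^sup>2) unit_square"
proof -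
  have "measure lborel (cbox (grid n i j) (grid n (Suc i) (Suc j))) = 1 / (real n)\<^sup>2"
    unfolding grid_def content_Pair using assms by (simp add: field_simps power2_eq_square)
  then have "((\<lambda>z. c) has_integral c / (real n)\<^sup>2) (cbox (grid n i j) (grid n (Suc i) (Suc j)))"
    using has_integral_const[of c "grid n i j" "grid n (Suc i) (Suc j)"] by simp
  then show ?thesis
    using cell_subset_unit_square[OF assms(2,3)]
    by (simp add: cell_def has_integral_open_interval[symmetric])
qed

lemma cell_unique: "z \<in> cell n i j \<Longrightarrow> z \<in> cell n i' j' \<Longrightarrow> i = i' \<and> j = j'"
proof -
  have aux: "a = b" if "real a / n < x" "x < real (Suc a) / n" "real b / n < x" "x < real (Suc b) / n" for a b and x :: real
  proof -
    have n: "real n > 0" using that(1,2) by (cases "n = 0") auto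
    have "real a < real (Suc b)" "real b < real (Suc a)"
      using that n by (auto simp: field_simps intro: order.strict_trans)
    then show ?thesis by linarith
  qed
  show "z \<in> cell n i j \<Longrightarrow> z \<in> cell n i' j' \<Longrightarrow> i = i' \<and> j = j'"
    unfolding mem_cell using aux by blast
qed

lemma cell_exists:
  assumes z: "z \<in> unit_square" and "fst z \<notin> \<rat>" "snd z \<notin> \<rat>" and n: "n > 0"
  obtains i j where "i < n" "j < n" "z \<in> cell n i j"
proof -
  have aux: "\<exists>a<n. real a / n < x \<and> x < real (Suc a) / n" if x: "0 \<le> x" "x \<le> 1" "x \<notin> \<rat>" for x :: real
  proof -
    define a where "a = nat \<lfloor>n * x\<rfloor>"
    have le: "0 \<le> n * x" using x by simp
    have rat: "x \<noteq> real k / n" for k using x(3) by auto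
    have a: "real a \<le> n * x" "n * x < real (Suc a)"
      using le unfolding a_def by linarith+
    then have a': "real a / n \<le> x" "x < real (Suc a) / n" using n by (auto simp: field_simps)
    have "x \<noteq> 1" using x(3) by auto
    then have "n * x < n" using x n by simp
    then have "a < n" using a(1) by linarith
    then show ?thesis using a' rat[of a] by force
  qed
  from aux[of "fst z"] aux[of "snd z"] show thesis
    using assms that unfolding mem_unit_square mem_cell by blast
qed

lemma negligible_rational_lines: "negligible {z :: real \<times> real. fst z \<in> \<rat> \<or> snd z \<in> \<rat>}"
proof -
  have "negligible {z :: real \<times> real. fst z = r}" "negligible {z :: real \<times> real. snd z = r}" for r
    using negligible_hyperplane[of "(1, 0) :: real \<times> real" r] negligible_hyperplane[of "(0, 1) :: real \<times> real" r]
    by (simp_all add: inner_prod_def zero_prod_def)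
  then have "negligible (\<Union>((\<lambda>r. {z :: real \<times> real. fst z = r} \<union> {z. snd z = r}) ` \<rat>))"
    by (intro negligible_countable_Union) (auto simp: countable_rat)
  moreover have "\<Union>((\<lambda>r. {z :: real \<times> real. fst z = r} \<union> {z. snd z = r}) ` \<rat>) = {z. fst z \<in> \<rat> \<or> snd z \<in> \<rat>}"
    by auto
  ultimately show ?thesis by simp
qed

lemma dist_grid_corners:
  assumes "n > 0" "i' \<in> {i, Suc i}" "j' \<in> {j, Suc j}" "i'' \<in> {i, Suc i}" "j'' \<in> {j, Suc j}"
  shows "dist (grid n i' j') (grid n i'' j'') \<le> 2 / real n"
proof -
  have "\<bar>real i' - real i''\<bar> \<le> 1" "\<bar>real j' - real j''\<bar> \<le> 1" using assms by auto
  then have "\<bar>real i' / n - real i'' / n\<bar> \<le> 1 / n" "\<bar>real j' / n - real j'' / n\<bar> \<le> 1 / n"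
    using assms(1) by (simp_all add: divide_right_mono flip: diff_divide_distrib)
  then show ?thesis
    using norm_Pair_le[of "real i' / n - real i'' / n" "real j' / n - real j'' / n"]
    by (simp add: grid_def dist_norm)
qed

lemma dist_cell_corner:
  assumes "z \<in> cell n i j" "i' \<in> {i, Suc i}" "j' \<in> {j, Suc j}"
  shows "dist (grid n i' j') z \<le> 2 / real n"
proof -
  have n: "n > 0" using assms(1) by (cases "n = 0") (auto simp: mem_cell)
  have s: "real (Suc k) / n = real k / n + 1 / n" for k by (simp add: add_divide_distrib)
  have "\<bar>real i' / n - fst z\<bar> \<le> 1 / n" "\<bar>real j' / n - snd z\<bar> \<le> 1 / n"
    using assms unfolding mem_cell s by (auto simp: s simp del: of_nat_Suc)
  then show ?thesis
    using norm_Pair_le[of "real i' / n - fst z" "real j' / n - snd z"]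
    by (cases z) (simp add: grid_def dist_norm)
qed

lemma abs_cell_area_le:
  assumes L: "L-lipschitz_on unit_square F" and S: "F ` unit_square \<subseteq> shape_sphere"
    and "n > 0" "i < n" "j < n"
  shows "\<bar>cell_area F n i j\<bar> \<le> 4 * L\<^sup>2 / (real n)\<^sup>2"
proof -
  have L0: "L \<ge> 0" by (rule lipschitz_on_nonneg[OF L])
  have d: "norm (F (grid n i' j') - F (grid n i j)) \<le> L * (2 / n)"
    if "i' \<in> {i, Suc i}" "j' \<in> {j, Suc j}" for i' j'
  proof -
    have "dist (F (grid n i' j')) (F (grid n i j)) \<le> L * dist (grid n i' j') (grid n i j)"
      by (rule lipschitz_onD[OF L]) (use that assms in \<open>auto intro!: grid_mem_unit_square\<close>)
    also have "\<dots> \<le> L * (2 / n)"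
      using dist_grid_corners[OF \<open>n > 0\<close> that, of i j] L0 by (intro mult_left_mono) auto
    finally show ?thesis by (simp add: dist_norm)
  qed
  have "F (grid n i j) \<in> shape_sphere"
    using S grid_mem_unit_square[of i n j] assms by auto
  then have half: "norm (F (grid n i j)) = 1/2" by (simp add: shape_sphere_def)
  have tr: "\<bar>triple (F (grid n i j)) (F (grid n i1 j1)) (F (grid n i2 j2))\<bar> \<le> 1/2 * (L * (2 / n) * (L * (2 / n)))"
    if "i1 \<in> {i, Suc i}" "j1 \<in> {j, Suc j}" "i2 \<in> {i, Suc i}" "j2 \<in> {j, Suc j}" for i1 i2 j1 j2
  proof -
    have "norm (F (grid n i1 j1) - F (grid n i j)) * norm (F (grid n i2 j2) - F (grid n i j)) \<le> L * (2 / n) * (L * (2 / n))"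
      using d that L0 by (intro mult_mono) auto
    then show ?thesis
      using abs_triple_le[of "F (grid n i j)" "F (grid n i1 j1)" "F (grid n i2 j2)"] half by simp
  qed
  have "\<bar>cell_area F n i j\<bar> \<le> 1/2 * (L * (2 / n) * (L * (2 / n))) + 1/2 * (L * (2 / n) * (L * (2 / n)))"
    unfolding cell_area_def by (intro order_trans[OF abs_triangle_ineq] add_mono tr) auto
  also have "\<dots> = 4 * L\<^sup>2 / (real n)\<^sup>2" by (simp add: power2_eq_square)
  finally show ?thesis .
qed

text \<open>The sum is the integral of the step function with value \<open>n\<^sup>2 cell_area F n i j\<close> on the cell
  \<open>(i, j)\<close>. The Lipschitz condition bounds these functions uniformly, and at a point of
  differentiability they converge to \<open>2 F \<bullet> (F\<^sub>x \<times> F\<^sub>y)\<close>, which is minus the area form. Dominated convergence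
  gives the limit.\<close>

lemma cell_area_sum_tendsto:
  assumes L: "L-lipschitz_on unit_square F" and S: "F ` unit_square \<subseteq> shape_sphere"
    and N: "negligible N" and diff: "\<And>z. z \<in> unit_square - N \<Longrightarrow> F differentiable (at z)"
  shows "(\<lambda>n. \<Sum>i<n. \<Sum>j<n. cell_area F n i j) \<longlonglongrightarrow> - signed_area F"
proof -
  define f where "f = (\<lambda>n z. \<Sum>i<n. \<Sum>j<n. if z \<in> cell n i j then (real n)\<^sup>2 * cell_area F n i j else 0)"
  \<comment> \<open>For \<open>z\<close> in this set, some open cell of each size contains \<open>z\<close>.\<close>
  define G where "G = unit_square - (N \<union> {z. fst z \<in> \<rat> \<or> snd z \<in> \<rat>})"
  define g where "g = (\<lambda>z. area_form (F z) (frechet_derivative F (at z) (1, 0)) (frechet_derivative F (at z) (0, 1)))"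
  have G: "G \<subseteq> unit_square" by (auto simp: G_def)
  have "unit_square - G \<subseteq> N \<union> {z. fst z \<in> \<rat> \<or> snd z \<in> \<rat>}" by (auto simp: G_def)
  then have G_null: "negligible (unit_square - G)"
    by (rule negligible_subset[rotated]) (intro negligible_Un N negligible_rational_lines)
  have spike: "negligible {x \<in> unit_square - G. h x \<noteq> (0::real)}" for h
    by (rule negligible_subset[OF G_null]) blast
  have spike': "negligible {x \<in> G - unit_square. h x \<noteq> (0::real)}" for h
    by (rule negligible_subset[OF negligible_empty]) (use G in blast)
  have f_int: "(f n has_integral (\<Sum>i<n. \<Sum>j<n. cell_area F n i j)) unit_square" if "n > 0" for n
  proof -
    have "((\<lambda>z. if z \<in> cell n i j then (real n)\<^sup>2 * cell_area F n i j else 0) has_integral cell_area F n i j) unit_square"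
      if "i < n" "j < n" for i j
      using has_integral_cell[OF \<open>n > 0\<close> that, of "(real n)\<^sup>2 * cell_area F n i j"] \<open>n > 0\<close> by simp
    then show ?thesis unfolding f_def by (intro has_integral_sum) auto
  qed
  have f_0: "f 0 = (\<lambda>z. 0)" by (simp add: f_def fun_eq_iff)
  have f_on_cell: "f n z = (real n)\<^sup>2 * cell_area F n i j" if "z \<in> cell n i j" "i < n" "j < n" for n i j z
  proof -
    have mem: "z \<in> cell n i' j' \<longleftrightarrow> i' = i \<and> j' = j" for i' j'
      using cell_unique that(1) by blast
    have "f n z = (\<Sum>i'<n. \<Sum>j'<n. if i' = i then if j' = j then (real n)\<^sup>2 * cell_area F n i j else 0 else 0)"
      unfolding f_def mem by (intro sum.cong) auto
    also have "\<dots> = (\<Sum>i'<n. if i' = i then (real n)\<^sup>2 * cell_area F n i j else 0)"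
      using that(3) by (intro sum.cong) (auto simp: sum.delta)
    also have "\<dots> = (real n)\<^sup>2 * cell_area F n i j"
      using that(2) by (simp add: sum.delta)
    finally show ?thesis .
  qed
  have f_G: "(f n has_integral (\<Sum>i<n. \<Sum>j<n. cell_area F n i j)) G" for n
  proof (cases "n = 0")
    case False
    then have "(f n has_integral (\<Sum>i<n. \<Sum>j<n. cell_area F n i j)) unit_square"
      using f_int[of n] by simp
    then show ?thesis
      using has_integral_spike_set_eq[OF spike spike'] by blast
  qed (simp add: f_0)
  have "(\<lambda>n. integral G (f n)) \<longlonglongrightarrow> integral G (\<lambda>z. - g z)"
  proof (rule dominated_convergence(2)[where h = "\<lambda>_. 4 * L\<^sup>2"])
    show "f n integrable_on G" for n using f_G by blast
    have "(\<lambda>_::real \<times> real. 4 * L\<^sup>2) integrable_on unit_square"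
      unfolding unit_square_def by (rule integrable_const)
    then show "(\<lambda>_::real \<times> real. 4 * L\<^sup>2) integrable_on G"
      by (rule integrable_spike_set[OF _ spike spike'])
    show "norm (f n z) \<le> 4 * L\<^sup>2" if "z \<in> G" for n z
    proof (cases "n = 0")
      case False
      have "z \<in> unit_square" "fst z \<notin> \<rat>" "snd z \<notin> \<rat>" using that by (auto simp: G_def)
      with False obtain i j where ij: "i < n" "j < n" "z \<in> cell n i j"
        by (metis cell_exists gr0I)
      have "norm (f n z) = (real n)\<^sup>2 * \<bar>cell_area F n i j\<bar>"
        by (simp add: f_on_cell[OF ij(3,1,2)] abs_mult)
      also have "\<dots> \<le> (real n)\<^sup>2 * (4 * L\<^sup>2 / (real n)\<^sup>2)"
        using abs_cell_area_le[OF L S _ ij(1,2)] False by (intro mult_left_mono) auto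
      also have "\<dots> = 4 * L\<^sup>2" using False by simp
      finally show ?thesis .
    qed (simp add: f_0)
    show "(\<lambda>n. f n z) \<longlonglongrightarrow> - g z" if z: "z \<in> G" for z
    proof -
      have "\<exists>i j. i < n \<and> j < n \<and> z \<in> cell n i j" if "n > 0" for n
        using cell_exists[of z n] that z unfolding G_def by blast
      then obtain I J where IJ: "\<And>n. n > 0 \<Longrightarrow> I n < n \<and> J n < n \<and> z \<in> cell n (I n) (J n)" by metis
      define F' where "F' = frechet_derivative F (at z)"
      have F': "(F has_derivative F') (at z)"
        using diff[of z] z unfolding F'_def G_def frechet_derivative_works by blast
      interpret F': bounded_linear F' using F' by (rule has_derivative_bounded_linear)
      \<comment> \<open>The corners of the cell around \<open>z\<close>.\<close>
      define c where "c = (\<lambda>a b n. grid n (I n + a) (J n + b))"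
      have c: "norm (c a b n - z) \<le> 2 / real n" if "n > 0" "a \<le> 1" "b \<le> 1" for a b n
        using dist_cell_corner[of z n "I n" "J n" "I n + a" "J n + b"] IJ[OF that(1)] that
        by (cases a; cases b) (auto simp: c_def dist_norm)
      have quot: "(\<lambda>n. real n *\<^sub>R (F (c a b n) - F (c 0 0 n))) \<longlonglongrightarrow> F' (real a, real b)"
        if "a \<le> 1" "b \<le> 1" for a b
      proof (rule difference_quotient_tendsto[OF F'])
        show "norm (c a b n - z) \<le> 2 / real n" if "n > 0" for n
          using c \<open>a \<le> 1\<close> \<open>b \<le> 1\<close> that by blast
        show "norm (c 0 0 n - z) \<le> 2 / real n" if "n > 0" for n using c that by simp
        show "real n *\<^sub>R (c a b n - c 0 0 n) = (real a, real b)" if "n > 0" for n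
          using that by (simp add: c_def grid_def field_simps)
      qed
      have "(\<lambda>n. c 0 0 n - z) \<longlonglongrightarrow> 0"
      proof (rule Lim_null_comparison)
        show "\<forall>\<^sub>F n in sequentially. norm (c 0 0 n - z) \<le> 2 / real n"
          by (rule eventually_mono[OF eventually_gt_at_top[of 0]]) (use c in simp)
        show "(\<lambda>n. 2 / real n) \<longlonglongrightarrow> 0" by (rule lim_const_over_n)
      qed
      then have "c 0 0 \<longlonglongrightarrow> z" by (simp add: LIM_zero_iff)
      then have F0: "(\<lambda>n. F (c 0 0 n)) \<longlonglongrightarrow> F z"
        by (rule isCont_tendsto_compose[OF has_derivative_continuous[OF F']])
      have ev: "\<forall>\<^sub>F n in sequentially.
          triple (F (c 0 0 n)) (real n *\<^sub>R (F (c 1 0 n) - F (c 0 0 n))) (real n *\<^sub>R (F (c 1 1 n) - F (c 0 0 n)))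
        + triple (F (c 0 0 n)) (real n *\<^sub>R (F (c 1 1 n) - F (c 0 0 n))) (real n *\<^sub>R (F (c 0 1 n) - F (c 0 0 n)))
        = f n z"
      proof (rule eventually_mono[OF eventually_gt_at_top[of 0]])
        fix n :: nat assume n: "n > 0"
        have sc: "triple u (k *\<^sub>R (v - u)) (k *\<^sub>R (w - u)) = k\<^sup>2 * triple u v w" for u v w k
          unfolding triple_edges[of u v w]
          by (simp add: triple_def cross_mult_left cross_mult_right power2_eq_square)
        have "f n z = (real n)\<^sup>2 * cell_area F n (I n) (J n)"
          using IJ[OF n] by (intro f_on_cell) auto
        then show "triple (F (c 0 0 n)) (real n *\<^sub>R (F (c 1 0 n) - F (c 0 0 n))) (real n *\<^sub>R (F (c 1 1 n) - F (c 0 0 n)))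
        + triple (F (c 0 0 n)) (real n *\<^sub>R (F (c 1 1 n) - F (c 0 0 n))) (real n *\<^sub>R (F (c 0 1 n) - F (c 0 0 n)))
        = f n z"
          unfolding sc by (simp add: c_def cell_area_def distrib_left)
      qed
      define u where "u = F' (1, 0)"
      define v where "v = F' (0, 1)"
      have uv: "F' (1, 1) = u + v" unfolding u_def v_def F'.add[symmetric] by simp
      have "(\<lambda>n. triple (F (c 0 0 n)) (real n *\<^sub>R (F (c 1 0 n) - F (c 0 0 n))) (real n *\<^sub>R (F (c 1 1 n) - F (c 0 0 n)))
        + triple (F (c 0 0 n)) (real n *\<^sub>R (F (c 1 1 n) - F (c 0 0 n))) (real n *\<^sub>R (F (c 0 1 n) - F (c 0 0 n))))
        \<longlonglongrightarrow> triple (F z) u (u + v) + triple (F z) (u + v) v"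
        using quot[of 1 0] quot[of 1 1] quot[of 0 1]
        by (intro tendsto_add tendsto_triple F0) (auto simp: uv u_def[symmetric] v_def[symmetric])
      also have "triple (F z) u (u + v) + triple (F z) (u + v) v = - g z"
        by (simp add: triple_def g_def area_form_def cross_add_left cross_add_right F'_def[symmetric] u_def v_def)
      finally show ?thesis using ev by (rule Lim_transform_eventually)
    qed
  qed
  moreover have "integral G (f n) = (\<Sum>i<n. \<Sum>j<n. cell_area F n i j)" for n
    using f_G by (rule integral_unique)
  moreover have "integral G (\<lambda>z. - g z) = - signed_area F"
    using integral_subset_negligible[OF G G_null, of g] by (simp add: signed_area_def g_def[symmetric])
  ultimately show ?thesis by simp
qed

section \<open>Holonomy around the boundary of a disk\<close>

lemma herm_nonzero_if_close:
  assumes "lifts a A" "lifts b B" "A \<in> shape_sphere" "B \<in> shape_sphere" "norm a = 1" "norm b = 1" "norm (B - A) < 1"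
  shows "herm a b \<noteq> 0"
proof -
  have h: "hopf a = A" "hopf b = B" using assms by (simp_all add: lifts_def)
  have AB: "A \<bullet> B = 1/4 - (norm (B - A))\<^sup>2 / 2"
    using assms by (simp add: mem_shape_sphere power2_norm_eq_inner inner_diff_left inner_diff_right inner_commute field_simps)
  have "(cmod (herm a b))\<^sup>2 = 1 - (norm (B - A))\<^sup>2"
    unfolding norm_herm_sq h AB using assms by simp
  moreover have "(norm (B - A))\<^sup>2 < 1" using assms(7) by (simp add: power_less_one_iff)
  ultimately show ?thesis by auto
qed

lemma prod_cis: "(\<Prod>i\<in>A. cis (f i)) = cis (sum f A)"
  by (induction A rule: infinite_finite_induct) (simp_all add: cis_mult)

lemma grid_product_cis_estimate:
  fixes w :: "nat \<Rightarrow> nat \<Rightarrow> complex"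
  assumes w: "\<And>i j. i < n \<Longrightarrow> j < n \<Longrightarrow> cmod (w i j) \<le> 1"
    and e: "\<And>i j. i < n \<Longrightarrow> j < n \<Longrightarrow> cmod (w i j - cis (2 * \<theta> i j)) \<le> e"
  shows "cmod ((\<Prod>i<n. \<Prod>j<n. w i j) - cis (2 * (\<Sum>i<n. \<Sum>j<n. \<theta> i j))) \<le> (real n)\<^sup>2 * e"
proof -
  let ?N = "{..<n} \<times> {..<n}"
  have "(\<Prod>i<n. \<Prod>j<n. w i j) - cis (2 * (\<Sum>i<n. \<Sum>j<n. \<theta> i j))
      = (\<Prod>x\<in>?N. w (fst x) (snd x)) - (\<Prod>x\<in>?N. cis (2 * \<theta> (fst x) (snd x)))"
    unfolding prod.cartesian_product sum.cartesian_product prod_cis sum_distrib_left[symmetric] case_prod_beta ..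
  also have "cmod \<dots> \<le> (\<Sum>x\<in>?N. cmod (w (fst x) (snd x) - cis (2 * \<theta> (fst x) (snd x))))"
    by (rule norm_prod_diff) (auto intro: w)
  also have "\<dots> \<le> (\<Sum>x\<in>?N. e)"
    by (rule sum_mono) (auto intro: e)
  also have "\<dots> = (real n)\<^sup>2 * e" by (simp add: power2_eq_square)
  finally show ?thesis .
qed

text \<open>Each of the \<open>n\<^sup>2\<close> cells contributes an error of order \<open>n\<^sup>-\<^sup>4\<close> when its phase is replaced by
  \<open>cis (2 * cell_area F n i j)\<close>. For large \<open>n\<close> neighbouring points are close, so that none of the Hermitian products
  vanishes and the phases are defined.\<close>

lemma plaquette_product_tendsto:
  assumes L: "L-lipschitz_on unit_square F" and S: "F ` unit_square \<subseteq> shape_sphere"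
    and area: "(\<lambda>n. \<Sum>i<n. \<Sum>j<n. cell_area F n i j) \<longlonglongrightarrow> A"
    and s: "\<And>z. z \<in> unit_square \<Longrightarrow> norm (s z) = 1 \<and> lifts (s z) (F z)"
  defines "H \<equiv> \<lambda>n i j. sgn (herm (s (grid n i j)) (s (grid n (Suc i) j)))"
    and "V \<equiv> \<lambda>n i j. sgn (herm (s (grid n i j)) (s (grid n i (Suc j))))"
  shows "(\<lambda>n. (\<Prod>i<n. H n i 0) * (\<Prod>j<n. V n n j) / ((\<Prod>i<n. H n i n) * (\<Prod>j<n. V n 0 j))) \<longlonglongrightarrow> cis (2 * A)"
proof -
  have L0: "L \<ge> 0" by (rule lipschitz_on_nonneg[OF L])
  \<comment> \<open>From this \<open>N\<close> on, the corners of a cell have images at distance at most \<open>1/2\<close>.\<close>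
  obtain N where N: "4 * L + 1 < real N" using reals_Archimedean2 by blast
  define P where "P = (\<lambda>n. (\<Prod>i<n. H n i 0) * (\<Prod>j<n. V n n j) / ((\<Prod>i<n. H n i n) * (\<Prod>j<n. V n 0 j)))"
  have close: "norm (F (grid n i' j') - F (grid n i'' j'')) \<le> 2 * L / n" 
    if "n > 0" "i' \<in> {i, Suc i}" "j' \<in> {j, Suc j}" "i'' \<in> {i, Suc i}" "j'' \<in> {j, Suc j}"
      "i' \<le> n" "j' \<le> n" "i'' \<le> n" "j'' \<le> n" for n i j i' j' i'' j''
  proof -
    have "dist (F (grid n i' j')) (F (grid n i'' j'')) \<le> L * dist (grid n i' j') (grid n i'' j'')"
      by (intro lipschitz_onD[OF L] grid_mem_unit_square that)
    also have "\<dots> \<le> L * (2 / n)"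
      by (intro mult_left_mono dist_grid_corners[OF that(1-5)] L0)
    finally show ?thesis by (simp add: dist_norm mult.commute)
  qed
  have SF: "F (grid n i j) \<in> shape_sphere" if "i \<le> n" "j \<le> n" for n i j
    using S grid_mem_unit_square[OF that] by blast
  have sg: "norm (s (grid n i j)) = 1" "lifts (s (grid n i j)) (F (grid n i j))" if "i \<le> n" "j \<le> n" for n i j
    using s[OF grid_mem_unit_square[OF that]] by auto
  have main: "cmod (P n - cis (2 * (\<Sum>i<n. \<Sum>j<n. cell_area F n i j))) \<le> 320 * L ^ 4 / (real n)\<^sup>2"
    if n: "n \<ge> N" for n
  proof -
    have n0: "n > 0" and Ln: "2 * L / n \<le> 1/2"
    proof -
      have *: "4 * L + 1 < real n" using N n by linarith
      then have "real n > 0" using L0 by linarith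
      then show "n > 0" by simp
      then show "2 * L / n \<le> 1/2" using * by (simp add: field_simps)
    qed
    have nz: "herm (s (grid n i' j')) (s (grid n i'' j'')) \<noteq> 0"
      if "i' \<in> {i, Suc i}" "j' \<in> {j, Suc j}" "i'' \<in> {i, Suc i}" "j'' \<in> {j, Suc j}"
      "i' \<le> n" "j' \<le> n" "i'' \<le> n" "j'' \<le> n" for i j i' j' i'' j''
    proof (rule herm_nonzero_if_close)
      show "norm (F (grid n i'' j'') - F (grid n i' j')) < 1"
        using close[OF n0 that(3,4,1,2,7,8,5,6)] Ln by linarith
    qed (rule sg SF that)+
    have H1: "cmod (H n i j) = 1" if "i < n" "j \<le> n" for i j
      using nz[of i i j j "Suc i" j] that by (simp add: H_def norm_sgn)
    have V1: "cmod (V n i j) = 1" if "i \<le> n" "j < n" for i j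
      using nz[of i i j j i "Suc j"] that by (simp add: V_def norm_sgn)
    have HV: "P n = (\<Prod>i<n. \<Prod>j<n. H n i j * V n (Suc i) j / (H n i (Suc j) * V n i j))"
      unfolding P_def
    proof (rule grid_product_telescope[symmetric])
      show "H n i j \<noteq> 0" if "i < n" "j \<le> n" for i j
        using H1[OF that] by auto
      show "V n i j \<noteq> 0" if "i \<le> n" "j < n" for i j
        using V1[OF that] by auto
    qed
    have plaq: "cmod (H n i j * V n (Suc i) j / (H n i (Suc j) * V n i j) - cis (2 * cell_area F n i j)) \<le> 20 * (2 * L / n) ^ 4"
      if ij: "i < n" "j < n" for i j
    proof -
      have eq: "H n i j * V n (Suc i) j / (H n i (Suc j) * V n i j)
          = sgn (herm (s (grid n i j)) (s (grid n (Suc i) j))) * sgn (herm (s (grid n (Suc i) j)) (s (grid n (Suc i) (Suc j))))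
          * sgn (herm (s (grid n (Suc i) (Suc j))) (s (grid n i (Suc j)))) * sgn (herm (s (grid n i (Suc j))) (s (grid n i j)))"
        unfolding H_def V_def
          sgn_herm_commute[of "s (grid n (Suc i) (Suc j))" "s (grid n i (Suc j))"]
          sgn_herm_commute[of "s (grid n i (Suc j))" "s (grid n i j)"]
        by (simp add: divide_inverse)
      have le: "i \<le> n" "Suc i \<le> n" "j \<le> n" "Suc j \<le> n" using ij by auto
      show ?thesis
        unfolding eq cell_area_def
      proof (rule plaquette_phase_estimate)
        let ?X = "{F (grid n i j), F (grid n (Suc i) j), F (grid n (Suc i) (Suc j)), F (grid n i (Suc j))}"
        have corner: "\<exists>i'\<in>{i, Suc i}. \<exists>j'\<in>{j, Suc j}. X = F (grid n i' j')" if "X \<in> ?X" for X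
          using that by auto
        fix X Y assume XY: "X \<in> ?X" "Y \<in> ?X"
        obtain i' j' where X: "i' \<in> {i, Suc i}" "j' \<in> {j, Suc j}" "X = F (grid n i' j')"
          using corner[OF XY(1)] by blast
        obtain i'' j'' where Y: "i'' \<in> {i, Suc i}" "j'' \<in> {j, Suc j}" "Y = F (grid n i'' j'')"
          using corner[OF XY(2)] by blast
        have "i' \<le> n" "j' \<le> n" "i'' \<le> n" "j'' \<le> n" using X Y le by auto
        then show "norm (Y - X) \<le> 2 * L / n"
          unfolding X(3) Y(3) by (intro close[OF n0 Y(1,2) X(1,2)])
      next
        show "herm (s (grid n i j)) (s (grid n (Suc i) (Suc j))) \<noteq> 0"
          using nz[of i i j j "Suc i" "Suc j"] le by simp
        show "{F (grid n i j), F (grid n (Suc i) j), F (grid n (Suc i) (Suc j)), F (grid n i (Suc j))} \<subseteq> shape_sphere"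
          using SF le by simp
      qed (fact sg Ln | rule sg le)+
    qed
    have "cmod (P n - cis (2 * (\<Sum>i<n. \<Sum>j<n. cell_area F n i j))) \<le> (real n)\<^sup>2 * (20 * (2 * L / n) ^ 4)"
      unfolding HV
    proof (rule grid_product_cis_estimate)
      fix i j assume ij: "i < n" "j < n"
      then have "cmod (H n i j) = 1" "cmod (V n (Suc i) j) = 1" "cmod (H n i (Suc j)) = 1" "cmod (V n i j) = 1"
        by (simp_all add: H1 V1)
      then show "cmod (H n i j * V n (Suc i) j / (H n i (Suc j) * V n i j)) \<le> 1"
        by (simp add: norm_mult norm_divide)
    qed (rule plaq)
    also have "\<dots> = 320 * L ^ 4 / (real n)\<^sup>2"
    proof -
      have cancel: "w * (20 * (a / (w * w))) = 20 * a / w" if "w \<noteq> 0" for a w :: real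
        using that by simp
      have "(2 * L / real n) ^ 4 = 16 * L ^ 4 / ((real n)\<^sup>2 * (real n)\<^sup>2)"
        using power_add[of "real n" 2 2] by (simp only: power_divide power_mult_distrib) simp
      then show ?thesis using n0 cancel[of "(real n)\<^sup>2" "16 * L ^ 4"] by (simp only:) simp
    qed
    finally show ?thesis .
  qed
  have "(\<lambda>n. P n - cis (2 * (\<Sum>i<n. \<Sum>j<n. cell_area F n i j))) \<longlonglongrightarrow> 0"
  proof (rule Lim_null_comparison)
    show "\<forall>\<^sub>F n in sequentially. cmod (P n - cis (2 * (\<Sum>i<n. \<Sum>j<n. cell_area F n i j))) \<le> 320 * L ^ 4 * (1 / real n)\<^sup>2"
    proof (rule eventually_mono[OF eventually_ge_at_top[of N]])
      fix n assume "n \<ge> N"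
      from main[OF this] show "cmod (P n - cis (2 * (\<Sum>i<n. \<Sum>j<n. cell_area F n i j))) \<le> 320 * L ^ 4 * (1 / real n)\<^sup>2"
        by (simp only: power_one_over times_divide_eq_right mult_1_right)
    qed
    have "(\<lambda>n. 320 * L ^ 4 * (1 / real n)\<^sup>2) \<longlonglongrightarrow> 320 * L ^ 4 * 0\<^sup>2"
      by (intro tendsto_mult_left tendsto_power lim_const_over_n)
    then show "(\<lambda>n. 320 * L ^ 4 * (1 / real n)\<^sup>2) \<longlonglongrightarrow> 0" by simp
  qed
  moreover have "(\<lambda>n. cis (2 * (\<Sum>i<n. \<Sum>j<n. cell_area F n i j))) \<longlonglongrightarrow> cis (2 * A)"
    by (intro tendsto_cis tendsto_mult_left area)
  ultimately have "(\<lambda>n. P n - cis (2 * (\<Sum>i<n. \<Sum>j<n. cell_area F n i j)) + cis (2 * (\<Sum>i<n. \<Sum>j<n. cell_area F n i j)))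
      \<longlonglongrightarrow> 0 + cis (2 * A)"
    by (rule tendsto_add)
  then show ?thesis by (simp add: P_def)
qed

lemma square_boundary_eq:
  "square_boundary t = (if t \<le> 1/2 then (2 * t, 0) else if t \<le> 3/4 then (1, 4 * t - 2)
     else if t \<le> 7/8 then (7 - 8 * t, 1) else (0, 8 - 8 * t))"
proof -
  have 1: "2 * t - 1 \<le> 1/2 \<longleftrightarrow> t \<le> 3/4" "2 * (2 * t - 1) - 1 \<le> 1/2 \<longleftrightarrow> t \<le> 7/8" by auto
  have 2: "linepath (0, 0) (1, 0) (2 * t) = (2 * t, 0 :: real)"
    "linepath (1, 0) (1, 1) (2 * (2 * t - 1)) = (1 :: real, 4 * t - 2)"
    "linepath (1, 1) (0, 1) (2 * (2 * (2 * t - 1) - 1)) = (7 - 8 * t, 1 :: real)"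
    "linepath (0, 1) (0, 0) (2 * (2 * (2 * t - 1) - 1) - 1) = (0 :: real, 8 - 8 * t)"
    by (simp_all add: linepath_def)
  show ?thesis unfolding square_boundary_def joinpaths_def 1 2 ..
qed

text \<open>The iterated concatenation spends half of the parameter interval on the first side, a quarter on the second
  and an eighth on each of the last two; the last two sides are run through against the numbering
  of the grid.\<close>

lemma square_boundary_sides:
  assumes "n > 0" "i \<le> n"
  shows "square_boundary (0 + (1/2 - 0) * real i / real n) = grid n i 0"
    and "square_boundary (1/2 + (3/4 - 1/2) * real i / real n) = grid n n i"
    and "square_boundary (3/4 + (7/8 - 3/4) * real i / real n) = grid n (n - i) n"
    and "square_boundary (7/8 + (1 - 7/8) * real i / real n) = grid n 0 (n - i)"
proof -
  define x where "x = real i / real n"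
  have x: "0 \<le> x" "x \<le> 1" using assms by (auto simp: x_def divide_le_eq_1)
  have e: "a * real i / real n = a * x" for a by (simp add: x_def)
  have nx: "real (n - i) / real n = 1 - x" "real n / real n = 1"
    using assms by (simp_all add: x_def of_nat_diff diff_divide_distrib)
  have g: "grid n i 0 = (x, 0)" "grid n n i = (1, x)" "grid n (n - i) n = (1 - x, 1)" "grid n 0 (n - i) = (0, 1 - x)"
    unfolding grid_def nx by (simp_all only: x_def of_nat_0 div_0)
  have sb: "square_boundary (0 + (1/2 - 0) * x) = (x, 0)" "square_boundary (1/2 + (3/4 - 1/2) * x) = (1, x)"
    "square_boundary (3/4 + (7/8 - 3/4) * x) = (1 - x, 1)" "square_boundary (7/8 + (1 - 7/8) * x) = (0, 1 - x)"
    using x by (cases "x = 0"; simp add: square_boundary_eq)+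
  show "square_boundary (0 + (1/2 - 0) * real i / real n) = grid n i 0"
    and "square_boundary (1/2 + (3/4 - 1/2) * real i / real n) = grid n n i"
    and "square_boundary (3/4 + (7/8 - 3/4) * real i / real n) = grid n (n - i) n"
    and "square_boundary (7/8 + (1 - 7/8) * real i / real n) = grid n 0 (n - i)"
    unfolding e g by (fact sb)+
qed

text \<open>The product of the edge phases along the boundary of the grid is evaluated twice: through the cells
  it tends to \<open>cis (- 2 * signed_area D)\<close>, and through the horizontal lift, side by side, it
  tends to the ratio of the factors between the chosen lift and \<open>\<zeta>\<close> at the two ends. The chosen lift has the
  same value at both ends, so this ratio is \<open>1 / sgn l\<close>.\<close>

theorem disk_holonomy:
  assumes lift: "horizontal_lift c 0 1 \<zeta>" and D: "disk_bounded_by D c"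
    and l: "\<zeta> 1 = scaleC2 l (\<zeta> 0)"
  shows "sgn l = cis (2 * signed_area D)"
proof -
  from D have S: "D ` unit_square \<subseteq> shape_sphere" and smooth: "piecewise_smooth_on D unit_square"
    by (auto simp: disk_bounded_by_def)
  from D obtain \<phi> where \<phi>: "continuous_on {0..1} \<phi>" "mono_on {0..1} \<phi>" "\<phi> 0 = 0" "\<phi> 1 = (1::real)"
    and bd: "\<And>u. u \<in> {0..1} \<Longrightarrow> D (square_boundary u) = c (\<phi> u)"
    unfolding disk_bounded_by_def by blast
  have "convex unit_square" by (simp add: unit_square_def)
  with smooth obtain L where L: "L-lipschitz_on unit_square D"
    using piecewise_smooth_on_lipschitz by blast
  obtain N where N: "negligible N" "\<And>z. z \<in> unit_square - N \<Longrightarrow> D differentiable (at z)"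
    using piecewise_smooth_on_differentiable_ae[OF smooth] by blast
  note area = cell_area_sum_tendsto[OF L S N]
  have "\<exists>a. norm a = 1 \<and> lifts a (D z)" if "z \<in> unit_square" for z
    using ex_unit_lift[of "D z"] S that by blast
  then obtain s where s: "\<And>z. z \<in> unit_square \<Longrightarrow> norm (s z) = 1 \<and> lifts (s z) (D z)" by metis
  define H where "H = (\<lambda>n i j. sgn (herm (s (grid n i j)) (s (grid n (Suc i) j))))"
  define V where "V = (\<lambda>n i j. sgn (herm (s (grid n i j)) (s (grid n i (Suc j)))))"
  have lim1: "(\<lambda>n. (\<Prod>i<n. H n i 0) * (\<Prod>j<n. V n n j) / ((\<Prod>i<n. H n i n) * (\<Prod>j<n. V n 0 j)))
      \<longlonglongrightarrow> cis (2 * (- signed_area D))"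
    unfolding H_def V_def by (rule plaquette_product_tendsto[OF L S area s])

  define B where "B = (\<lambda>u. s (square_boundary u))"
  have sb_mem: "square_boundary u \<in> unit_square" if "u \<in> {0..1}" for u
    using that by (simp add: mem_unit_square square_boundary_eq)
  have \<phi>_mem: "\<phi> u \<in> {0..1}" if "u \<in> {0..1}" for u
    using mono_onD[OF \<phi>(2), of 0 u] mono_onD[OF \<phi>(2), of u 1] that \<phi>(3,4) by simp
  have "\<exists>k. k \<noteq> 0 \<and> \<zeta> (\<phi> u) = scaleC2 k (B u)" if u: "u \<in> {0..1}" for u
  proof -
    have "lifts (B u) (c (\<phi> u))" using s[OF sb_mem[OF u]] bd[OF u] by (simp add: B_def)
    moreover have "lifts (\<zeta> (\<phi> u)) (c (\<phi> u))" by (rule horizontal_lift_lifts[OF lift \<phi>_mem[OF u]])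
    moreover have "c (\<phi> u) \<in> shape_sphere" using S sb_mem[OF u] bd[OF u] by auto
    ultimately show ?thesis using lifts_collinear by metis
  qed
  then obtain k where k: "\<And>u. u \<in> {0..1} \<Longrightarrow> \<zeta> (\<phi> u) = scaleC2 (k u) (B u)" "\<And>u. u \<in> {0..1} \<Longrightarrow> k u \<noteq> 0" by metis
  have side: "(\<lambda>n. \<Prod>i<n. sgn (herm (B (\<alpha> + (\<beta> - \<alpha>) * real i / real n)) (B (\<alpha> + (\<beta> - \<alpha>) * real (Suc i) / real n))))
      \<longlonglongrightarrow> sgn (k \<alpha>) / sgn (k \<beta>)" if "0 \<le> \<alpha>" "\<alpha> < \<beta>" "\<beta> \<le> 1" for \<alpha> \<beta>
  proof (rule gauge_phase_product[OF lift])
    have sub: "{\<alpha>..\<beta>} \<subseteq> {0..1}" using that by auto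
    show "continuous_on {\<alpha>..\<beta>} \<phi>" "mono_on {\<alpha>..\<beta>} \<phi>" "\<phi> ` {\<alpha>..\<beta>} \<subseteq> {0..1}"
      using \<phi>(1,2) sub \<phi>_mem by (auto intro: continuous_on_subset mono_on_subset)
  qed (use that k in auto)
  have edge: "sgn (herm (B u) (B v)) = sgn (herm (s x) (s y))" if "square_boundary u = x" "square_boundary v = y" for u v x y
    by (simp add: B_def that)
  have lim2: "(\<lambda>n. (\<Prod>i<n. H n i 0) * (\<Prod>j<n. V n n j) / ((\<Prod>i<n. H n i n) * (\<Prod>j<n. V n 0 j)))
      \<longlonglongrightarrow> (sgn (k 0) / sgn (k (1/2))) * (sgn (k (1/2)) / sgn (k (3/4))) * (sgn (k (3/4)) / sgn (k (7/8))) * (sgn (k (7/8)) / sgn (k 1))"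
  proof (rule Lim_transform_eventually)
    show "(\<lambda>n. (\<Prod>i<n. sgn (herm (B (0 + (1/2 - 0) * real i / real n)) (B (0 + (1/2 - 0) * real (Suc i) / real n))))
       * (\<Prod>i<n. sgn (herm (B (1/2 + (3/4 - 1/2) * real i / real n)) (B (1/2 + (3/4 - 1/2) * real (Suc i) / real n))))
       * (\<Prod>i<n. sgn (herm (B (3/4 + (7/8 - 3/4) * real i / real n)) (B (3/4 + (7/8 - 3/4) * real (Suc i) / real n))))
       * (\<Prod>i<n. sgn (herm (B (7/8 + (1 - 7/8) * real i / real n)) (B (7/8 + (1 - 7/8) * real (Suc i) / real n)))))
      \<longlonglongrightarrow> (sgn (k 0) / sgn (k (1/2))) * (sgn (k (1/2)) / sgn (k (3/4))) * (sgn (k (3/4)) / sgn (k (7/8))) * (sgn (k (7/8)) / sgn (k 1))"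
      by (intro tendsto_mult side) auto
    show "\<forall>\<^sub>F n in sequentially. (\<Prod>i<n. sgn (herm (B (0 + (1/2 - 0) * real i / real n)) (B (0 + (1/2 - 0) * real (Suc i) / real n))))
       * (\<Prod>i<n. sgn (herm (B (1/2 + (3/4 - 1/2) * real i / real n)) (B (1/2 + (3/4 - 1/2) * real (Suc i) / real n))))
       * (\<Prod>i<n. sgn (herm (B (3/4 + (7/8 - 3/4) * real i / real n)) (B (3/4 + (7/8 - 3/4) * real (Suc i) / real n))))
       * (\<Prod>i<n. sgn (herm (B (7/8 + (1 - 7/8) * real i / real n)) (B (7/8 + (1 - 7/8) * real (Suc i) / real n))))
       = (\<Prod>i<n. H n i 0) * (\<Prod>j<n. V n n j) / ((\<Prod>i<n. H n i n) * (\<Prod>j<n. V n 0 j))"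
    proof (rule eventually_mono[OF eventually_gt_at_top[of 0]])
      fix n :: nat assume n: "n > 0"
      note sides = square_boundary_sides[OF n]
      have inv: "(\<Prod>i<n. inverse (f i)) = inverse (\<Prod>i<n. f i)" for f :: "nat \<Rightarrow> complex"
        using prod_inversef[of f "{..<n}"] by (simp add: comp_def)
      have 1: "(\<Prod>i<n. sgn (herm (B (0 + (1/2 - 0) * real i / real n)) (B (0 + (1/2 - 0) * real (Suc i) / real n)))) = (\<Prod>i<n. H n i 0)"
        unfolding H_def by (intro prod.cong refl edge sides) auto
      have 2: "(\<Prod>i<n. sgn (herm (B (1/2 + (3/4 - 1/2) * real i / real n)) (B (1/2 + (3/4 - 1/2) * real (Suc i) / real n)))) = (\<Prod>i<n. V n n i)"
        unfolding V_def by (intro prod.cong refl edge sides) auto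
      have "(\<Prod>i<n. sgn (herm (B (3/4 + (7/8 - 3/4) * real i / real n)) (B (3/4 + (7/8 - 3/4) * real (Suc i) / real n))))
          = (\<Prod>i<n. sgn (herm (s (grid n (n - i) n)) (s (grid n (n - Suc i) n))))"
        by (intro prod.cong refl edge sides) auto
      also have "\<dots> = (\<Prod>i<n. inverse (H n (n - Suc i) n))"
        unfolding H_def sgn_herm_commute[symmetric] by (intro prod.cong refl) (auto simp: Suc_diff_Suc)
      also have "\<dots> = (\<Prod>i<n. inverse (H n i n))" by (rule prod.nat_diff_reindex)
      finally have 3: "(\<Prod>i<n. sgn (herm (B (3/4 + (7/8 - 3/4) * real i / real n)) (B (3/4 + (7/8 - 3/4) * real (Suc i) / real n))))
          = inverse (\<Prod>i<n. H n i n)" unfolding inv .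
      have "(\<Prod>i<n. sgn (herm (B (7/8 + (1 - 7/8) * real i / real n)) (B (7/8 + (1 - 7/8) * real (Suc i) / real n))))
          = (\<Prod>i<n. sgn (herm (s (grid n 0 (n - i))) (s (grid n 0 (n - Suc i)))))"
        by (intro prod.cong refl edge sides) auto
      also have "\<dots> = (\<Prod>i<n. inverse (V n 0 (n - Suc i)))"
        unfolding V_def sgn_herm_commute[symmetric] by (intro prod.cong refl) (auto simp: Suc_diff_Suc)
      also have "\<dots> = (\<Prod>i<n. inverse (V n 0 i))" by (rule prod.nat_diff_reindex)
      finally have 4: "(\<Prod>i<n. sgn (herm (B (7/8 + (1 - 7/8) * real i / real n)) (B (7/8 + (1 - 7/8) * real (Suc i) / real n))))
          = inverse (\<Prod>j<n. V n 0 j)" unfolding inv .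
      show "(\<Prod>i<n. sgn (herm (B (0 + (1/2 - 0) * real i / real n)) (B (0 + (1/2 - 0) * real (Suc i) / real n))))
       * (\<Prod>i<n. sgn (herm (B (1/2 + (3/4 - 1/2) * real i / real n)) (B (1/2 + (3/4 - 1/2) * real (Suc i) / real n))))
       * (\<Prod>i<n. sgn (herm (B (3/4 + (7/8 - 3/4) * real i / real n)) (B (3/4 + (7/8 - 3/4) * real (Suc i) / real n))))
       * (\<Prod>i<n. sgn (herm (B (7/8 + (1 - 7/8) * real i / real n)) (B (7/8 + (1 - 7/8) * real (Suc i) / real n))))
       = (\<Prod>i<n. H n i 0) * (\<Prod>j<n. V n n j) / ((\<Prod>i<n. H n i n) * (\<Prod>j<n. V n 0 j))"
        unfolding 1 2 3 4 by (simp add: divide_inverse)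
    qed
  qed
  have knz: "sgn (k u) \<noteq> 0" if "u \<in> {0..1}" for u using k(2)[OF that] by (simp add: sgn_zero_iff)
  have "cis (2 * (- signed_area D)) = sgn (k 0) / sgn (k 1)"
    using LIMSEQ_unique[OF lim1 lim2] knz[of "1/2"] knz[of "3/4"] knz[of "7/8"] by simp
  moreover have "k 1 = l * k 0"
  proof -
    have "square_boundary 0 = (0, 0)" "square_boundary 1 = (0, 0)"
      by (simp_all add: square_boundary_eq)
    then have B: "B 1 = B 0" "B 0 \<noteq> 0" using s[of "(0, 0)"] by (auto simp: B_def mem_unit_square lifts_def)
    have "scaleC2 (k 1) (B 0) = scaleC2 (l * k 0) (B 0)"
      using l k(1)[of 0] k(1)[of 1] \<phi>(3,4) B(1) by (auto simp: scaleC2_def mult.assoc)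
    then have "k 1 * fst (B 0) = l * k 0 * fst (B 0)" "k 1 * snd (B 0) = l * k 0 * snd (B 0)"
      unfolding scaleC2_def by simp_all
    moreover have "fst (B 0) \<noteq> 0 \<or> snd (B 0) \<noteq> 0" using B(2) by (auto simp: prod_eq_iff)
    ultimately show ?thesis by (metis mult_right_cancel)
  qed
  ultimately have "cis (- (2 * signed_area D)) = inverse (sgn l)"
    using knz[of 0] by (simp add: sgn_mult divide_inverse)
  then have "inverse (cis (2 * signed_area D)) = inverse (sgn l)" by (simp only: cis_inverse)
  then show ?thesis by (metis inverse_inverse_eq)
qed

section \<open>Lifting geodesics and smooth curves\<close>

lemma horizontal_lift_reverse:
  assumes "horizontal_lift c 0 1 \<zeta>"
  shows "horizontal_lift (\<lambda>u. c (1 - u)) 0 1 (\<lambda>u. \<zeta> (1 - u))"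
proof -
  obtain C where C: "C > 0"
    "\<And>s t. s \<in> {0..1} \<Longrightarrow> t \<in> {0..1} \<Longrightarrow> s \<le> t \<Longrightarrow> norm (\<zeta> t - \<zeta> s) \<le> C * (t - s)"
    "\<And>s t. s \<in> {0..1} \<Longrightarrow> t \<in> {0..1} \<Longrightarrow> s \<le> t \<Longrightarrow> \<bar>Im (herm (\<zeta> s) (\<zeta> t))\<bar> \<le> C * (t - s)\<^sup>2"
    using horizontal_liftE[OF assms] by metis
  have "norm (\<zeta> (1 - t) - \<zeta> (1 - s)) \<le> C * (t - s) \<and> \<bar>Im (herm (\<zeta> (1 - s)) (\<zeta> (1 - t)))\<bar> \<le> C * (t - s)\<^sup>2"
    if "s \<in> {0..1}" "t \<in> {0..1}" "s \<le> t" for s t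
    using C(2)[of "1 - t" "1 - s"] C(3)[of "1 - t" "1 - s"] that
    by (simp add: norm_minus_commute herm_commute[of "\<zeta> (1 - t)"])
  moreover have "lifts (\<zeta> (1 - t)) (c (1 - t))" if "t \<in> {0..1}" for t
    by (rule horizontal_lift_lifts[OF assms]) (use that in auto)
  ultimately show ?thesis unfolding horizontal_lift_def by blast
qed

text \<open>The Hermitian product of two points of the lift is the real number \<open>cos (\<phi> (t - s) / 2)\<close>; the
  angle is halved because the sphere has radius \<open>1/2\<close>.\<close>

lemma horizontal_lift_great_circle:
  assumes p: "norm p = 1" "norm p' = 1" "herm p p' = 0"
    and g: "\<And>u. u \<in> {0..1} \<Longrightarrow> hopf (cos (\<phi> * u / 2) *\<^sub>R p + sin (\<phi> * u / 2) *\<^sub>R p') = g u"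
  shows "horizontal_lift g 0 1 (\<lambda>u. cos (\<phi> * u / 2) *\<^sub>R p + sin (\<phi> * u / 2) *\<^sub>R p')"
proof -
  define \<zeta> where "\<zeta> = (\<lambda>u. cos (\<phi> * u / 2) *\<^sub>R p + sin (\<phi> * u / 2) *\<^sub>R p')"
  have scale: "herm (a *\<^sub>R x) y = a * herm x y" "herm x (a *\<^sub>R y) = a * herm x y" for a x y
    by (simp_all add: herm_def scaleR_conv_of_real algebra_simps)
  have p'p: "herm p' p = 0" using p(3) herm_commute[of p' p] by simp
  have h: "herm (\<zeta> s) (\<zeta> t) = cos (\<phi> * (t - s) / 2)" for s t
  proof -
    have "herm (\<zeta> s) (\<zeta> t) = cos (\<phi> * s / 2) * cos (\<phi> * t / 2) + sin (\<phi> * s / 2) * sin (\<phi> * t / 2)"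
      by (simp add: \<zeta>_def herm_simps scale p(3) p'p herm_self p(1,2))
    also have "\<dots> = cos (\<phi> * t / 2 - \<phi> * s / 2)" by (simp add: cos_diff mult.commute)
    also have "\<phi> * t / 2 - \<phi> * s / 2 = \<phi> * (t - s) / 2" by (simp add: field_simps)
    finally show ?thesis .
  qed
  have unit: "norm (\<zeta> t) = 1" for t
  proof -
    have "complex_of_real ((norm (\<zeta> t))\<^sup>2) = complex_of_real 1" using h[of t t] by (simp add: herm_self)
    then have "(norm (\<zeta> t))\<^sup>2 = 1" by (simp only: of_real_eq_iff)
    then show ?thesis by (metis norm_ge_zero one_power2 power2_eq_iff_nonneg zero_le_one)
  qed
  have lip: "norm (\<zeta> t - \<zeta> s) \<le> \<bar>\<phi>\<bar> * \<bar>t - s\<bar>" for s t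
  proof (rule power2_le_imp_le)
    define x where "x = \<phi> * (t - s) / 4"
    have "(norm (\<zeta> t - \<zeta> s))\<^sup>2 = 2 - 2 * cos (2 * x)"
      using unit[of s] unit[of t] h[of s t] Re_herm[of "\<zeta> s" "\<zeta> t"]
      by (simp add: power2_norm_eq_inner inner_diff_left inner_diff_right inner_commute norm_eq_1 x_def)
    also have "\<dots> = 4 * (sin x)\<^sup>2" by (simp add: cos_double_sin)
    also have "\<dots> \<le> 4 * x\<^sup>2"
      using abs_sin_x_le_abs_x[of x] by (simp add: abs_le_square_iff)
    also have "\<dots> \<le> (\<bar>\<phi>\<bar> * \<bar>t - s\<bar>)\<^sup>2"
      by (simp add: x_def power_mult_distrib power_divide)
    finally show "(norm (\<zeta> t - \<zeta> s))\<^sup>2 \<le> (\<bar>\<phi>\<bar> * \<bar>t - s\<bar>)\<^sup>2" .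
  qed simp
  have "lifts (\<zeta> t) (g t)" if "t \<in> {0..1}" for t
  proof -
    have "hopf (\<zeta> t) = g t" using g[OF that] by (simp only: \<zeta>_def)
    then show ?thesis using unit[of t] by (auto simp: lifts_def)
  qed
  moreover have "norm (\<zeta> t - \<zeta> s) \<le> \<bar>\<phi>\<bar> * (t - s) \<and> \<bar>Im (herm (\<zeta> s) (\<zeta> t))\<bar> \<le> \<bar>\<phi>\<bar> * (t - s)\<^sup>2" if "s \<le> t" for s t
    using lip[of t s] that by (simp add: h)
  ultimately show ?thesis unfolding horizontal_lift_def \<zeta>_def[symmetric] by blast
qed

lemma geodesic_arc_start: "geodesic_arc a b g \<Longrightarrow> g 0 = a"
  by (auto simp: geodesic_arc_def)

lemma geodesic_arc_reverse:
  assumes "geodesic_arc a b g"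
  shows "geodesic_arc b a (\<lambda>u. g (1 - u))"
proof -
  from assms obtain e \<phi> where a: "a \<in> shape_sphere" "g 1 = b" and e: "e \<in> shape_sphere" "a \<bullet> e = 0"
    and \<phi>: "0 \<le> \<phi>" "\<phi> \<le> pi" and g: "\<And>u. u \<in> {0..1} \<Longrightarrow> g u = cos (\<phi> * u) *\<^sub>R a + sin (\<phi> * u) *\<^sub>R e"
    unfolding geodesic_arc_def by blast
  define e' where "e' = sin \<phi> *\<^sub>R a - cos \<phi> *\<^sub>R e"
  have b: "b = cos \<phi> *\<^sub>R a + sin \<phi> *\<^sub>R e" using g[of 1] a(2) by simp
  have ae: "a \<bullet> a = 1/4" "e \<bullet> e = 1/4" "e \<bullet> a = 0"
    using a(1) e by (simp_all add: mem_shape_sphere inner_commute)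
  have sc: "(sin \<phi>)\<^sup>2 + (cos \<phi>)\<^sup>2 = 1" by simp
  have "b \<bullet> b = ((sin \<phi>)\<^sup>2 + (cos \<phi>)\<^sup>2) / 4" "e' \<bullet> e' = ((sin \<phi>)\<^sup>2 + (cos \<phi>)\<^sup>2) / 4" "b \<bullet> e' = 0"
    unfolding b e'_def
    by (simp_all add: inner_add_left inner_add_right inner_diff_left inner_diff_right ae e(2) power2_eq_square
        del: sin_cos_squared_add sin_cos_squared_add2 sin_cos_squared_add3)
  then have *: "b \<in> shape_sphere" "e' \<in> shape_sphere" "b \<bullet> e' = 0" by (simp_all add: mem_shape_sphere)
  have "g (1 - u) = cos (\<phi> * u) *\<^sub>R b + sin (\<phi> * u) *\<^sub>R e'" if "u \<in> {0..1}" for u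
  proof -
    have "g (1 - u) = cos (\<phi> - \<phi> * u) *\<^sub>R a + sin (\<phi> - \<phi> * u) *\<^sub>R e"
      using g[of "1 - u"] that by (simp add: right_diff_distrib)
    then show ?thesis
      unfolding b e'_def cos_diff sin_diff by (simp add: algebra_simps)
  qed
  moreover have "g (1 - 1) = a" using geodesic_arc_start[OF assms] by simp
  ultimately show ?thesis
    unfolding geodesic_arc_def using * \<phi> by blast
qed

text \<open>The two base points with the unit vectors above them; \<open>herm p\<close> picks out the second
  coordinate over \<open>C1_pt\<close> and the first one over \<open>O1_pt\<close>.\<close>

definition pole_lift :: "real ^ 3 \<Rightarrow> complex \<times> complex \<Rightarrow> bool" where
  "pole_lift a p \<longleftrightarrow> a = C1_pt \<and> p = (0, 1) \<or> a = O1_pt \<and> p = (1, 0)"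

text \<open>The direction \<open>e\<close> of the geodesic is orthogonal to the base point, so it lies in the plane of the
  last two coordinates; \<open>p'\<close> is the unit vector orthogonal to \<open>p\<close> whose phase is that of \<open>2 e\<close> in
  this plane, up to conjugation. The value of
  \<open>herm p (\<zeta> 1)\<close> is nonnegative real because the arc is minimizing.\<close>

lemma geodesic_from_pole_lift:
  assumes "pole_lift a p" "geodesic_arc a b g"
  obtains \<zeta> \<phi> where "horizontal_lift g 0 1 \<zeta>" "\<zeta> 0 = p" "0 \<le> \<phi>" "\<phi> \<le> pi" "herm p (\<zeta> 1) = cos (\<phi> / 2)"
proof -
  from assms(2) obtain e \<phi> where e: "e \<in> shape_sphere" "a \<bullet> e = 0"
    and \<phi>: "0 \<le> \<phi>" "\<phi> \<le> pi" and g: "\<And>u. u \<in> {0..1} \<Longrightarrow> g u = cos (\<phi> * u) *\<^sub>R a + sin (\<phi> * u) *\<^sub>R e"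
    unfolding geodesic_arc_def by blast
  have e1: "e $ 1 = 0"
    using assms(1) e(2) by (auto simp: pole_lift_def C1_pt_def O1_pt_def inner_vec_def sum_3)
  have e23: "(2 * e $ 2)\<^sup>2 + (2 * e $ 3)\<^sup>2 = 1"
    using e(1) e1 by (simp add: mem_shape_sphere inner_vec_def sum_3 power2_eq_square)
  define p' where "p' = (if a = C1_pt then (Complex (2 * e $ 2) (- (2 * e $ 3)), 0) else (0, Complex (2 * e $ 2) (2 * e $ 3)))"
  have ne: "O1_pt \<noteq> C1_pt" by (simp add: C1_pt_def O1_pt_def vec_eq_iff forall_3)
  have cm: "cmod (Complex (2 * e $ 2) (2 * e $ 3)) = 1" "cmod (Complex (2 * e $ 2) (- (2 * e $ 3))) = 1"
    using e23 by (simp_all add: complex_norm)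
  have p: "norm p = 1" "norm p' = 1" "herm p p' = 0"
    using assms(1) ne cm by (auto simp: pole_lift_def p'_def norm_Pair herm_def)
  have "hopf (cos (\<phi> * u / 2) *\<^sub>R p + sin (\<phi> * u / 2) *\<^sub>R p') = g u" if "u \<in> {0..1}" for u
  proof -
    define x where "x = \<phi> * u / 2"
    have x: "\<phi> * u = 2 * x" by (simp add: x_def)
    from assms(1) consider "a = C1_pt" "p = (0, 1)" | "a = O1_pt" "p = (1, 0)"
      by (auto simp: pole_lift_def)
    then show ?thesis
    proof cases
      case 1
      show ?thesis
        unfolding g[OF that] x_def[symmetric] unfolding x cos_double sin_double 1 p'_def
        by (simp add: hopf_def vec_eq_iff forall_3 C1_pt_def e1 cm power_mult_distrib field_simps)
    next
      case 2
      show ?thesis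
        unfolding g[OF that] x_def[symmetric] unfolding x cos_double sin_double 2 p'_def if_not_P[OF ne]
        by (simp add: hopf_def vec_eq_iff forall_3 O1_pt_def e1 cm power_mult_distrib field_simps)
          (use sin_cos_squared_add2[of x] in linarith)
    qed
  qed
  then have lift: "horizontal_lift g 0 1 (\<lambda>u. cos (\<phi> * u / 2) *\<^sub>R p + sin (\<phi> * u / 2) *\<^sub>R p')"
    by (rule horizontal_lift_great_circle[OF p])
  show thesis
  proof (rule that[OF lift _ \<phi>])
    show "cos (\<phi> * 0 / 2) *\<^sub>R p + sin (\<phi> * 0 / 2) *\<^sub>R p' = p" by simp
    have "herm p (cos (\<phi> / 2) *\<^sub>R p + sin (\<phi> / 2) *\<^sub>R p') = cos (\<phi> / 2) * herm p p + sin (\<phi> / 2) * herm p p'"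
      by (simp add: herm_def scaleR_conv_of_real algebra_simps)
    then show "herm p (cos (\<phi> * 1 / 2) *\<^sub>R p + sin (\<phi> * 1 / 2) *\<^sub>R p') = cos (\<phi> / 2)"
      by (simp add: p herm_self)
  qed
qed

text \<open>With \<open>s\<close> fixed, the derivative of \<open>Im \<langle>\<zeta> s, \<zeta> r\<rangle>\<close> in \<open>r\<close> is \<open>- Im \<langle>\<zeta> r - \<zeta> s, \<zeta>' r\<rangle>\<close>, which is of first order
  in \<open>r - s\<close>; integrating it gives the second order bound.\<close>

lemma horizontal_lift_of_C1:
  assumes "u \<le> v" and lift: "\<And>t. t \<in> {u..v} \<Longrightarrow> lifts (\<zeta> t) (c t)"
    and d: "\<And>t. t \<in> {u..v} \<Longrightarrow> (\<zeta> has_vector_derivative \<zeta>' t) (at t within {u..v})"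
    and cont: "continuous_on {u..v} \<zeta>'"
    and hor: "\<And>t. t \<in> {u..v} \<Longrightarrow> Im (herm (\<zeta> t) (\<zeta>' t)) = 0"
  shows "horizontal_lift c u v \<zeta>"
proof -
  have "bounded (\<zeta>' ` {u..v})"
    by (intro compact_imp_bounded compact_continuous_image cont) simp
  then obtain L where L: "L > 0" "\<And>t. t \<in> {u..v} \<Longrightarrow> norm (\<zeta>' t) \<le> L"
    unfolding bounded_pos by blast
  have lip: "norm (\<zeta> t - \<zeta> s) \<le> L * (t - s)" if st: "s \<in> {u..v}" "t \<in> {u..v}" "s \<le> t" for s t
  proof -
    have sub: "{s..t} \<subseteq> {u..v}" using st by auto
    have "(\<zeta>' has_integral (\<zeta> t - \<zeta> s)) {s..t}"
      by (intro fundamental_theorem_of_calculus[OF st(3)] has_vector_derivative_within_subset[OF d sub])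
         (use sub in blast)
    then have "norm (\<zeta> t - \<zeta> s) \<le> L * measure lborel {s..t}"
      by (rule has_integral_bound_real[rotated 2, where S = "{}"]) (use L sub in auto)
    then show ?thesis using st by simp
  qed
  have im: "\<bar>Im (herm (\<zeta> s) (\<zeta> t))\<bar> \<le> 2 * L\<^sup>2 * (t - s)\<^sup>2" if st: "s \<in> {u..v}" "t \<in> {u..v}" "s \<le> t" for s t
  proof -
    have sub: "{s..t} \<subseteq> {u..v}" using st by auto
    have lin: "bounded_linear (\<lambda>x. Im (herm a x))" for a
    proof (rule bounded_linear_intro)
      show "norm (Im (herm a x)) \<le> norm x * (2 * norm a)" for x
        using order_trans[OF abs_Im_le_cmod norm_herm_le[of a x]] by (simp add: mult_ac)
    qed (simp_all add: herm_def scaleR_conv_of_real algebra_simps)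
    have "((\<lambda>r. Im (herm (\<zeta> s) (\<zeta>' r))) has_integral (Im (herm (\<zeta> s) (\<zeta> t)) - Im (herm (\<zeta> s) (\<zeta> s)))) {s..t}"
      by (intro fundamental_theorem_of_calculus[OF st(3)] bounded_linear.has_vector_derivative[OF lin]
          has_vector_derivative_within_subset[OF d sub]) (use sub in blast)
    then have int: "((\<lambda>r. Im (herm (\<zeta> s) (\<zeta>' r))) has_integral Im (herm (\<zeta> s) (\<zeta> t))) {s..t}"
      by (simp add: herm_self)
    have "norm (Im (herm (\<zeta> s) (\<zeta>' r))) \<le> 2 * L\<^sup>2 * (t - s)" if r: "r \<in> {s..t}" for r
    proof -
      have "Im (herm (\<zeta> s) (\<zeta>' r)) = - Im (herm (\<zeta> r - \<zeta> s) (\<zeta>' r))"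
        using hor[of r] r sub by (auto simp: herm_simps)
      then have "norm (Im (herm (\<zeta> s) (\<zeta>' r))) \<le> 2 * norm (\<zeta> r - \<zeta> s) * norm (\<zeta>' r)"
        using order_trans[OF abs_Im_le_cmod norm_herm_le[of "\<zeta> r - \<zeta> s" "\<zeta>' r"]] by simp
      also have "\<dots> \<le> 2 * (L * (t - s)) * L"
      proof (intro mult_mono)
        have "norm (\<zeta> r - \<zeta> s) \<le> L * (r - s)" using st r by (intro lip) auto
        also have "\<dots> \<le> L * (t - s)" using r L by simp
        finally show "norm (\<zeta> r - \<zeta> s) \<le> L * (t - s)" .
        show "norm (\<zeta>' r) \<le> L" using L r sub by blast
      qed (use L r in auto)
      finally show ?thesis by (simp add: power2_eq_square mult_ac)
    qed
    then have "norm (Im (herm (\<zeta> s) (\<zeta> t))) \<le> 2 * L\<^sup>2 * (t - s) * measure lborel {s..t}"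
      using st L by (intro has_integral_bound_real[OF _ finite.emptyI int]) auto
    then show ?thesis using st by (simp add: power2_eq_square mult_ac)
  qed
  define C where "C = max L (2 * L\<^sup>2)"
  have "norm (\<zeta> t - \<zeta> s) \<le> C * (t - s) \<and> \<bar>Im (herm (\<zeta> s) (\<zeta> t))\<bar> \<le> C * (t - s)\<^sup>2"
    if st: "s \<in> {u..v}" "t \<in> {u..v}" "s \<le> t" for s t
  proof -
    have "L * (t - s) \<le> C * (t - s)" "2 * L\<^sup>2 * (t - s)\<^sup>2 \<le> C * (t - s)\<^sup>2"
      using st by (auto intro!: mult_right_mono simp: C_def)
    then show ?thesis using lip[OF st] im[OF st] by linarith
  qed
  then show ?thesis unfolding horizontal_lift_def using lift by blast
qed

text \<open>Induction on the number of break points strictly between the ends.\<close>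

lemma piecewise_smooth_curve_induct:
  assumes f: "piecewise_smooth_curve a b f" and "a < b"
    and piece: "\<And>u v f'. a \<le> u \<Longrightarrow> u < v \<Longrightarrow> v \<le> b \<Longrightarrow> continuous_on {u..v} f' \<Longrightarrow>
        (\<And>t. t \<in> {u..v} \<Longrightarrow> (f has_vector_derivative f' t) (at t within {u..v})) \<Longrightarrow> Q u v"
    and join: "\<And>u v w. a \<le> u \<Longrightarrow> u < v \<Longrightarrow> v < w \<Longrightarrow> w \<le> b \<Longrightarrow> Q u v \<Longrightarrow> Q v w \<Longrightarrow> Q u w"
  shows "Q a b"
proof -
  from f obtain B where B: "finite B" "{a, b} \<subseteq> B" "B \<subseteq> {a..b}"
    and pieces: "\<forall>u\<in>B. \<forall>v\<in>B. u < v \<and> {u<..<v} \<inter> B = {} \<longrightarrow> (\<exists>f'. continuous_on {u..v} f' \<and>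
              (\<forall>t\<in>{u..v}. (f has_vector_derivative f' t) (at t within {u..v})))"
    unfolding piecewise_smooth_curve_def by (elim conjE exE)
  then have ab: "a \<in> B" "b \<in> B" by simp_all
  have pc: "\<And>u v. u \<in> B \<Longrightarrow> v \<in> B \<Longrightarrow> u < v \<Longrightarrow> {u<..<v} \<inter> B = {} \<Longrightarrow> \<exists>f'. continuous_on {u..v} f' \<and>
              (\<forall>t\<in>{u..v}. (f has_vector_derivative f' t) (at t within {u..v}))"
    using pieces by simp
  have "Q u v" if "u \<in> B" "v \<in> B" "u < v" for u v
    using that
  proof (induction "card ({u<..<v} \<inter> B)" arbitrary: u v rule: less_induct)
    case less
    have uv: "a \<le> u" "v \<le> b" using less.prems(1,2) B(3) by auto
    show ?case
    proof (cases "{u<..<v} \<inter> B = {}")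
      case True
      with pc[OF less.prems] obtain f' where "continuous_on {u..v} f'"
        "\<And>t. t \<in> {u..v} \<Longrightarrow> (f has_vector_derivative f' t) (at t within {u..v})" by blast
      then show ?thesis by (rule piece[OF uv(1) less.prems(3) uv(2)])
    next
      case False
      then obtain w where w: "u < w" "w < v" "w \<in> B" by auto
      have "{u<..<w} \<inter> B \<subset> {u<..<v} \<inter> B" "{w<..<v} \<inter> B \<subset> {u<..<v} \<inter> B" using w by auto
      then have "card ({u<..<w} \<inter> B) < card ({u<..<v} \<inter> B)" "card ({w<..<v} \<inter> B) < card ({u<..<v} \<inter> B)"
        using B(1) by (intro psubset_card_mono; simp)+
      then have "Q u w" "Q w v"
        using less.hyps[OF _ less.prems(1) w(3,1)] less.hyps[OF _ w(3) less.prems(2) w(2)] by blast+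
      then show ?thesis by (rule join[OF uv(1) w(1,2) uv(2)])
    qed
  qed
  then show ?thesis using ab \<open>a < b\<close> by blast
qed

section \<open>Jacobi coordinates and the lift of a motion\<close>

definition jacobi :: "real ^ 3 \<Rightarrow> complex ^ 3 \<Rightarrow> complex \<times> complex" where
  "jacobi m q = (jacobi1 m q, jacobi2 m q)"

lemma hopf_jacobi: "hopf (jacobi m q) = shape_proj m q"
  by (simp add: hopf_def jacobi_def shape_proj_def Let_def)

lemma bounded_linear_jacobi: "bounded_linear (jacobi m)"
  unfolding linear_conv_bounded_linear[symmetric]
  by (rule linearI) (simp_all add: jacobi_def jacobi1_def jacobi2_def algebra_simps add_divide_distrib)

text \<open>Jacobi coordinates diagonalize the mass form after splitting off the centre of mass. The mixed term of the
  centres of mass vanishes as soon as that of \<open>q\<close> does, so a velocity can be put for \<open>p\<close>.\<close>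

lemma herm_jacobi:
  assumes m: "\<And>i. m $ i > 0" and q: "q \<in> config_space m"
  shows "herm (jacobi m q) (jacobi m p) = (\<Sum>i\<in>UNIV. m $ i * (cnj (q $ i) * p $ i))"
proof -
  define s where "s = m $ 2 + m $ 3"
  have pos: "m $ 1 > 0" "m $ 2 > 0" "m $ 3 > 0" "s > 0" using m by (auto simp: s_def add_pos_pos)
  define a where "a = complex_of_real (m $ 1)"
  define b where "b = complex_of_real (m $ 2)"
  define c where "c = complex_of_real (m $ 3)"
  define x where "x = (\<lambda>i. cnj (q $ i))"
  have nz: "a \<noteq> 0" "b + c \<noteq> 0" "a + (b + c) \<noteq> 0"
    using pos unfolding a_def b_def c_def by (auto simp flip: of_real_add simp: s_def)
  have mu1: "complex_of_real ((mu1 m)\<^sup>2) = b * c / (b + c)"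
  proof -
    have "(mu1 m)\<^sup>2 = m $ 2 * m $ 3 / s"
      using pos by (simp add: mu1_def power_divide s_def field_simps)
    then show ?thesis by (simp add: b_def c_def s_def)
  qed
  have mu2: "complex_of_real ((mu2 m)\<^sup>2) = a * (b + c) / (a + (b + c))"
  proof -
    have "(mu2 m)\<^sup>2 = m $ 1 * s / (m $ 1 + s)"
      using pos by (simp add: mu2_def power_divide s_def[symmetric] field_simps)
    then show ?thesis by (simp add: a_def b_def c_def s_def)
  qed
  have "cnj (\<Sum>i\<in>UNIV. m $ i *\<^sub>R q $ i) = 0" using q by (simp add: config_space_def)
  then have x: "b * x 2 + c * x 3 = - (a * x 1)"
    by (simp add: sum_3 a_def b_def c_def x_def scaleR_conv_of_real eq_neg_iff_add_eq_0 add_ac)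
  have collect: "P / r * A + (X + Y * (Z / r)) = X + (P * A + Y * Z) / r" for P r A X Y Z :: complex
    by (simp add: add_divide_distrib)
  have "herm (jacobi m q) (jacobi m p)
      = (complex_of_real ((mu1 m)\<^sup>2)) * ((x 3 - x 2) * (p $ 3 - p $ 2))
      + (complex_of_real ((mu2 m)\<^sup>2)) * ((x 1 - (b * x 2 + c * x 3) / (b + c)) * (p $ 1 - (b * p $ 2 + c * p $ 3) / (b + c)))"
    by (simp add: herm_def jacobi_def jacobi1_def jacobi2_def x_def b_def c_def scaleR_conv_of_real power2_eq_square divide_inverse mult_ac)
  also have "x 1 - (b * x 2 + c * x 3) / (b + c) = (a + (b + c)) / (b + c) * x 1"
    unfolding x using nz by (simp add: field_simps)
  also have "complex_of_real ((mu2 m)\<^sup>2) * ((a + (b + c)) / (b + c) * x 1 * (p $ 1 - (b * p $ 2 + c * p $ 3) / (b + c)))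
      = a * x 1 * p $ 1 - a * x 1 * ((b * p $ 2 + c * p $ 3) / (b + c))"
  proof -
    have "a * (b + c) / (a + (b + c)) * ((a + (b + c)) / (b + c)) = a" using nz by simp
    then show ?thesis unfolding mu2 by (metis (no_types, lifting) mult.assoc right_diff_distrib)
  qed
  also have "- (a * x 1) * ((b * p $ 2 + c * p $ 3) / (b + c)) = (b * x 2 + c * x 3) * ((b * p $ 2 + c * p $ 3) / (b + c))"
    unfolding x ..
  then have "a * x 1 * p $ 1 - a * x 1 * ((b * p $ 2 + c * p $ 3) / (b + c))
      = a * x 1 * p $ 1 + (b * x 2 + c * x 3) * ((b * p $ 2 + c * p $ 3) / (b + c))" by simp
  also have "complex_of_real ((mu1 m)\<^sup>2) * ((x 3 - x 2) * (p $ 3 - p $ 2)) + \<dots>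
     = a * x 1 * p $ 1 + (b * c * ((x 3 - x 2) * (p $ 3 - p $ 2)) + (b * x 2 + c * x 3) * (b * p $ 2 + c * p $ 3)) / (b + c)"
    unfolding mu1 by (rule collect)
  also have "b * c * ((x 3 - x 2) * (p $ 3 - p $ 2)) + (b * x 2 + c * x 3) * (b * p $ 2 + c * p $ 3)
     = (b + c) * (b * x 2 * p $ 2 + c * x 3 * p $ 3)"
    by (simp add: algebra_simps)
  finally show ?thesis
    using nz by (simp add: sum_3 a_def b_def c_def x_def add_ac mult_ac)
qed

lemma inertia_eq_norm_jacobi:
  assumes "\<And>i. m $ i > 0" "q \<in> config_space m"
  shows "inertia m q = (norm (jacobi m q))\<^sup>2"
proof -
  have "complex_of_real ((norm (jacobi m q))\<^sup>2) = complex_of_real (inertia m q)"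
    unfolding herm_self[symmetric] herm_jacobi[OF assms] inertia_def
    by (simp add: complex_norm_square mult.commute del: of_real_power)
  then show ?thesis by (simp only: of_real_eq_iff)
qed

lemma angular_momentum_eq_herm_jacobi:
  assumes "\<And>i. m $ i > 0" "q t \<in> config_space m"
  shows "angular_momentum m q t = Im (herm (jacobi m (q t)) (jacobi m (vector_derivative q (at t))))"
  unfolding herm_jacobi[OF assms] angular_momentum_def by (simp add: Im_sum)

lemma jacobi_nonzero:
  assumes m: "\<And>i. m $ i > 0" and q: "q \<in> config_space m - {0}"
  shows "jacobi m q \<noteq> 0"
proof
  assume "jacobi m q = 0"
  then have "inertia m q = 0" using inertia_eq_norm_jacobi[OF m] q by simp
  then have "\<forall>i\<in>UNIV. m $ i * (cmod (q $ i))\<^sup>2 = 0"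
    unfolding inertia_def using m by (subst (asm) sum_nonneg_eq_0_iff) (auto simp: less_imp_le)
  then have "q = 0" using m by (auto simp: vec_eq_iff) (metis less_irrefl)
  then show False using q by simp
qed

lemma jacobi_lifts_shape:
  assumes m: "\<And>i. m $ i > 0" and q: "q t \<in> config_space m - {0}"
  shows "lifts (jacobi m (q t)) (shape_curve m q t)"
  using jacobi_nonzero[OF m q] inertia_eq_norm_jacobi[OF m, of "q t"] q
  by (simp add: lifts_def hopf_jacobi shape_curve_def)

text \<open>At the break points \<open>vector_derivative q (at t)\<close> may be an arbitrary value, but these are
  finitely many; inside a piece the integrand is the continuous function \<open>k\<close>.\<close>

lemma rotation_speed_on_piece:
  assumes m: "\<And>i. m $ i > 0" and q: "\<And>t. t \<in> {u..v} \<Longrightarrow> q t \<in> config_space m - {0}"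
    and f': "continuous_on {u..v} f'" "\<And>t. t \<in> {u..v} \<Longrightarrow> (q has_vector_derivative f' t) (at t within {u..v})"
  defines "k \<equiv> \<lambda>t. Im (herm (jacobi m (q t)) (jacobi m (f' t))) / (norm (jacobi m (q t)))\<^sup>2"
  shows "continuous_on {u..v} k"
    and "\<And>w. w \<in> {u..v} \<Longrightarrow> ((\<lambda>t. angular_momentum m q t / inertia m (q t)) has_integral integral {u..w} k) {u..w}"
proof -
  have "continuous_on {u..v} q"
    using f'(2) by (meson continuous_on_eq_continuous_within has_vector_derivative_continuous)
  then have c: "continuous_on {u..v} (\<lambda>t. jacobi m (q t))" "continuous_on {u..v} (\<lambda>t. jacobi m (f' t))"
    using f'(1) by (auto intro: bounded_linear.continuous_on[OF bounded_linear_jacobi])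
  have "jacobi m (q t) \<noteq> 0" if "t \<in> {u..v}" for t by (rule jacobi_nonzero[OF m q[OF that]])
  then show k: "continuous_on {u..v} k"
    unfolding k_def herm_def by (intro continuous_intros c) auto
  fix w assume w: "w \<in> {u..v}"
  have "(k has_integral integral {u..w} k) {u..w}"
    using w by (intro integrable_integral integrable_continuous_real continuous_on_subset[OF k]) auto
  then show "((\<lambda>t. angular_momentum m q t / inertia m (q t)) has_integral integral {u..w} k) {u..w}"
  proof (rule has_integral_spike_finite[where S = "{u, v}", rotated 2])
    fix t assume t: "t \<in> {u..w} - {u, v}"
    then have t': "t \<in> {u<..<v}" "t \<in> {u..v}" using w by auto
    have "(q has_vector_derivative f' t) (at t)"
      using f'(2)[OF t'(2)] at_within_Icc_at[of u t v] t'(1) by simp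
    then have "vector_derivative q (at t) = f' t" by (rule vector_derivative_at)
    then show "angular_momentum m q t / inertia m (q t) = k t"
      using q[OF t'(2)] by (simp add: k_def inertia_eq_norm_jacobi[OF m] angular_momentum_eq_herm_jacobi[OF m])
  qed simp
qed

text \<open>Differentiating, \<open>Im \<langle>\<zeta>, \<zeta>'\<rangle> = Im \<langle>z, z'\<rangle> - \<kappa> (norm z)\<^sup>2 = J - \<kappa> I\<close>, and this vanishes for \<open>\<kappa> = J / I\<close>.\<close>

lemma motion_horizontal_lift:
  fixes q :: "real \<Rightarrow> complex ^ 3"
  assumes m: "\<And>i. m $ i > 0" and "T > 0" and smooth: "piecewise_smooth_curve 0 T q"
    and q: "\<And>t. t \<in> {0..T} \<Longrightarrow> q t \<in> config_space m - {0}"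
  defines "\<kappa> \<equiv> \<lambda>t. angular_momentum m q t / inertia m (q t)"
  shows "horizontal_lift (shape_curve m q) 0 T (\<lambda>t. scaleC2 (cis (- integral {0..t} \<kappa>)) (jacobi m (q t)))"
proof -
  have int: "\<kappa> integrable_on {0..T}"
  proof (rule piecewise_smooth_curve_induct[OF smooth \<open>T > 0\<close>, where Q = "\<lambda>u v. \<kappa> integrable_on {u..v}"])
    fix u v f' assume uv: "0 \<le> u" "u < v" "v \<le> T" and f': "continuous_on {u..v} f'"
      "\<And>t. t \<in> {u..v} \<Longrightarrow> (q has_vector_derivative f' t) (at t within {u..v})"
    have quv: "q t \<in> config_space m - {0}" if "t \<in> {u..v}" for t
      by (rule q) (use uv that in simp)
    show "\<kappa> integrable_on {u..v}"
      unfolding \<kappa>_def by (rule has_integral_integrable[OF rotation_speed_on_piece(2)[OF m quv f']]) (use uv in simp_all)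
  next
    fix u v w assume "u < v" "v < w" and int: "\<kappa> integrable_on {u..v}" "\<kappa> integrable_on {v..w}"
    then show "\<kappa> integrable_on {u..w}"
      by (intro Henstock_Kurzweil_Integration.integrable_combine[OF _ _ int]) simp_all
  qed
  define \<Theta> where "\<Theta> = (\<lambda>t. integral {0..t} \<kappa>)"
  have "horizontal_lift (shape_curve m q) 0 T (\<lambda>t. scaleC2 (cis (- \<Theta> t)) (jacobi m (q t)))"
  proof (rule piecewise_smooth_curve_induct[OF smooth \<open>T > 0\<close>,
        where Q = "\<lambda>u v. horizontal_lift (shape_curve m q) u v (\<lambda>t. scaleC2 (cis (- \<Theta> t)) (jacobi m (q t)))"])
    fix u v f' assume uv: "0 \<le> u" "u < v" "v \<le> T" and f': "continuous_on {u..v} f'"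
      "\<And>t. t \<in> {u..v} \<Longrightarrow> (q has_vector_derivative f' t) (at t within {u..v})"
    have quv: "q t \<in> config_space m - {0}" if "t \<in> {u..v}" for t
      by (rule q) (use uv that in simp)
    define z where "z = (\<lambda>t. jacobi m (q t))"
    define w where "w = (\<lambda>t. jacobi m (f' t))"
    define k where "k = (\<lambda>t. Im (herm (z t) (w t)) / (norm (z t))\<^sup>2)"
    have k: "continuous_on {u..v} k" "\<And>t. t \<in> {u..v} \<Longrightarrow> (\<kappa> has_integral integral {u..t} k) {u..t}"
      unfolding k_def z_def w_def \<kappa>_def by (rule rotation_speed_on_piece[OF m quv f'], assumption+)+
    have z_nz: "z t \<noteq> 0" if "t \<in> {u..v}" for t
      unfolding z_def by (rule jacobi_nonzero[OF m quv[OF that]])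
    have \<Theta>_eq: "\<Theta> t = \<Theta> u + integral {u..t} k" if t: "t \<in> {u..v}" for t
    proof -
      have "\<kappa> integrable_on {0..t}"
        by (rule integrable_on_subinterval[OF int]) (use t uv in auto)
      then have "\<Theta> t = \<Theta> u + integral {u..t} \<kappa>"
        unfolding \<Theta>_def using t uv by (intro Henstock_Kurzweil_Integration.integral_combine[symmetric]) auto
      then show ?thesis unfolding integral_unique[OF k(2)[OF t]] .
    qed
    have d\<Theta>: "(\<Theta> has_vector_derivative k t) (at t within {u..v})" if t: "t \<in> {u..v}" for t
    proof -
      have "((\<lambda>t. \<Theta> u + integral {u..t} k) has_vector_derivative 0 + k t) (at t within {u..v})"
        by (intro has_vector_derivative_add has_vector_derivative_const integral_has_vector_derivative k t)
      then show ?thesis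
        unfolding add_0_left by (rule has_vector_derivative_transform[OF t, rotated]) (rule \<Theta>_eq)
    qed
    have dz: "(z has_vector_derivative w t) (at t within {u..v})" if "t \<in> {u..v}" for t
      unfolding z_def w_def by (rule bounded_linear.has_vector_derivative[OF bounded_linear_jacobi f'(2)[OF that]])
    define \<zeta>' where "\<zeta>' = (\<lambda>t. scaleC2 (cis (- \<Theta> t)) (w t - scaleC2 (\<i> * k t) (z t)))"
    have "horizontal_lift (shape_curve m q) u v (\<lambda>t. scaleC2 (cis (- \<Theta> t)) (z t))"
    proof (rule horizontal_lift_of_C1[where \<zeta>' = \<zeta>'])
      show "u \<le> v" using uv by simp
      fix t assume t: "t \<in> {u..v}"
      show "lifts (scaleC2 (cis (- \<Theta> t)) (z t)) (shape_curve m q t)"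
        unfolding z_def by (intro lifts_scaleC2 jacobi_lifts_shape m quv t) simp
      have dcis: "((\<lambda>t. cis (- \<Theta> t)) has_vector_derivative (- k t *\<^sub>R (\<i> * cis (- \<Theta> t)))) (at t within {u..v})"
      proof -
        have "((\<lambda>t. - \<Theta> t) has_derivative (\<lambda>h. h *\<^sub>R - k t)) (at t within {u..v})"
          using has_vector_derivative_minus[OF d\<Theta>[OF t]] by (simp only: has_vector_derivative_def)
        from has_derivative_cis[OF this] show ?thesis
          by (simp add: has_vector_derivative_def)
      qed
      have "((\<lambda>t. (cis (- \<Theta> t) * fst (z t), cis (- \<Theta> t) * snd (z t))) has_vector_derivative
          (cis (- \<Theta> t) * fst (w t) + (- k t *\<^sub>R (\<i> * cis (- \<Theta> t))) * fst (z t),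
           cis (- \<Theta> t) * snd (w t) + (- k t *\<^sub>R (\<i> * cis (- \<Theta> t))) * snd (z t))) (at t within {u..v})"
        by (intro has_vector_derivative_Pair has_vector_derivative_mult dcis
            bounded_linear.has_vector_derivative[OF bounded_linear_fst dz[OF t]]
            bounded_linear.has_vector_derivative[OF bounded_linear_snd dz[OF t]])
      also have "(cis (- \<Theta> t) * fst (w t) + (- k t *\<^sub>R (\<i> * cis (- \<Theta> t))) * fst (z t),
           cis (- \<Theta> t) * snd (w t) + (- k t *\<^sub>R (\<i> * cis (- \<Theta> t))) * snd (z t)) = \<zeta>' t"
        by (simp add: \<zeta>'_def scaleC2_def scaleR_conv_of_real algebra_simps)
      finally show "((\<lambda>t. scaleC2 (cis (- \<Theta> t)) (z t)) has_vector_derivative \<zeta>' t) (at t within {u..v})"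
        by (simp only: scaleC2_def)
      have "herm (scaleC2 (cis (- \<Theta> t)) (z t)) (\<zeta>' t)
          = (cnj (cis (- \<Theta> t)) * cis (- \<Theta> t)) * herm (z t) (w t - scaleC2 (\<i> * k t) (z t))"
        unfolding \<zeta>'_def herm_scaleC2 by (simp only: mult_ac)
      also have "cnj (cis (- \<Theta> t)) * cis (- \<Theta> t) = 1" by (simp add: cis_cnj cis_mult)
      also have "1 * herm (z t) (w t - scaleC2 (\<i> * k t) (z t))
          = herm (z t) (w t) - \<i> * of_real (k t) * of_real ((norm (z t))\<^sup>2)"
        by (simp only: herm_simps herm_scaleC2 herm_self mult_1)
      finally have "Im (herm (scaleC2 (cis (- \<Theta> t)) (z t)) (\<zeta>' t)) = Im (herm (z t) (w t)) - k t * (norm (z t))\<^sup>2"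
        by (simp del: of_real_power)
      then show "Im (herm (scaleC2 (cis (- \<Theta> t)) (z t)) (\<zeta>' t)) = 0"
        using z_nz[OF t] by (simp add: k_def)
    next
      have cont: "continuous_on {u..v} \<Theta>" "continuous_on {u..v} z" "continuous_on {u..v} w"
        unfolding w_def
        by (auto simp: continuous_on_eq_continuous_within[of _ \<Theta>] continuous_on_eq_continuous_within[of _ z]
            intro!: has_vector_derivative_continuous[OF d\<Theta>] has_vector_derivative_continuous[OF dz]
              bounded_linear.continuous_on[OF bounded_linear_jacobi f'(1)])
      have "continuous_on {u..v} (\<lambda>t. cis (- \<Theta> t))"
        unfolding cis_conv_exp by (intro continuous_intros cont)
      then show "continuous_on {u..v} \<zeta>'"
        unfolding \<zeta>'_def scaleC2_def by (intro continuous_intros cont k(1))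
    qed
    then show "horizontal_lift (shape_curve m q) u v (\<lambda>t. scaleC2 (cis (- \<Theta> t)) (jacobi m (q t)))"
      by (simp only: z_def)
  qed (rule horizontal_lift_concat)
  then show ?thesis by (simp only: \<Theta>_def)
qed

section \<open>The angle of rotation\<close>

text \<open>The condition \<open>herm p z \<noteq> 0\<close> says that \<open>b\<close> is not antipodal to the base point. So \<open>cos (\<phi> / 2)\<close> is
  positive, and rescaling the lift to end in \<open>z\<close> multiplies it by a number of the same phase as
  \<open>herm p z\<close>.\<close>

lemma geodesic_lift_to_curve:
  assumes pole: "pole_lift a p" and g: "geodesic_arc a b g" and b: "lifts z b" "b \<in> shape_sphere" and nz: "herm p z \<noteq> 0"
  obtains \<zeta> l where "horizontal_lift g 0 1 \<zeta>" "\<zeta> 0 = scaleC2 l p" "\<zeta> 1 = z" "l \<noteq> 0" "sgn l = sgn (herm p z)"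
proof -
  obtain \<xi> \<phi> where \<xi>: "horizontal_lift g 0 1 \<xi>" "\<xi> 0 = p" "0 \<le> \<phi>" "\<phi> \<le> pi" "herm p (\<xi> 1) = cos (\<phi> / 2)"
    using geodesic_from_pole_lift[OF pole g] by blast
  have "g 1 = b" using g by (simp add: geodesic_arc_def)
  then have "lifts (\<xi> 1) b" using horizontal_lift_lifts[OF \<xi>(1), of 1] by simp
  then obtain l where l: "l \<noteq> 0" "z = scaleC2 l (\<xi> 1)" using lifts_collinear[OF _ b] by blast
  have hz: "herm p z = l * complex_of_real (cos (\<phi> / 2))" by (simp add: l(2) \<xi>(5))
  have "cos (\<phi> / 2) \<ge> 0" using \<xi>(3,4) by (intro cos_ge_zero) auto
  moreover have "cos (\<phi> / 2) \<noteq> 0" using nz hz by auto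
  ultimately have "sgn (herm p z) = sgn l" unfolding hz sgn_mult sgn_of_real by simp
  then show thesis
    using that[OF horizontal_lift_scaleC2[OF \<xi>(1) l(1)]] \<xi>(2) l by simp
qed

text \<open>The three lifts fit together at the corners; the affine maps undo the parametrization by nested
  path concatenation.\<close>

lemma closed_up_curve_lift:
  assumes T: "T > 0" and g: "horizontal_lift g0 0 1 \<xi>0" "horizontal_lift \<gamma> 0 T \<zeta>" "horizontal_lift g1 0 1 \<xi>1"
    and ends: "g0 1 = \<gamma> 0" "g1 0 = \<gamma> T" "\<xi>0 1 = \<zeta> 0" "\<xi>1 0 = \<zeta> T"
  obtains \<eta> where "horizontal_lift (closed_up_curve g0 \<gamma> T g1) 0 1 \<eta>" "\<eta> 0 = \<xi>0 0" "\<eta> 1 = \<xi>1 1"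
proof -
  define c where "c = closed_up_curve g0 \<gamma> T g1"
  define \<eta> where "\<eta> = (\<lambda>u. if u \<le> 1/2 then \<xi>0 (2 * u + 0) else if u \<le> 3/4 then \<zeta> (4 * T * u + - 2 * T) else \<xi>1 (4 * u + - 3))"
  have c1: "c u = g0 (2 * u + 0)" if "u \<in> {0..1/2}" for u
    using that by (simp add: c_def closed_up_curve_def joinpaths_def)
  have c2: "c u = \<gamma> (4 * T * u + - 2 * T)" if "u \<in> {1/2..3/4}" for u
  proof (cases "u = 1/2")
    case True
    show ?thesis unfolding True using ends(1) by (simp add: c_def closed_up_curve_def joinpaths_def)
  next
    case False
    have "T * (2 * (2 * u - 1)) = 4 * T * u + - 2 * T" by (simp add: algebra_simps)
    then show ?thesis using that False by (simp add: c_def closed_up_curve_def joinpaths_def)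
  qed
  have c3: "c u = g1 (4 * u + - 3)" if "u \<in> {3/4..1}" for u
  proof (cases "u = 3/4")
    case True
    show ?thesis unfolding True using ends(2) by (simp add: c_def closed_up_curve_def joinpaths_def)
  next
    case False
    have "2 * (2 * u - 1) - 1 = 4 * u + - 3" by simp
    then show ?thesis using that False by (simp add: c_def closed_up_curve_def joinpaths_def)
  qed
  have 1: "horizontal_lift c 0 (1/2) (\<lambda>u. \<xi>0 (2 * u + 0))"
    by (rule horizontal_lift_affine[OF g(1)]) (use c1 in auto)
  have 2: "horizontal_lift c (1/2) (3/4) (\<lambda>u. \<zeta> (4 * T * u + - 2 * T))"
    by (rule horizontal_lift_affine[OF g(2)]) (use c2 T in auto)
  have 3: "horizontal_lift c (3/4) 1 (\<lambda>u. \<xi>1 (4 * u + - 3))"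
    by (rule horizontal_lift_affine[OF g(3)]) (use c3 in auto)
  have "horizontal_lift c 0 (1/2) \<eta>"
    by (rule horizontal_lift_cong[OF 1]) (auto simp: \<eta>_def)
  moreover have "horizontal_lift c (1/2) (3/4) \<eta>"
  proof (rule horizontal_lift_cong[OF 2 refl])
    show "\<eta> u = \<zeta> (4 * T * u + - 2 * T)" if "u \<in> {1/2..3/4}" for u
    proof (cases "u = 1/2")
      case True
      show ?thesis unfolding True using ends(3) by (simp add: \<eta>_def)
    qed (use that in \<open>simp add: \<eta>_def\<close>)
  qed
  moreover have "horizontal_lift c (3/4) 1 \<eta>"
  proof (rule horizontal_lift_cong[OF 3 refl])
    show "\<eta> u = \<xi>1 (4 * u + - 3)" if "u \<in> {3/4..1}" for u
    proof (cases "u = 3/4")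
      case True
      show ?thesis unfolding True using ends(4) by (simp add: \<eta>_def)
    qed (use that in \<open>simp add: \<eta>_def\<close>)
  qed
  ultimately have "horizontal_lift c 0 1 \<eta>" by (meson horizontal_lift_concat)
  then show thesis by (rule that[unfolded c_def[symmetric]]) (simp_all add: \<eta>_def)
qed

text \<open>Both statements of the theorem are this one, with the two base points. The closed boundary curve is lifted
  horizontally from \<open>l0\<close> times \<open>p\<close> to \<open>l1\<close> times \<open>p\<close>, where \<open>l0\<close> has the phase of
  \<open>herm p (jacobi m (q 0))\<close> and \<open>l1\<close> that of \<open>herm p (jacobi m (q T))\<close> turned back by \<open>\<integral> J / I\<close>.\<close>

lemma rotation_about_pole:
  fixes q :: "real \<Rightarrow> complex ^ 3"
  assumes m: "\<And>i. m $ i > 0" and T: "T > 0" and smooth: "piecewise_smooth_curve 0 T q"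
    and q: "\<And>t. t \<in> {0..T} \<Longrightarrow> q t \<in> config_space m - {0}"
    and pole: "pole_lift a p" and nz: "herm p (jacobi m (q 0)) \<noteq> 0" "herm p (jacobi m (q T)) \<noteq> 0"
    and D: "spanning_disk a (shape_curve m q) T D"
  shows "sgn (herm p (jacobi m (q T))) / sgn (herm p (jacobi m (q 0)))
       = cis (integral {0..T} (\<lambda>t. angular_momentum m q t / inertia m (q t)) + 2 * signed_area D)"
proof -
  define \<Theta> where "\<Theta> = integral {0..T} (\<lambda>t. angular_momentum m q t / inertia m (q t))"
  define \<zeta> where "\<zeta> = (\<lambda>t. scaleC2 (cis (- integral {0..t} (\<lambda>t. angular_momentum m q t / inertia m (q t)))) (jacobi m (q t)))"
  have lift: "horizontal_lift (shape_curve m q) 0 T \<zeta>"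
    unfolding \<zeta>_def by (rule motion_horizontal_lift[OF m T smooth q])
  have \<zeta>0: "\<zeta> 0 = jacobi m (q 0)" by (simp add: \<zeta>_def scaleC2_def)
  have \<zeta>T: "\<zeta> T = scaleC2 (cis (- \<Theta>)) (jacobi m (q T))" by (simp add: \<zeta>_def \<Theta>_def)
  obtain g0 g1 where g: "geodesic_arc a (shape_curve m q 0) g0" "geodesic_arc (shape_curve m q T) a g1"
    and D': "disk_bounded_by D (closed_up_curve g0 (shape_curve m q) T g1)"
    using D unfolding spanning_disk_def by blast
  note g1' = geodesic_arc_reverse[OF g(2)]
  have sphere: "shape_curve m q 0 \<in> shape_sphere" "shape_curve m q T \<in> shape_sphere"
    using geodesic_arc_reverse[OF g(1)] g(2) by (simp_all add: geodesic_arc_def)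
  have zl: "lifts (\<zeta> 0) (shape_curve m q 0)" "lifts (\<zeta> T) (shape_curve m q T)"
    using horizontal_lift_lifts[OF lift] T by simp_all
  have "herm p (\<zeta> 0) \<noteq> 0" "herm p (\<zeta> T) \<noteq> 0" using nz by (simp_all add: \<zeta>0 \<zeta>T)
  note nz' = this
  obtain \<xi>0 l0 where x0: "horizontal_lift g0 0 1 \<xi>0" "\<xi>0 0 = scaleC2 l0 p" "\<xi>0 1 = \<zeta> 0" "l0 \<noteq> 0" "sgn l0 = sgn (herm p (\<zeta> 0))"
    by (rule geodesic_lift_to_curve[OF pole g(1) zl(1) sphere(1) nz'(1)])
  obtain \<xi>1 l1 where x1: "horizontal_lift (\<lambda>u. g1 (1 - u)) 0 1 \<xi>1" "\<xi>1 0 = scaleC2 l1 p" "\<xi>1 1 = \<zeta> T" "l1 \<noteq> 0" "sgn l1 = sgn (herm p (\<zeta> T))"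
    by (rule geodesic_lift_to_curve[OF pole g1' zl(2) sphere(2) nz'(2)])
  have x1': "horizontal_lift g1 0 1 (\<lambda>u. \<xi>1 (1 - u))"
    using horizontal_lift_reverse[OF x1(1)] by simp
  obtain \<eta> where \<eta>: "horizontal_lift (closed_up_curve g0 (shape_curve m q) T g1) 0 1 \<eta>" "\<eta> 0 = \<xi>0 0" "\<eta> 1 = \<xi>1 (1 - 1)"
    by (rule closed_up_curve_lift[OF T x0(1) lift x1'])
       (use g x0(3) x1(3) geodesic_arc_start[OF g(2)] in \<open>auto simp: geodesic_arc_def\<close>)
  have "\<eta> 1 = scaleC2 (l1 / l0) (\<eta> 0)"
    using \<eta>(2,3) x0(2,4) x1(2) by (simp add: scaleC2_def)
  from disk_holonomy[OF \<eta>(1) D' this] have hol: "sgn l1 / sgn l0 = cis (2 * signed_area D)"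
    by (simp add: sgn_divide)
  have "sgn l1 = cis (- \<Theta>) * sgn (herm p (jacobi m (q T)))"
    unfolding x1(5) \<zeta>T herm_scaleC2 sgn_mult sgn_cis ..
  then have "cis (- \<Theta>) * (sgn (herm p (jacobi m (q T))) / sgn (herm p (jacobi m (q 0)))) = cis (2 * signed_area D)"
    using hol unfolding x0(5) \<zeta>0 by simp
  then have "cis \<Theta> * (cis (- \<Theta>) * (sgn (herm p (jacobi m (q T))) / sgn (herm p (jacobi m (q 0))))) = cis (\<Theta> + 2 * signed_area D)"
    by (simp only: cis_mult)
  then show ?thesis
    unfolding \<Theta>_def[symmetric] mult.assoc[symmetric] cis_mult by simp
qed

lemma rcong_Arg_diff:
  assumes "w \<noteq> 0" "z \<noteq> 0" "sgn w / sgn z = cis \<theta>"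
  shows "[Arg w - Arg z = \<theta>] (rmod (2 * pi))"
  unfolding cis_eq_iff[symmetric] using assms by (simp add: cis_divide[symmetric] cis_Arg)

theorem theorem1p1:
  fixes m :: "real ^ 3" and q :: "real \<Rightarrow> complex ^ 3" and T :: real
  assumes "\<forall>i. m $ i > 0"
    and "T > 0"
    and "piecewise_smooth_curve 0 T q"
    and "\<forall>t\<in>{0..T}. q t \<in> config_space m - {0}"
  shows "(q 0 $ 1 \<noteq> 0 \<and> q T $ 1 \<noteq> 0 \<longrightarrow>
           (\<forall>D. spanning_disk C1_pt (shape_curve m q) T D \<longrightarrow>
              [Arg (q T $ 1) - Arg (q 0 $ 1)
                = integral {0..T} (\<lambda>t. angular_momentum m q t / inertia m (q t))
                    + 2 * signed_area D] (rmod (2 * pi)))) \<and>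
         (q 0 $ 3 - q 0 $ 2 \<noteq> 0 \<and> q T $ 3 - q T $ 2 \<noteq> 0 \<longrightarrow>
           (\<forall>D. spanning_disk O1_pt (shape_curve m q) T D \<longrightarrow>
              [Arg (q T $ 3 - q T $ 2) - Arg (q 0 $ 3 - q 0 $ 2)
                = integral {0..T} (\<lambda>t. angular_momentum m q t / inertia m (q t))
                    + 2 * signed_area D] (rmod (2 * pi))))"
proof -
  have m: "m $ i > 0" for i using assms(1) by blast
  have q: "q t \<in> config_space m - {0}" if "t \<in> {0..T}" for t using assms(4) that by blast
  define s where "s = m $ 2 + m $ 3"
  have s: "s > 0" using m[of 2] m[of 3] by (simp add: s_def)
  have "1 / m $ 2 + 1 / m $ 3 > 0" "1 / m $ 1 + 1 / s > 0"
    using m s by (simp_all add: add_pos_pos)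
  then have mu: "mu1 m > 0" "mu2 m > 0" by (simp_all add: mu1_def mu2_def s_def)
  have herm_O1: "herm (1, 0) (jacobi m x) = mu1 m *\<^sub>R (x $ 3 - x $ 2)" for x
    by (simp add: herm_def jacobi_def jacobi1_def)
  have herm_C1: "herm (0, 1) (jacobi m x) = (mu2 m * (1 + m $ 1 / s)) *\<^sub>R x $ 1" if "x \<in> config_space m" for x
  proof -
    have "m $ 2 *\<^sub>R x $ 2 + m $ 3 *\<^sub>R x $ 3 = - (m $ 1 *\<^sub>R x $ 1)"
      using that by (simp add: config_space_def sum_3 eq_neg_iff_add_eq_0 add_ac)
    then show ?thesis
      by (simp add: herm_def jacobi_def jacobi2_def s_def[symmetric] scaleR_add_left divide_inverse mult.commute
          flip: scaleR_scaleR)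
  qed
  have r: "mu2 m * (1 + m $ 1 / s) > 0" using mu(2) m[of 1] s by (simp add: add_pos_pos)
  have sgn_pos: "sgn (k *\<^sub>R w) = sgn w" if "k > 0" for k and w :: complex
    using that by (simp add: sgn_scaleR)
  have q0T: "q 0 \<in> config_space m" "q T \<in> config_space m" using q assms(2) by auto
  show ?thesis
  proof (intro conjI impI allI)
    fix D assume nz: "q 0 $ 1 \<noteq> 0 \<and> q T $ 1 \<noteq> 0" and D: "spanning_disk C1_pt (shape_curve m q) T D"
    have pole: "pole_lift C1_pt (0, 1)" by (simp add: pole_lift_def)
    have "herm (0, 1) (jacobi m (q 0)) \<noteq> 0" "herm (0, 1) (jacobi m (q T)) \<noteq> 0"
      unfolding herm_C1[OF q0T(1)] herm_C1[OF q0T(2)] using nz r by auto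
    from rotation_about_pole[OF m assms(2,3) q pole this D]
    show "[Arg (q T $ 1) - Arg (q 0 $ 1)
                = integral {0..T} (\<lambda>t. angular_momentum m q t / inertia m (q t))
                    + 2 * signed_area D] (rmod (2 * pi))"
      unfolding herm_C1[OF q0T(1)] herm_C1[OF q0T(2)] sgn_pos[OF r] using nz by (intro rcong_Arg_diff) auto
  next
    fix D assume nz: "q 0 $ 3 - q 0 $ 2 \<noteq> 0 \<and> q T $ 3 - q T $ 2 \<noteq> 0" and D: "spanning_disk O1_pt (shape_curve m q) T D"
    have pole: "pole_lift O1_pt (1, 0)" by (simp add: pole_lift_def)
    have "herm (1, 0) (jacobi m (q 0)) \<noteq> 0" "herm (1, 0) (jacobi m (q T)) \<noteq> 0"
      unfolding herm_O1 using nz mu(1) by auto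
    from rotation_about_pole[OF m assms(2,3) q pole this D]
    show "[Arg (q T $ 3 - q T $ 2) - Arg (q 0 $ 3 - q 0 $ 2)
                = integral {0..T} (\<lambda>t. angular_momentum m q t / inertia m (q t))
                    + 2 * signed_area D] (rmod (2 * pi))"
      unfolding herm_O1 sgn_pos[OF mu(1)] using nz by (intro rcong_Arg_diff) auto
  qed
qed

end
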